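(* For any positive integer $s$, $\dim_{\mathbb F_2} (QP_5)_{15\cdot 2^s-5} = 1240$.
   Context: $P_n=\mathbb F_2[x_1,\ldots,x_n]$ is the graded polynomial algebra over the field $\mathbb F_2$ of two elements with $\deg x_i=1$. It is a module over the mod-2 Steenrod algebra $\mathcal A$: the Steenrod squares satisfy $Sq^0=\mathrm{id}$, $Sq^1(x_i)=x_i^2$, $Sq^k(x_i)=0$ for $k>1$, and the Cartan formula $Sq^k(fg)=\sum_{i=0}^k Sq^i(f)Sq^{k-i}(g)$. $\mathcal A^+$ is the augmentation ideal of $\mathcal A$, so $\mathcal A^+P_n$ is the span of all $Sq^j(g)$ with $j>0$, $g\in P_n$. $QP_n:=P_n/\mathcal A^+P_n=\mathbb F_2\otimes_{\mathcal A}P_n$, and $(QP_n)_d$ is its degree $d$ part, consisting of classes of homogeneous polynomials of degree $d$. *)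

theory Defs
  imports
    "HOL-Library.Poly_Mapping"
    "HOL-Library.Z2"
    "HOL-Library.Numeral_Type"
    "HOL-Computational_Algebra.Polynomial"
begin

section \<open>Polynomials over the field with two elements\<close>

text \<open>
  The variables are indexed by a finite type \<^typ>\<open>'n\<close>, so that \<^typ>\<open>'n\<close> of cardinality \<open>n\<close>
  gives \<open>P\<^sub>n\<close>.  Exponent vectors are finitely supported maps \<open>'n \<Rightarrow>\<^sub>0 nat\<close>, and the ring
  structure is the (convolution) one of \<^theory>\<open>HOL-Library.Poly_Mapping\<close>.
\<close>

(* by default sums and products in bit are rewritten to bit operations *)
declare add_bit_eq_xor [simp del] mult_bit_eq_and [simp del]

type_synonym 'n f2poly = "('n \<Rightarrow>\<^sub>0 nat) \<Rightarrow>\<^sub>0 bit"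

definition Var :: "'n \<Rightarrow> 'n f2poly"
  where "Var i = Poly_Mapping.single (Poly_Mapping.single i 1) 1"

definition scaleP :: "bit \<Rightarrow> 'n f2poly \<Rightarrow> 'n f2poly"
  where "scaleP c f = Poly_Mapping.map ((*) c) f"

definition mono_deg :: "('n::finite \<Rightarrow>\<^sub>0 nat) \<Rightarrow> nat"
  where "mono_deg m = (\<Sum>i\<in>UNIV. Poly_Mapping.lookup m i)"

definition homogeneous :: "nat \<Rightarrow> 'n::finite f2poly set"
  where "homogeneous d = {f. \<forall>m\<in>Poly_Mapping.keys f. mono_deg m = d}"

lemma scaleP_conv_mult: "scaleP c f = Poly_Mapping.single 0 c * f"
  by (simp only: scaleP_def mult_map_scale_conv_mult)

interpretation P: vector_space "scaleP :: bit \<Rightarrow> 'n f2poly \<Rightarrow> 'n f2poly"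
proof
  fix a b :: bit and x y :: "'n f2poly"
  show "scaleP a (x + y) = scaleP a x + scaleP a y"
    by (simp add: scaleP_conv_mult distrib_left)
  show "scaleP (a + b) x = scaleP a x + scaleP b x"
    by (simp only: scaleP_conv_mult single_add distrib_right)
  show "scaleP a (scaleP b x) = scaleP (a * b) x"
    by (simp add: scaleP_conv_mult mult_single flip: mult.assoc)
  show "scaleP 1 x = x"
    by (simp add: scaleP_conv_mult)
qed

section \<open>Steenrod squares\<close>

text \<open>
  The properties determining the action of the squares on \<open>P\<^sub>n\<close>; additivity is the same as
  \<open>F\<^sub>2\<close>-linearity.  Exactly one family of operations has them (\<open>steenrod_squares_ex1\<close> below).
\<close>

definition steenrod_squares :: "(nat \<Rightarrow> 'n::finite f2poly \<Rightarrow> 'n f2poly) \<Rightarrow> bool"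
  where "steenrod_squares S \<longleftrightarrow>
    (\<forall>k f g. S k (f + g) = S k f + S k g) \<and>
    (\<forall>f. S 0 f = f) \<and>
    (\<forall>i. S 1 (Var i) = Var i ^ 2) \<and>
    (\<forall>k i. 1 < k \<longrightarrow> S k (Var i) = 0) \<and>
    (\<forall>k f g. S k (f * g) = (\<Sum>i\<le>k. S i f * S (k - i) g))"

text \<open>
  Existence uses the total square, the ring homomorphism from \<open>P\<^sub>n\<close> to \<open>P\<^sub>n[t]\<close> with
  \<open>x\<^sub>i \<mapsto> x\<^sub>i + t x\<^sub>i\<^sup>2\<close>; \<open>Sq\<^sup>k\<close> is its coefficient at \<open>t\<^sup>k\<close>.
\<close>

definition tsq_mono :: "('n::finite \<Rightarrow>\<^sub>0 nat) \<Rightarrow> 'n f2poly poly"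
  where "tsq_mono m = (\<Prod>i\<in>UNIV. [:Var i, Var i ^ 2:] ^ Poly_Mapping.lookup m i)"

definition tsq :: "'n::finite f2poly \<Rightarrow> 'n f2poly poly"
  where "tsq f = (\<Sum>m\<in>Poly_Mapping.keys f.
    smult (Poly_Mapping.single 0 (Poly_Mapping.lookup f m)) (tsq_mono m))"

lemma f2poly_induct [case_names zero mono add]:
  fixes f :: "'n f2poly"
  assumes z: "Q 0" and m: "\<And>m. Q (Poly_Mapping.single m 1)"
    and a: "\<And>f g. Q f \<Longrightarrow> Q g \<Longrightarrow> Q (f + g)"
  shows "Q f"
proof (induction f rule: update_induct)
  case const
  show ?case by (rule z)
next
  case (update f k v)
  have "v = 1" using update.hyps(2) by simp
  have "Poly_Mapping.update k v f = f + Poly_Mapping.single k 1"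
    using update.hyps(1) \<open>v = 1\<close>
    by (intro poly_mapping_eqI)
      (auto simp add: lookup_update lookup_add lookup_single when_def in_keys_iff)
  then show ?case using a[OF update.IH m] \<open>v = 1\<close> by simp
qed

lemma tsq_mono_add: "tsq_mono (a + b) = tsq_mono a * tsq_mono b"
  by (simp add: tsq_mono_def lookup_add power_add prod.distrib)

lemma tsq_superset:
  assumes "finite A" "Poly_Mapping.keys f \<subseteq> A"
  shows "tsq f = (\<Sum>m\<in>A. smult (Poly_Mapping.single 0 (Poly_Mapping.lookup f m)) (tsq_mono m))"
  unfolding tsq_def using assms
  by (intro sum.mono_neutral_left) (auto simp: in_keys_iff)

lemma tsq_add: "tsq (f + g) = tsq f + tsq g"
proof -
  let ?A = "Poly_Mapping.keys f \<union> Poly_Mapping.keys g"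
  have "Poly_Mapping.keys (f + g) \<subseteq> ?A" by (rule keys_add)
  then show ?thesis
    by (simp only: tsq_superset[of ?A] finite_UnI finite_keys Un_upper1 Un_upper2
        lookup_add single_add smult_add_left sum.distrib)
qed

lemma tsq_zero [simp]: "tsq 0 = 0"
  by (simp add: tsq_def)

lemma tsq_single [simp]: "tsq (Poly_Mapping.single m 1) = tsq_mono m"
  by (simp add: tsq_def)

lemma tsq_mult: "tsq (f * g) = tsq f * tsq g"
proof (induction f rule: f2poly_induct)
  case (mono a)
  show ?case
  proof (induction g rule: f2poly_induct)
    case (mono b)
    then show ?case by (simp add: mult_single tsq_mono_add)
  qed (simp_all add: tsq_add distrib_left)
qed (simp_all add: tsq_add distrib_right)

lemma tsq_Var: "tsq (Var i) = [:Var i, Var i ^ 2:]"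
proof -
  have "tsq (Var i) = (\<Prod>j\<in>UNIV. if j = i then [:Var i, Var i ^ 2:] else 1)"
    unfolding Var_def tsq_single tsq_mono_def
    by (intro prod.cong) (auto simp: lookup_single when_def)
  then show ?thesis by simp
qed

lemma Var_power: "Var i ^ k = Poly_Mapping.single (Poly_Mapping.single i k) 1"
  by (induction k) (simp_all add: Var_def mult_single single_add[symmetric])

lemma prod_single_one:
  "finite A \<Longrightarrow> (\<Prod>i\<in>A. Poly_Mapping.single (e i) (1::bit)) = Poly_Mapping.single (\<Sum>i\<in>A. e i) 1"
  by (induction A rule: finite_induct) (simp_all add: mult_single)

lemma mono_eq_prod:
  fixes m :: "'n::finite \<Rightarrow>\<^sub>0 nat"
  shows "Poly_Mapping.single m (1::bit) = (\<Prod>i\<in>UNIV. Var i ^ Poly_Mapping.lookup m i)"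
proof -
  have "(\<Sum>i\<in>UNIV. Poly_Mapping.single i (Poly_Mapping.lookup m i)) = m"
    by (intro poly_mapping_eqI) (simp add: lookup_sum lookup_single when_def)
  then show ?thesis by (simp add: Var_power prod_single_one)
qed

lemma coeff_0_tsq: "coeff (tsq f) 0 = f"
proof (induction f rule: f2poly_induct)
  case (mono m)
  have c: "coeff p 0 = poly p 0" for p :: "'a f2poly poly" by (simp add: poly_0_coeff_0)
  show ?case by (simp add: c tsq_mono_def poly_prod flip: mono_eq_prod)
qed (simp_all add: tsq_add)

lemma steenrod_squares_tsq: "steenrod_squares (\<lambda>k f. coeff (tsq f) k)"
  by (simp add: steenrod_squares_def tsq_add coeff_0_tsq tsq_Var tsq_mult coeff_mult
      coeff_pCons split: nat.split)

lemma steenrod_squares_one: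
  assumes "steenrod_squares S" "0 < k"
  shows "S k 1 = 0"
  using \<open>0 < k\<close>
proof (induction k rule: less_induct)
  case (less k)
  have cartan: "S k (1 * 1) = (\<Sum>i\<le>k. S i 1 * S (k - i) 1)" and S0: "S 0 1 = 1"
    using assms(1)[unfolded steenrod_squares_def] by (metis, metis)
  have "(\<Sum>i\<le>k. S i 1 * S (k - i) 1) = (\<Sum>i\<in>{0,k}. S i 1 * S (k - i) 1)"
    using less by (intro sum.mono_neutral_right) auto
  also have "\<dots> = S k 1 + S k 1" using less.prems S0 by simp
  finally show ?case using cartan by simp
qed

lemma steenrod_squares_unique:
  assumes S: "steenrod_squares S" and T: "steenrod_squares T"
  shows "S = T"
proof -
  have Sadd: "S k (f + g) = S k f + S k g" and Tadd: "T k (f + g) = T k f + T k g"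
    and S0: "S 0 f = f" and T0: "T 0 f = f"
    and Smult: "S k (f * g) = (\<Sum>i\<le>k. S i f * S (k - i) g)"
    and Tmult: "T k (f * g) = (\<Sum>i\<le>k. T i f * T (k - i) g)"
    and SV: "S 1 (Var i) = Var i ^ 2" "1 < k \<Longrightarrow> S k (Var i) = 0"
    and TV: "T 1 (Var i) = Var i ^ 2" "1 < k \<Longrightarrow> T k (Var i) = 0" for k f g i
    using S[unfolded steenrod_squares_def] T[unfolded steenrod_squares_def] by simp_all
  have one: "S k 1 = T k 1" for k
    using steenrod_squares_one[OF S, of k] steenrod_squares_one[OF T, of k] S0 T0
    by (cases k) auto
  have var: "S k (Var i) = T k (Var i)" for k i
    using S0 T0 SV TV by (cases "k = 0"; cases "k = 1") auto
  have mult: "\<forall>k. S k (f * g) = T k (f * g)"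
    if "\<forall>k. S k f = T k f" "\<forall>k. S k g = T k g" for f g
    using that by (simp add: Smult Tmult)
  have pow: "\<forall>k. S k (Var i ^ e) = T k (Var i ^ e)" for i e
    by (induction e) (use one var mult in auto)
  have prod: "\<forall>k. S k (\<Prod>i\<in>A. Var i ^ e i) = T k (\<Prod>i\<in>A. Var i ^ e i)" if "finite A" for A e
    using that by (induction A rule: finite_induct) (use one pow mult in auto)
  have "\<forall>k. S k f = T k f" for f
  proof (induction f rule: f2poly_induct)
    case zero
    have "S k 0 = 0" "T k 0 = 0" for k using Sadd[of k 0 0] Tadd[of k 0 0] by simp_all
    then show ?case by simp
  next
    case (mono m)
    then show ?case by (simp add: mono_eq_prod prod)
  next
    case (add f g)
    then show ?case by (simp add: Sadd Tadd)
  qed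
  then show ?thesis by blast
qed

lemma steenrod_squares_ex1: "\<exists>!S. steenrod_squares S"
  using steenrod_squares_tsq steenrod_squares_unique by blast

definition Sq :: "nat \<Rightarrow> 'n::finite f2poly \<Rightarrow> 'n f2poly"
  where "Sq = (THE S. steenrod_squares S)"

lemma steenrod_squares_Sq: "steenrod_squares Sq"
  unfolding Sq_def by (rule theI'[OF steenrod_squares_ex1])

section \<open>The quotient by the hit polynomials\<close>

text \<open>
  \<open>hit\<close> is \<open>\<A>\<^sup>+P\<^sub>n\<close>, where \<open>\<A>\<^sup>+\<close> is the augmentation ideal of the Steenrod algebra,
  and \<open>'n QP\<close> is \<open>P\<^sub>n/\<A>\<^sup>+P\<^sub>n\<close>.
\<close>

definition hit :: "'n::finite f2poly set"
  where "hit = P.span {Sq j g | j g. 0 < j}"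

definition hit_equiv :: "'n::finite f2poly \<Rightarrow> 'n f2poly \<Rightarrow> bool"
  where "hit_equiv f g \<longleftrightarrow> f - g \<in> hit"

lemma subspace_hit: "P.subspace hit"
  by (simp add: hit_def)

lemmas hit_closed =
  P.subspace_0[OF subspace_hit] P.subspace_add[OF subspace_hit] P.subspace_diff[OF subspace_hit]
  P.subspace_neg[OF subspace_hit] P.subspace_scale[OF subspace_hit]

lemma equivp_hit_equiv: "equivp hit_equiv"
proof (rule equivpI)
  show "reflp hit_equiv" by (simp add: reflp_def hit_equiv_def hit_closed)
  show "symp hit_equiv"
    using hit_closed(4) by (fastforce simp: symp_def hit_equiv_def)
  show "transp hit_equiv"
    using hit_closed(2) by (fastforce simp: transp_def hit_equiv_def)
qed

quotient_type 'n QP = "'n::finite f2poly" / hit_equiv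
  by (rule equivp_hit_equiv)

instantiation QP :: (finite) ab_group_add
begin

lift_definition zero_QP :: "'a QP" is 0 .

lift_definition plus_QP :: "'a QP \<Rightarrow> 'a QP \<Rightarrow> 'a QP" is "(+)"
  by (simp add: hit_equiv_def add_diff_add hit_closed(2))

lift_definition uminus_QP :: "'a QP \<Rightarrow> 'a QP" is uminus
  using hit_closed(4) by (fastforce simp: hit_equiv_def)

lift_definition minus_QP :: "'a QP \<Rightarrow> 'a QP \<Rightarrow> 'a QP" is "(-)"
proof -
  fix a b c d :: "'a f2poly"
  assume "hit_equiv a b" "hit_equiv c d"
  then have "(a - b) - (c - d) \<in> hit" by (simp add: hit_equiv_def hit_closed(3))
  moreover have "(a - b) - (c - d) = (a - c) - (b - d)" by (simp add: algebra_simps)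
  ultimately show "hit_equiv (a - c) (b - d)" by (simp only: hit_equiv_def)
qed

instance
  by standard (transfer; simp add: hit_equiv_def hit_closed algebra_simps)+

end

lift_definition scaleQP :: "bit \<Rightarrow> 'n::finite QP \<Rightarrow> 'n QP" is scaleP
  by (simp add: hit_equiv_def hit_closed(5) flip: P.scale_right_diff_distrib)

interpretation QP: vector_space "scaleQP :: bit \<Rightarrow> 'n::finite QP \<Rightarrow> 'n QP"
  by standard (transfer; simp add: hit_equiv_def hit_closed P.scale_right_distrib P.scale_left_distrib)+

definition QP_deg :: "nat \<Rightarrow> 'n::finite QP set"
  where "QP_deg d = abs_QP ` homogeneous d"

lemma subspace_homogeneous: "P.subspace (homogeneous d)"
  unfolding P.subspace_def homogeneous_def
  by (auto simp: scaleP_def in_keys_iff lookup_add Poly_Mapping.map.rep_eq when_def split: if_splits)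

lemma subspace_QP_deg: "QP.subspace (QP_deg d)"
  unfolding QP.subspace_def QP_deg_def
  using P.subspace_0[OF subspace_homogeneous] P.subspace_add[OF subspace_homogeneous]
    P.subspace_scale[OF subspace_homogeneous]
  by (auto simp: zero_QP.abs_eq plus_QP.abs_eq scaleQP.abs_eq intro!: imageI)

end

theory Submission
  imports Defs "HOL-Algebra.Algebraic_Closure_Type"
begin

text \<open>
  Extend the scalars to an algebraic closure \<open>K\<close> of \<open>F\<^sub>2\<close>. A self-dual normal basis of the field with 32
  elements gives a linear change of variables that turns the total square \<open>x\<^sub>i \<mapsto> x\<^sub>i + x\<^sub>i\<^sup>2\<close> into
  \<open>u\<^sub>i \<mapsto> u\<^sub>i + u\<^sub>i\<^sub>-\<^sub>1\<^sup>2\<close>. In the new variables the hit problem is graded by the weight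
  \<open>\<Sum> 2\<^sup>i e\<^sub>i\<close> modulo 31 of a monomial with exponents \<open>e\<^sub>i\<close>, and it is symmetric under the rotation of the variables.

  In degree \<open>15 \<cdot> 2\<^sup>s - 5\<close>, \<open>s \<ge> 2\<close>, the \<open>\<chi>\<close>-trick shows that every monomial with an even exponent is hit, so
  Kameko's map identifies the quotient with the one for \<open>s - 1\<close>; all of them reduce to degree 25.

  In degree 25 a certificate settles the dimension. Eight functionals vanish on all hit polynomials, and their 5
  rotations restricted to the 31 weights are 1240 functionals dual to a list of 1240 monomials; conversely
  explicit hit relations rewrite every other monomial by monomials of lower rank, ending in that list.
\<close>

text \<open>Linear changes of variables over F_2 commute with the squares. Identifying F_2^5 with
  the field of 32 elements singles out multiplication by nonzero field elements, a cyclic group of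
  order 31, and Frobenius, of order 5. The former is diagonalizable only after extending the
  scalars: in the variables \<open>u_i\<close> it becomes the grading by weight, and Frobenius
  becomes the rotation. Yet the twisted total square has coefficients 0 and 1, so the certificate
  consists of bits although the ground field is \<open>K\<close>. The count 1240 = 31 * 5 * 8 says
  that each weight has dimension 40. The descent stops at degree 25 for a reason. The trick shows
  that a monomial with set \<open>A\<close> of odd exponents and square part \<open>y^2\<close> is
  hit unless |A| + deg y is a sum of |A| powers of 2. In degree 25 with |A| = 3 this number is 14 =
  2 + 4 + 8. With |A| = 1 it is 13 and the trick still works, so that only three or five odd
  exponents remain: 10 * 1365 + 1001 monomials, of which the rotation leaves 2 * 1365 + 1001 to be
  certified.\<close>

type_synonym ('n, 'a) mpol = "('n \<Rightarrow>\<^sub>0 nat) \<Rightarrow>\<^sub>0 'a"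

definition smul :: "'a::field \<Rightarrow> ('n, 'a) mpol \<Rightarrow> ('n, 'a) mpol"
  where "smul c f = Poly_Mapping.single 0 c * f"

abbreviation mon :: "('n \<Rightarrow>\<^sub>0 nat) \<Rightarrow> ('n, 'a::field) mpol"
  where "mon m \<equiv> Poly_Mapping.single m 1"

lemma lookup_smul [simp]: "Poly_Mapping.lookup (smul c f) m = c * Poly_Mapping.lookup f m"
  unfolding smul_def mult_map_scale_conv_mult[symmetric]
  by (simp add: Poly_Mapping.map.rep_eq when_def)

lemma smul_single [simp]: "smul c (Poly_Mapping.single m d) = Poly_Mapping.single m (c * d)"
  by (simp add: smul_def mult_single)

lemma smul_mult_left: "smul c f * g = smul c (f * g)"
  and smul_mult_right: "f * smul c g = smul c (f * g)"
  by (simp_all add: smul_def ac_simps)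

interpretation MP: vector_space "smul :: 'a::field \<Rightarrow> ('n, 'a) mpol \<Rightarrow> ('n, 'a) mpol"
  by standard (auto intro!: poly_mapping_eqI simp: lookup_add algebra_simps)

lemma mpol_induct [case_names zero single add]:
  fixes f :: "('n, 'a::comm_monoid_add) mpol"
  assumes z: "Q 0" and m: "\<And>m c. Q (Poly_Mapping.single m c)"
    and a: "\<And>f g. Q f \<Longrightarrow> Q g \<Longrightarrow> Q (f + g)"
  shows "Q f"
proof (induction f rule: update_induct)
  case const
  show ?case by (rule z)
next
  case (update f k v)
  have "Poly_Mapping.update k v f = f + Poly_Mapping.single k v"
    using update.hyps(1)
    by (intro poly_mapping_eqI)
      (auto simp add: lookup_update lookup_add lookup_single when_def in_keys_iff)
  then show ?case using a[OF update.IH m] by simp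
qed

lemma MP_additive_span:
  assumes add: "\<And>x y. f (x + y) = f x + f y" and sc: "\<And>c x. f (smul c x) = smul c (f x)"
    and A: "\<And>x. x \<in> A \<Longrightarrow> f x \<in> MP.span B" and x: "x \<in> MP.span A"
  shows "f x \<in> MP.span B"
  using x
proof (induction rule: MP.span_induct_alt)
  case base
  have "f 0 = 0" using sc[of 0 0] by simp
  then show ?case by (simp add: MP.span_zero)
next
  case (step c x y)
  then show ?case by (simp add: add sc MP.span_add MP.span_scale A)
qed

section \<open>Linear extension and substitution\<close>

definition lext :: "(('n \<Rightarrow>\<^sub>0 nat) \<Rightarrow> ('k, 'a::field) mpol) \<Rightarrow> ('n, 'a) mpol \<Rightarrow> ('k, 'a) mpol"
  where "lext \<phi> f = (\<Sum>m\<in>Poly_Mapping.keys f. smul (Poly_Mapping.lookup f m) (\<phi> m))"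

lemma lext_superset:
  assumes "finite A" "Poly_Mapping.keys f \<subseteq> A"
  shows "lext \<phi> f = (\<Sum>m\<in>A. smul (Poly_Mapping.lookup f m) (\<phi> m))"
  unfolding lext_def using assms
  by (intro sum.mono_neutral_left) (auto simp: in_keys_iff)

lemma lext_add: "lext \<phi> (f + g) = lext \<phi> f + lext \<phi> g"
proof -
  let ?A = "Poly_Mapping.keys f \<union> Poly_Mapping.keys g"
  have "Poly_Mapping.keys (f + g) \<subseteq> ?A" by (rule keys_add)
  then show ?thesis
    by (simp only: lext_superset[of ?A] finite_UnI finite_keys Un_upper1 Un_upper2
        lookup_add MP.scale_left_distrib sum.distrib)
qed

lemma lext_0 [simp]: "lext \<phi> 0 = 0"
  by (simp add: lext_def)

lemma lext_single [simp]: "lext \<phi> (Poly_Mapping.single m c) = smul c (\<phi> m)"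
  by (cases "c = 0") (simp_all add: lext_def)

lemma lext_smul: "lext \<phi> (smul c f) = smul c (lext \<phi> f)"
  by (induction f rule: mpol_induct) (simp_all add: lext_add MP.scale_right_distrib)

lemma lext_diff: "lext \<phi> (f - g) = lext \<phi> f - lext \<phi> g"
  by (metis add_diff_cancel_right' diff_add_cancel lext_add)

lemma lext_sum: "lext \<phi> (sum g A) = (\<Sum>x\<in>A. lext \<phi> (g x))"
  by (induction A rule: infinite_finite_induct) (simp_all add: lext_add)

definition subst :: "('n::finite \<Rightarrow> ('k, 'a::field) mpol) \<Rightarrow> ('n, 'a) mpol \<Rightarrow> ('k, 'a) mpol"
  where "subst \<phi> = lext (\<lambda>m. \<Prod>i\<in>UNIV. \<phi> i ^ Poly_Mapping.lookup m i)"

lemma subst_add: "subst \<phi> (f + g) = subst \<phi> f + subst \<phi> g"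
  and subst_smul: "subst \<phi> (smul c f) = smul c (subst \<phi> f)"
  and subst_sum: "subst \<phi> (sum h A) = (\<Sum>x\<in>A. subst \<phi> (h x))"
  by (simp_all add: subst_def lext_add lext_smul lext_sum)

lemmas subst_linear = subst_add subst_smul subst_sum

lemma subst_0 [simp]: "subst \<phi> 0 = 0"
  by (simp add: subst_def)

lemma subst_mon: "subst \<phi> (mon m) = (\<Prod>i\<in>UNIV. \<phi> i ^ Poly_Mapping.lookup m i)"
  by (simp add: subst_def)

lemma subst_single: "subst \<phi> (Poly_Mapping.single m c) = smul c (subst \<phi> (mon m))"
  by (simp add: subst_def)

lemma subst_1 [simp]: "subst \<phi> 1 = 1"
  using subst_mon[of \<phi> 0] by simp

lemma subst_mult: "subst \<phi> (f * g) = subst \<phi> f * subst \<phi> g"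
proof (induction f rule: mpol_induct)
  case (single a c)
  show ?case
  proof (induction g rule: mpol_induct)
    case (single b d)
    have "subst \<phi> (mon (a + b)) = subst \<phi> (mon a) * subst \<phi> (mon b)"
      by (simp add: subst_mon lookup_add power_add prod.distrib)
    then show ?case
      by (simp add: mult_single subst_single[of _ _ c] subst_single[of _ _ d]
          subst_single[of _ _ "c * d"] smul_mult_left smul_mult_right mult.commute)
  qed (simp_all add: subst_linear distrib_left)
qed (simp_all add: subst_linear distrib_right)

lemma subst_power: "subst \<phi> (f ^ k) = subst \<phi> f ^ k"
  by (induction k) (simp_all add: subst_mult)

lemma subst_prod: "subst \<phi> (prod g A) = (\<Prod>x\<in>A. subst \<phi> (g x))"
  by (induction A rule: infinite_finite_induct) (simp_all add: subst_mult)

definition var :: "'n \<Rightarrow> ('n, 'a::field) mpol"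
  where "var i = mon (Poly_Mapping.single i 1)"

lemma subst_var [simp]: "subst \<phi> (var i) = \<phi> i"
proof -
  have "subst \<phi> (var i) = (\<Prod>j\<in>UNIV. if j = i then \<phi> i else 1)"
    unfolding var_def subst_mon by (intro prod.cong) (auto simp: lookup_single when_def)
  then show ?thesis by simp
qed

lemma var_power: "var i ^ k = mon (Poly_Mapping.single i k)"
  by (induction k) (simp_all add: var_def mult_single single_add[symmetric])

lemma prod_mon: "finite A \<Longrightarrow> (\<Prod>i\<in>A. mon (e i)) = mon (\<Sum>i\<in>A. e i)"
  by (induction A rule: finite_induct) (simp_all add: mult_single)

lemma mon_eq_prod: "mon m = (\<Prod>i\<in>UNIV. var i ^ Poly_Mapping.lookup m (i :: 'n::finite))"
proof -
  have "(\<Sum>i\<in>UNIV. Poly_Mapping.single i (Poly_Mapping.lookup m i)) = m"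
    by (intro poly_mapping_eqI) (simp add: lookup_sum lookup_single when_def)
  then show ?thesis by (simp add: var_power prod_mon)
qed

lemma subst_comp: "subst \<phi> (subst \<psi> f) = subst (\<lambda>i. subst \<phi> (\<psi> i)) f"
proof (induction f rule: mpol_induct)
  case (single m c)
  show ?case
    by (simp add: subst_single[of _ m c] subst_single[of \<psi> m c] subst_linear subst_mon subst_prod subst_power)
qed (simp_all add: subst_linear)

lemma subst_id: "subst var f = f"
proof (induction f rule: mpol_induct)
  case (single m c)
  show ?case
    by (simp add: subst_single[of _ m c] subst_mon flip: mon_eq_prod)
qed (simp_all add: subst_linear)

section \<open>Homogeneous components\<close>

lemma mono_deg_0 [simp]: "mono_deg 0 = 0"
  by (simp add: mono_deg_def)

lemma mono_deg_add [simp]: "mono_deg (a + b) = mono_deg a + mono_deg b"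
  by (simp add: mono_deg_def lookup_add sum.distrib)

lemma mono_deg_sum: "mono_deg (sum f A) = (\<Sum>x\<in>A. mono_deg (f x))"
  by (induction A rule: infinite_finite_induct) simp_all

lemma mono_deg_single [simp]: "mono_deg (Poly_Mapping.single i k) = k"
  by (simp add: mono_deg_def lookup_single when_def)

definition hc :: "nat \<Rightarrow> ('n::finite, 'a::field) mpol \<Rightarrow> ('n, 'a) mpol"
  where "hc d = lext (\<lambda>m. if mono_deg m = d then mon m else 0)"

lemma hc_mon [simp]: "hc d (mon m) = (if mono_deg m = d then mon m else 0)"
  by (simp add: hc_def)

lemma hc_single: "hc d (Poly_Mapping.single m c) = (if mono_deg m = d then Poly_Mapping.single m c else 0)"
  by (simp add: hc_def)

lemma hc_0 [simp]: "hc d 0 = 0"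
  by (simp add: hc_def)

lemma hc_add: "hc d (f + g) = hc d f + hc d g"
  and hc_smul: "hc d (smul c f) = smul c (hc d f)"
  and hc_sum: "hc d (sum h A) = (\<Sum>x\<in>A. hc d (h x))"
  and hc_diff: "hc d (f - g) = hc d f - hc d g"
  by (simp_all add: hc_def lext_add lext_smul lext_sum lext_diff)

lemma lookup_hc: "Poly_Mapping.lookup (hc d f) m = (if mono_deg m = d then Poly_Mapping.lookup f m else 0)"
  by (induction f rule: mpol_induct) (auto simp: hc_add lookup_add hc_single lookup_single when_def)

definition hom :: "nat \<Rightarrow> ('n::finite, 'a::field) mpol set"
  where "hom d = {f. hc d f = f}"

lemma hom_iff: "f \<in> hom d \<longleftrightarrow> (\<forall>m\<in>Poly_Mapping.keys f. mono_deg m = d)"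
proof -
  have "hc d f = f \<longleftrightarrow> (\<forall>m. Poly_Mapping.lookup (hc d f) m = Poly_Mapping.lookup f m)"
    by (metis poly_mapping_eqI)
  then show ?thesis
    by (auto simp: hom_def lookup_hc in_keys_iff)
qed

lemma hc_hom: "f \<in> hom e \<Longrightarrow> hc d f = (if d = e then f else 0)"
proof (intro poly_mapping_eqI)
  fix m assume "f \<in> hom e"
  then have "Poly_Mapping.lookup f m = 0 \<or> mono_deg m = e"
    by (auto simp: hom_iff in_keys_iff)
  then show "Poly_Mapping.lookup (hc d f) m = Poly_Mapping.lookup (if d = e then f else 0) m"
    by (auto simp: lookup_hc)
qed

lemma hc_in_hom [simp]: "hc d f \<in> hom d"
  by (auto simp: hom_iff in_keys_iff lookup_hc split: if_splits)

lemma hom_mon: "mono_deg m = d \<Longrightarrow> mon m \<in> hom d"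
  by (simp add: hom_def)

lemma hom_subspace: "MP.subspace (hom d)"
  unfolding MP.subspace_def hom_def by (simp add: hc_add hc_smul)

lemma hom_0 [simp]: "0 \<in> hom d"
  by (simp add: hom_def)

lemma hom_mult: "f \<in> hom d \<Longrightarrow> g \<in> hom e \<Longrightarrow> f * g \<in> hom (d + e)"
  unfolding hom_iff using keys_mult[of f g] by fastforce

lemma hom_1: "1 \<in> hom 0"
  using hom_mon[of 0 0] by simp

lemma hom_power: "f \<in> hom d \<Longrightarrow> f ^ k \<in> hom (d * k)"
  by (induction k) (simp_all add: hom_1 hom_mult)

lemma hom_prod: "(\<And>x. x \<in> A \<Longrightarrow> f x \<in> hom (e x)) \<Longrightarrow> prod f A \<in> hom (sum e A)"
  by (induction A rule: infinite_finite_induct) (simp_all add: hom_1 hom_mult)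

lemma hom_span: "(hom d :: ('n::finite, 'a::field) mpol set) = MP.span (mon ` {m. mono_deg m = d})"
proof
  show "MP.span (mon ` {m. mono_deg m = d}) \<subseteq> hom d"
    by (rule MP.span_minimal) (auto simp: hom_mon hom_subspace)
  show "hom d \<subseteq> MP.span (mon ` {m. mono_deg m = d} :: ('n, 'a) mpol set)"
  proof
    fix f :: "('n, 'a) mpol"
    assume f: "f \<in> hom d"
    have "hc d g \<in> MP.span (mon ` {m. mono_deg m = d})" for g :: "('n, 'a) mpol"
    proof (induction g rule: mpol_induct)
      case (single m c)
      have "smul c (mon m) \<in> MP.span (mon ` {m. mono_deg m = d})" if "mono_deg m = d"
        using that by (intro MP.span_scale MP.span_base) simp
      then show ?case
        by (simp add: hc_single MP.span_zero)
    qed (simp_all add: hc_add MP.span_zero MP.span_add)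
    from this[of f] show "f \<in> MP.span (mon ` {m. mono_deg m = d})"
      using f by (simp add: hom_def)
  qed
qed

lemma finite_mono_deg: "finite {m :: 'n::finite \<Rightarrow>\<^sub>0 nat. mono_deg m = d}"
proof -
  have "finite (PiE (UNIV :: 'n set) (\<lambda>_. {..d}))" by (intro finite_PiE) auto
  moreover have "Poly_Mapping.lookup ` {m :: 'n \<Rightarrow>\<^sub>0 nat. mono_deg m = d} \<subseteq> PiE UNIV (\<lambda>_. {..d})"
    by (auto simp: mono_deg_def intro: member_le_sum)
  ultimately have "finite (Poly_Mapping.lookup ` {m :: 'n \<Rightarrow>\<^sub>0 nat. mono_deg m = d})"
    using finite_subset by blast
  then show ?thesis
    by (rule finite_imageD) (simp add: inj_on_def lookup_inject)
qed

section \<open>Twisted total squares and hit subspaces\<close>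

text \<open>For the identity \<open>\<sigma>\<close> this ring homomorphism is the sum of all
  Steenrod squares. A general \<open>\<sigma>\<close> covers the operator after the change of
  variables, so that both obey the same lemmas.\<close>

definition Stot :: "('n::finite \<Rightarrow> 'n) \<Rightarrow> ('n, 'a::field) mpol \<Rightarrow> ('n, 'a) mpol"
  where "Stot \<sigma> = subst (\<lambda>i. var i + var (\<sigma> i) ^ 2)"

lemma Stot_linear: "Stot \<sigma> (f + g) = Stot \<sigma> f + Stot \<sigma> g" "Stot \<sigma> (smul c f) = smul c (Stot \<sigma> f)"
  "Stot \<sigma> (sum h A) = (\<Sum>x\<in>A. Stot \<sigma> (h x))" "Stot \<sigma> 0 = 0"
  by (simp_all add: Stot_def subst_linear)

lemma Stot_mult: "Stot \<sigma> (f * g) = Stot \<sigma> f * Stot \<sigma> g"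
  by (simp add: Stot_def subst_mult)

text \<open>For the identity \<open>\<sigma>\<close>, the component of degree \<open>d\<close> of
  the total square of a monomial of degree e is Sq^(d-e). The condition
  \<open>mono_deg m < d\<close> thus means a square of positive degree, and the span is the part of
  degree \<open>d\<close> of the hit polynomials.\<close>

definition htw :: "('n::finite \<Rightarrow> 'n) \<Rightarrow> nat \<Rightarrow> ('n, 'a::field) mpol set"
  where "htw \<sigma> d = MP.span {hc d (Stot \<sigma> (mon m)) | m. mono_deg m < d}"

lemma htw_base: "mono_deg m < d \<Longrightarrow> hc d (Stot \<sigma> (mon m)) \<in> htw \<sigma> d"
  unfolding htw_def by (rule MP.span_base) blast

lemma subspace_htw: "MP.subspace (htw \<sigma> d)"
  by (simp add: htw_def)

lemmas htw_closed = MP.subspace_0[OF subspace_htw] MP.subspace_add[OF subspace_htw]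
  MP.subspace_diff[OF subspace_htw] MP.subspace_scale[OF subspace_htw] MP.subspace_sum[OF subspace_htw]
  MP.subspace_neg[OF subspace_htw]

lemma htw_hom: "htw \<sigma> d \<subseteq> hom d"
  unfolding htw_def by (rule MP.span_minimal) (auto simp: hom_subspace)

text \<open>The classes of \<open>B\<close> form a basis of the quotient in degree \<open>d\<close>.
  Coefficient functions on \<open>B\<close> in place of a quotient space make the notion easy to
  carry between fields, variables and degrees.\<close>

definition qbas :: "('n::finite \<Rightarrow> 'n) \<Rightarrow> nat \<Rightarrow> ('n, 'a::field) mpol set \<Rightarrow> bool"
  where "qbas \<sigma> d B \<longleftrightarrow> finite B \<and> B \<subseteq> hom d \<and> hom d \<subseteq> MP.span (B \<union> htw \<sigma> d) \<and>
    (\<forall>c. (\<Sum>b\<in>B. smul (c b) b) \<in> htw \<sigma> d \<longrightarrow> (\<forall>b\<in>B. c b = 0))"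

text \<open>Exchange argument: with a basis \<open>C\<close> of the hit space,
  \<open>B \<union> C\<close> is independent and lies in the span of \<open>B' \<union> C\<close>;
  the size of \<open>C\<close> then cancels.\<close>

lemma qbas_le:
  fixes B B' :: "('n::finite, 'a::field) mpol set"
  assumes B: "qbas \<sigma> d B" and B': "finite B'" "hom d \<subseteq> MP.span (B' \<union> htw \<sigma> d)"
  shows "card B \<le> card B'"
proof -
  have fB: "finite B" "B \<subseteq> hom d" and ind: "\<And>c. (\<Sum>b\<in>B. smul (c b) b) \<in> htw \<sigma> d \<Longrightarrow> \<forall>b\<in>B. c b = 0"
    using B by (auto simp: qbas_def)
  obtain C :: "('n, 'a) mpol set" where C: "C \<subseteq> htw \<sigma> d" "MP.independent C" "htw \<sigma> d \<subseteq> MP.span C"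
    using MP.maximal_independent_subset[of "htw \<sigma> d"] by blast
  have "C \<subseteq> MP.span (mon ` {m. mono_deg m = d})"
    using C(1) htw_hom[of \<sigma> d] unfolding hom_span by blast
  then have fC: "finite C"
    using MP.independent_span_bound[OF _ C(2)] finite_mono_deg by blast
  have disj: "B \<inter> C = {}"
  proof (rule ccontr)
    assume "B \<inter> C \<noteq> {}"
    then obtain b where b: "b \<in> B" "b \<in> C" by blast
    \<comment> \<open>An element of \<open>B\<close> in the hit space contradicts independence,
      applied to its indicator function.\<close>
    have "(\<Sum>v\<in>B. smul (if v = b then 1 else 0) v) = b"
    proof -
      have "(\<Sum>v\<in>B. smul (if v = b then 1 else 0) v) = (\<Sum>v\<in>B. if v = b then b else 0)"
        by (intro sum.cong) auto
      then show ?thesis using b fB by simp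
    qed
    then have "\<forall>v\<in>B. (if v = b then 1 else 0) = (0 :: 'a)"
      using b C(1) by (intro ind) auto
    then show False
      using b(1) by auto
  qed
  have indBC: "MP.independent (B \<union> C)"
  proof
    assume "MP.dependent (B \<union> C)"
    then obtain u where u: "\<exists>v\<in>B \<union> C. u v \<noteq> 0" "(\<Sum>v\<in>B \<union> C. smul (u v) v) = 0"
      using MP.dependent_finite[of "B \<union> C"] fB fC by auto
    have s: "(\<Sum>v\<in>B. smul (u v) v) + (\<Sum>v\<in>C. smul (u v) v) = 0"
      using u(2) sum.union_disjoint[OF fB(1) fC disj, of "\<lambda>v. smul (u v) v"] by simp
    have "(\<Sum>v\<in>C. smul (u v) v) \<in> htw \<sigma> d"
      using C(1) by (intro htw_closed(5)) (auto intro: htw_closed(4))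
    then have "(\<Sum>v\<in>B. smul (u v) v) \<in> htw \<sigma> d"
      using s htw_closed(6)[of "\<Sum>v\<in>C. smul (u v) v" \<sigma> d] by (simp add: add_eq_0_iff2)
    then have uB: "\<forall>b\<in>B. u b = 0" using ind by blast
    then have "(\<Sum>v\<in>C. smul (u v) v) = 0" using s by simp
    then have "\<forall>v\<in>C. u v = 0"
      using C(2) MP.dependent_finite[OF fC] by blast
    then show False using uB u(1) by blast
  qed
  have "B \<union> C \<subseteq> hom d" using fB(2) C(1) htw_hom by blast
  also have "hom d \<subseteq> MP.span (B' \<union> htw \<sigma> d)" by (rule B')
  also have "\<dots> \<subseteq> MP.span (B' \<union> C)"
  proof (rule MP.span_minimal)
    have "MP.span C \<subseteq> MP.span (B' \<union> C)" by (rule MP.span_mono) blast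
    then show "B' \<union> htw \<sigma> d \<subseteq> MP.span (B' \<union> C)"
      using C(3) by (auto intro: MP.span_base)
  qed simp
  finally have "B \<union> C \<subseteq> MP.span (B' \<union> C)" .
  then have "card (B \<union> C) \<le> card (B' \<union> C)"
    using MP.independent_span_bound[OF _ indBC] B'(1) fC by blast
  also have "\<dots> \<le> card B' + card C" by (rule card_Un_le)
  finally show ?thesis using card_Un_disjoint[OF fB(1) fC disj] by linarith
qed

lemma qbas_card_unique:
  fixes B B' :: "('n::finite, 'a::field) mpol set"
  shows "qbas \<sigma> d B \<Longrightarrow> qbas \<sigma> d B' \<Longrightarrow> card B = card B'"
  using qbas_le[of \<sigma> d B B'] qbas_le[of \<sigma> d B' B] by (simp add: qbas_def)

section \<open>Characteristic two\<close>

type_synonym K = "bit alg_closure"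

lemma K_two [simp]: "(2 :: K) = 0"
proof -
  have "to_ac (1 + 1 :: bit) = (1 + 1 :: K)" by (simp only: to_ac_add to_ac_1)
  then show ?thesis by simp
qed

lemma K_double [simp]: "(x :: K) + x = 0"
  by (simp flip: mult_2)

lemma mpolK_two [simp]: "(2 :: ('n, K) mpol) = 0"
proof -
  have "(1 + 1 :: ('n, K) mpol) = 0"
    by (intro poly_mapping_eqI) (simp only: lookup_add K_double lookup_zero)
  then show ?thesis by simp
qed

lemma mpolK_double [simp]: "(f :: ('n, K) mpol) + f = 0"
  by (simp flip: mult_2)

lemma mpolK_uminus [simp]: "- (f :: ('n, K) mpol) = f"
  by (metis add.inverse_unique mpolK_double)

lemma mpolK_power2_add: "((f :: ('n, K) mpol) + g)^2 = f^2 + g^2"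
proof -
  have "(f + g)^2 = f^2 + g^2 + (f * g + f * g)"
    by (simp add: power2_eq_square algebra_simps)
  then show ?thesis by simp
qed

lemma mpolK_frobenius: "((f :: ('n, K) mpol) + g)^(2^n) = f^(2^n) + g^(2^n)"
proof (induction n)
  case (Suc n)
  have "(f + g)^(2^Suc n) = ((f + g)^(2^n))^2" by (simp add: power_mult mult.commute flip: power_mult)
  also have "\<dots> = (f^(2^n))^2 + (g^(2^n))^2" by (simp add: Suc mpolK_power2_add)
  also have "\<dots> = f^(2^Suc n) + g^(2^Suc n)" by (simp add: mult.commute flip: power_mult)
  finally show ?case .
qed simp

lemma mpolK_frobenius_sum: "finite A \<Longrightarrow> (sum (f :: _ \<Rightarrow> ('n, K) mpol) A)^2 = (\<Sum>x\<in>A. f x ^ 2)"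
  by (induction A rule: finite_induct) (simp_all add: mpolK_power2_add)

section \<open>Squarefree times square\<close>

text \<open>Every monomial is a squarefree monomial times a square, with exponent vector
  \<open>ind A + (y + y)\<close> and \<open>A\<close> its set of odd exponents. Almost everything
  below is phrased in terms of this pair, because the total square acts on the two factors
  separately.\<close>

definition ind :: "'n set \<Rightarrow> 'n::finite \<Rightarrow>\<^sub>0 nat"
  where "ind A = (\<Sum>i\<in>A. Poly_Mapping.single i 1)"

lemma lookup_ind: "Poly_Mapping.lookup (ind A) i = of_bool (i \<in> A)"
  by (simp add: ind_def lookup_sum lookup_single when_def of_bool_def)

lemma mono_deg_ind [simp]: "mono_deg (ind A) = card A"
  by (simp add: ind_def mono_deg_sum)

lemma ind_empty [simp]: "ind {} = 0"
  by (simp add: ind_def)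

lemma mon_ind: "mon (ind A) = (\<Prod>i\<in>A. var i)"
  by (simp add: ind_def var_def prod_mon)

text \<open>Doubles the exponents and leaves the coefficients alone. Unlike squaring, from which it
  differs by Frobenius on the coefficients, it is linear over the ground field.\<close>

definition dbl :: "('n::finite, 'a::field) mpol \<Rightarrow> ('n, 'a) mpol"
  where "dbl = subst (\<lambda>i. var i ^ 2)"

lemma dbl_linear: "dbl (f + g) = dbl f + dbl g" "dbl (smul c f) = smul c (dbl f)"
  "dbl (sum h A) = (\<Sum>x\<in>A. dbl (h x))" "dbl 0 = 0"
  by (simp_all add: dbl_def subst_linear)

lemma dbl_mult: "dbl (f * g) = dbl f * dbl g"
  by (simp add: dbl_def subst_mult)

lemma dbl_prod: "dbl (prod h A) = (\<Prod>x\<in>A. dbl (h x))"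
  by (simp add: dbl_def subst_prod)

lemma dbl_var: "dbl (var i) = var i ^ 2"
  by (simp add: dbl_def)

lemma dbl_mon: "dbl (mon m) = mon (m + m)"
proof -
  have "dbl (mon m) = (\<Prod>i\<in>UNIV. var i ^ Poly_Mapping.lookup (m + m) i)"
    by (simp add: dbl_def subst_mon lookup_add flip: power_mult mult_2)
  then show ?thesis by (simp only: flip: mon_eq_prod)
qed

lemma parity_decomp: "\<exists>y. m = ind {i. odd (Poly_Mapping.lookup m i)} + (y + y)"
proof -
  have "m = ind {i. odd (Poly_Mapping.lookup m i)} +
      (Abs_poly_mapping (\<lambda>i. Poly_Mapping.lookup m i div 2) + Abs_poly_mapping (\<lambda>i. Poly_Mapping.lookup m i div 2))"
    by (intro poly_mapping_eqI) (simp add: lookup_add lookup_ind lookup_Abs_poly_mapping of_bool_def flip: mult_2)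
  then show ?thesis by blast
qed

lemma odd_set_ind_dbl [simp]: "{i. odd (Poly_Mapping.lookup (ind A + (y + y)) i)} = A"
  by (auto simp: lookup_add lookup_ind)

lemma hc_ind_dbl:
  "hc D (mon (ind A) * dbl f) =
    (if card A \<le> D \<and> even (D - card A) then mon (ind A) * dbl (hc ((D - card A) div 2) f) else 0)"
proof (induction f rule: mpol_induct)
  case (single m c)
  have *: "card A + (mono_deg m + mono_deg m) = D \<longleftrightarrow>
      card A \<le> D \<and> even (D - card A) \<and> mono_deg m = (D - card A) div 2"
    by presburger
  have "hc D (mon (ind A) * dbl (smul c (mon m))) =
     smul c (if card A + (mono_deg m + mono_deg m) = D then mon (ind A + (m + m)) else 0)"
    by (simp add: dbl_linear dbl_mon smul_mult_right hc_smul mult_single del: smul_single)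
  also have "\<dots> = (if card A \<le> D \<and> even (D - card A)
     then mon (ind A) * dbl (hc ((D - card A) div 2) (smul c (mon m))) else 0)"
    unfolding * by (auto simp add: dbl_linear dbl_mon smul_mult_right hc_smul mult_single simp del: smul_single)
  finally have *: "hc D (mon (ind A) * dbl (smul c (mon m))) = (if card A \<le> D \<and> even (D - card A)
     then mon (ind A) * dbl (hc ((D - card A) div 2) (smul c (mon m))) else 0)" .
  have "Poly_Mapping.single m c = smul c (mon m)" by simp
  then show ?case by (simp only: *)
qed (simp_all add: dbl_linear hc_add distrib_left del: even_diff_nat)

lemma hc_mon_mult: "hc D (mon a * f) = (if mono_deg a \<le> D then mon a * hc (D - mono_deg a) f else 0)"
proof (induction f rule: mpol_induct)
  case (single m c)
  have "mono_deg a + mono_deg m = D \<longleftrightarrow> mono_deg a \<le> D \<and> mono_deg m = D - mono_deg a" by auto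
  then show ?case by (simp add: hc_single mult_single)
qed (simp_all add: hc_add distrib_left)

text \<open>Frobenius: (u + v^2)^2 = u^2 + v^4. For coefficients in F_2 and no twist this says
  Sq^(2k)(f^2) = (Sq^k f)^2, while odd squares vanish on squares.\<close>

lemma Stot_dbl: "Stot \<sigma> (dbl f) = dbl (Stot \<sigma> (f :: ('n::finite, K) mpol))"
  unfolding Stot_def dbl_def subst_comp
  by (simp add: subst_power subst_linear mpolK_power2_add)

text \<open>Each variable of \<open>z\<close> contributes either itself or the square of
  \<open>var (\<sigma> i)\<close>, and \<open>A\<close> collects the indices where the square is
  taken. These squares join the factor under \<open>dbl\<close>, so sets of odd exponents can only
  shrink. The formula drives both the Kameko map and the analysis of degree 25.\<close>

lemma Stot_ind_dbl:
  "Stot \<sigma> (mon (ind z) * dbl g) =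
    (\<Sum>A\<in>Pow z. mon (ind (z - A)) * dbl ((\<Prod>i\<in>A. var (\<sigma> i)) * Stot \<sigma> (g :: ('n::finite, K) mpol)))"
proof -
  have "Stot \<sigma> (mon (ind z)) = (\<Prod>i\<in>z. var (\<sigma> i) ^ 2 + var i)"
    by (simp add: mon_ind Stot_def subst_prod add.commute)
  also have "\<dots> = (\<Sum>A\<in>Pow z. (\<Prod>i\<in>A. var (\<sigma> i) ^ 2) * (\<Prod>i\<in>z - A. var i))"
    by (rule prod_add) simp
  finally have *: "Stot \<sigma> (mon (ind z)) = (\<Sum>A\<in>Pow z. (\<Prod>i\<in>A. var (\<sigma> i) ^ 2) * (\<Prod>i\<in>z - A. var i))" .
  show ?thesis
    unfolding Stot_mult Stot_dbl * sum_distrib_right dbl_mult dbl_prod dbl_var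
    by (simp add: mon_ind ac_simps)
qed

section \<open>Degree filtrations\<close>

definition dge :: "nat \<Rightarrow> ('n::finite, 'a::field) mpol set"
  where "dge D = {f. \<forall>m\<in>Poly_Mapping.keys f. D \<le> mono_deg m}"

lemma dge_subspace: "MP.subspace (dge D)"
  unfolding MP.subspace_def dge_def by (auto simp: in_keys_iff lookup_add)

lemmas dge_closed = MP.subspace_0[OF dge_subspace] MP.subspace_add[OF dge_subspace]
  MP.subspace_scale[OF dge_subspace]

lemma dge_mult: "f \<in> dge D \<Longrightarrow> g \<in> dge E \<Longrightarrow> f * g \<in> dge (D + E)"
  unfolding dge_def using keys_mult[of f g] by (fastforce intro: add_mono)

lemma dge_mono: "f \<in> dge D \<Longrightarrow> E \<le> D \<Longrightarrow> f \<in> dge E"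
  by (auto simp: dge_def)

lemma dge_0 [simp]: "f \<in> dge 0"
  by (simp add: dge_def)

lemma dge_mon: "D \<le> mono_deg m \<Longrightarrow> mon m \<in> dge D"
  by (simp add: dge_def)

lemma dge_power: "f \<in> dge D \<Longrightarrow> f ^ k \<in> dge (k * D)"
  by (induction k) (simp_all add: dge_mult)

lemma dge_prod: "(\<And>x. x \<in> A \<Longrightarrow> f x \<in> dge (e x)) \<Longrightarrow> prod f A \<in> dge (sum e A)"
  by (induction A rule: infinite_finite_induct) (simp_all add: dge_mult)

lemma hc_dge: "f \<in> dge D \<Longrightarrow> d < D \<Longrightarrow> hc d f = 0"
  by (intro poly_mapping_eqI) (force simp: lookup_hc dge_def in_keys_iff)

lemma dge_var_power: "var i ^ k \<in> dge k"
  by (simp add: var_power dge_mon)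

lemma Stot_dge: "Stot \<sigma> (mon m) \<in> dge (mono_deg m)"
proof -
  have "var i + var (\<sigma> i) ^ 2 \<in> dge 1" for i
    using dge_closed(2)[of "var i ^ 1" 1 "var (\<sigma> i) ^ 2"] dge_var_power[of i 1]
      dge_mono[OF dge_var_power[of "\<sigma> i" 2], of 1] by simp
  from dge_power[OF this] have "(\<Prod>i\<in>UNIV. (var i + var (\<sigma> i) ^ 2) ^ Poly_Mapping.lookup m i)
      \<in> dge (\<Sum>i\<in>UNIV. Poly_Mapping.lookup m i)"
    by (intro dge_prod) simp
  then show ?thesis by (simp add: Stot_def subst_mon mono_deg_def)
qed

text \<open>\<open>tops D p t\<close>: \<open>p\<close> has degree at most \<open>D\<close> and its component of degree \<open>D\<close> is \<open>t\<close>.\<close>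

definition tops :: "nat \<Rightarrow> ('n::finite, 'a::field) mpol \<Rightarrow> ('n, 'a) mpol \<Rightarrow> bool"
  where "tops D p t \<longleftrightarrow> (\<forall>m\<in>Poly_Mapping.keys p. mono_deg m \<le> D) \<and> hc D p = t"

lemma tops_mult:
  assumes "tops D p t" "tops E q s"
  shows "tops (D + E) (p * q) (t * s)"
proof -
  have le: "(\<forall>m\<in>Poly_Mapping.keys p. mono_deg m \<le> D)" "(\<forall>m\<in>Poly_Mapping.keys q. mono_deg m \<le> E)"
    and t: "hc D p = t" "hc E q = s"
    using assms by (auto simp: tops_def)
  define L :: "nat \<Rightarrow> ('a, 'b) mpol set" where "L D = {f. \<forall>m\<in>Poly_Mapping.keys f. mono_deg m < D}" for D
  have L: "p - t \<in> L D" "q - s \<in> L E"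
    using le t by (auto simp: L_def in_keys_iff lookup_minus lookup_hc le_less split: if_splits)
  have hL: "hc n f = 0" if "f \<in> L n" for n f
    using that by (intro poly_mapping_eqI) (force simp: lookup_hc L_def in_keys_iff)
  have mL: "f * g \<in> L (a + b)" if "f \<in> L a" "\<forall>m\<in>Poly_Mapping.keys g. mono_deg m \<le> b" for f g a b
    using that keys_mult[of f g] by (fastforce simp: L_def intro: add_less_le_mono)
  have h: "t \<in> hom D" "s \<in> hom E" using t by auto
  have th: "\<forall>m\<in>Poly_Mapping.keys t. mono_deg m \<le> D" using h(1) by (auto simp: hom_iff)
  have ts: "t * s \<in> hom (D + E)" by (rule hom_mult[OF h])
  have "p * q = t * s + ((p - t) * q + (q - s) * t)" by (simp add: algebra_simps)
  then have "hc (D + E) (p * q) = t * s"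
    using hL[OF mL[OF L(1) le(2)]] hL[OF mL[OF L(2) th]] hc_hom[OF ts, of "D + E"]
    by (simp add: hc_add add.commute)
  moreover have "\<forall>m\<in>Poly_Mapping.keys (p * q). mono_deg m \<le> D + E"
    using keys_mult[of p q] le by (fastforce intro: add_mono)
  ultimately show ?thesis by (simp add: tops_def)
qed

lemma tops_1: "tops 0 1 1"
  using hc_hom[OF hom_1, of 0] by (simp add: tops_def)

lemma tops_power: "tops D p t \<Longrightarrow> tops (k * D) (p ^ k) (t ^ k)"
  by (induction k) (simp_all add: tops_1 tops_mult)

lemma tops_prod: "(\<And>x. x \<in> A \<Longrightarrow> tops (e x) (f x) (g x)) \<Longrightarrow> tops (sum e A) (prod f A) (prod g A)"
  by (induction A rule: infinite_finite_induct) (simp_all add: tops_1 tops_mult)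

text \<open>Instability: the highest square of a monomial is its square, here with the variables
  moved by \<open>\<sigma>\<close>.\<close>

lemma tops_Stot:
  "tops (2 * mono_deg m) (Stot \<sigma> (mon m) :: ('n::finite, 'a::field) mpol) (subst (\<lambda>i. var (\<sigma> i) ^ 2) (mon m))"
proof -
  have "tops 2 (var i + var (\<sigma> i) ^ 2) (var (\<sigma> i) ^ 2 :: ('n, 'a) mpol)" for i
  proof -
    have "mono_deg m \<le> 2" if "m \<in> Poly_Mapping.keys (var i + var (\<sigma> i) ^ 2 :: ('n, 'a) mpol)" for m
      using that keys_add[of "var i" "var (\<sigma> i) ^ 2"] unfolding var_power by (auto simp: var_def)
    moreover have "hc 2 (var i + var (\<sigma> i) ^ 2) = (var (\<sigma> i) ^ 2 :: ('n, 'a) mpol)"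
      unfolding var_power by (simp add: hc_add var_def)
    ultimately show ?thesis by (simp add: tops_def)
  qed
  then have "tops (\<Sum>i\<in>UNIV. Poly_Mapping.lookup m i * 2)
      (\<Prod>i\<in>UNIV. (var i + var (\<sigma> i) ^ 2 :: ('n, 'a) mpol) ^ Poly_Mapping.lookup m i)
      (\<Prod>i\<in>UNIV. (var (\<sigma> i) ^ 2) ^ Poly_Mapping.lookup m i)"
    by (intro tops_prod tops_power)
  then show ?thesis by (simp add: Stot_def subst_mon mono_deg_def sum_distrib_left mult.commute)
qed

section \<open>Hit monomials\<close>

text \<open>The total square never lowers degrees, so monomials of degree above \<open>d\<close>
  contribute nothing. Only degree \<open>d\<close> itself, where the square would be Sq^0, has to be
  excluded.\<close>

lemma Stot_hit_span:
  assumes "x \<in> MP.span (mon ` {m. mono_deg m \<noteq> d})"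
  shows "hc d (Stot \<sigma> x) \<in> htw \<sigma> d"
  unfolding htw_def
proof (rule MP_additive_span[OF _ _ _ assms])
  fix x :: "('a, 'b) mpol"
  assume "x \<in> mon ` {m. mono_deg m \<noteq> d}"
  then obtain m where m: "x = mon m" "mono_deg m \<noteq> d" by blast
  have "hc d (Stot \<sigma> x) \<in> htw \<sigma> d"
  proof (cases "mono_deg m < d")
    case False
    then have "hc d (Stot \<sigma> x) = 0" using m hc_dge[OF Stot_dge, of d m] by auto
    then show ?thesis by (simp add: htw_closed)
  qed (simp add: m htw_base)
  then show "hc d (Stot \<sigma> x) \<in> MP.span {hc d (Stot \<sigma> (mon m)) |m. mono_deg m < d}"
    by (simp add: htw_def)
qed (simp_all add: Stot_linear hc_add hc_smul)

text \<open>
  The series \<open>\<Sum>\<^sub>n u(\<sigma>\<^sup>n i)^(2^n)\<close> inverts the total square at the variable \<open>u(i)\<close>: applied to its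
  truncation, the total square telescopes.
\<close>

lemma Stot_telescope:
  "Stot \<sigma> (\<Sum>n<N. var ((\<sigma> ^^ n) i) ^ (2 ^ n)) = (var i + var ((\<sigma> ^^ N) i) ^ (2 ^ N) :: ('n::finite, K) mpol)"
proof (induction N)
  case (Suc N)
  have "Stot \<sigma> (var ((\<sigma> ^^ N) i) ^ (2 ^ N)) =
      (var ((\<sigma> ^^ N) i) ^ (2 ^ N) + (var ((\<sigma> ^^ Suc N) i) ^ 2) ^ (2 ^ N) :: ('n, K) mpol)"
    by (simp add: Stot_def subst_power mpolK_frobenius)
  then have "Stot \<sigma> (\<Sum>n<Suc N. var ((\<sigma> ^^ n) i) ^ (2 ^ n)) = ((var i + var ((\<sigma> ^^ N) i) ^ (2 ^ N))
      + (var ((\<sigma> ^^ N) i) ^ (2 ^ N) + (var ((\<sigma> ^^ Suc N) i) ^ 2) ^ (2 ^ N)) :: ('n, K) mpol)"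
    by (simp only: sum.lessThan_Suc Stot_linear(1) Suc)
  also have "\<dots> = var i + (var ((\<sigma> ^^ N) i) ^ (2 ^ N) + var ((\<sigma> ^^ N) i) ^ (2 ^ N))
      + (var ((\<sigma> ^^ Suc N) i) ^ 2) ^ (2 ^ N)"
    by (simp only: add.assoc)
  also have "\<dots> = var i + var ((\<sigma> ^^ Suc N) i) ^ (2 ^ Suc N)"
    by (simp only: mpolK_double add_0_right power_Suc flip: power_mult)
  finally show ?case .
qed (simp add: Stot_linear)

text \<open>Used with \<open>w i\<close> the remainders left by the truncated series: in low degrees
  the product cannot be told from \<open>mon (ind A)\<close>.\<close>

lemma prod_var_plus_high:
  assumes "\<And>i. i \<in> A \<Longrightarrow> w i \<in> dge D"
  shows "(\<Prod>i\<in>A. var i + w i) - mon (ind A) \<in> dge D"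
proof -
  have "finite A" by simp
  then show ?thesis using assms
  proof (induction A rule: finite_induct)
    case (insert a A)
    have "(\<Prod>i\<in>insert a A. var i + w i) - mon (ind (insert a A)) =
      (var a + w a) * ((\<Prod>i\<in>A. var i + w i) - mon (ind A)) + w a * mon (ind A)"
      using insert.hyps by (simp add: mon_ind algebra_simps)
    moreover have "(var a + w a) * ((\<Prod>i\<in>A. var i + w i) - mon (ind A)) \<in> dge (0 + D)"
      using insert by (intro dge_mult) auto
    moreover have "w a * mon (ind A) \<in> dge (D + 0)"
      using insert by (intro dge_mult) auto
    ultimately show ?case using dge_closed(2) by fastforce
  qed (simp add: dge_closed)
qed

text \<open>The \<chi>-trick. The total square of \<open>c\<close> is \<open>mon (ind A)\<close> up
  to terms of high degree, so in degree \<open>d\<close> the total square of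
  \<open>c * mon v\<close> is \<open>mon (ind A)\<close> times the top part of that of
  \<open>mon v\<close>, which is \<open>dbl (mon y)\<close>. The monomials of
  \<open>c * mon v\<close> have degrees of the form (sum of 2^(a i)) + \<open>mono_deg y\<close>,
  and \<open>no\<close> says exactly that none of them equals \<open>d\<close>.\<close>

lemma hit_monomial:
  fixes \<sigma> :: "'n::finite \<Rightarrow> 'n"
  assumes \<sigma>: "bij \<sigma>"
    and no: "\<And>a :: 'n \<Rightarrow> nat. (\<Sum>i\<in>A. 2 ^ a i) \<noteq> card A + mono_deg y"
  shows "mon (ind A) * dbl (mon y) \<in> (htw \<sigma> (card A + 2 * mono_deg y) :: ('n, K) mpol set)"
proof -
  define d where "d = card A + 2 * mono_deg y"
  \<comment> \<open>The top part of the twisted square sends \<open>var i\<close> to the square of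
    \<open>var (\<sigma> i)\<close>; shifting the exponents by \<open>\<sigma>\<close> compensates
    for this.\<close>
  define v where "v = Abs_poly_mapping (\<lambda>i. Poly_Mapping.lookup y (\<sigma> i))"
  have lv: "Poly_Mapping.lookup v i = Poly_Mapping.lookup y (\<sigma> i)" for i
    by (simp add: v_def)
  have dv: "mono_deg v = mono_deg y"
    unfolding mono_deg_def lv using \<sigma> by (rule sum.reindex_bij_betw)
  have top: "subst (\<lambda>i. var (\<sigma> i) ^ 2) (mon v) = (dbl (mon y) :: ('n, K) mpol)"
    unfolding dbl_def subst_mon lv using \<sigma> by (rule prod.reindex_bij_betw)
  define w where "w i = (var ((\<sigma> ^^ d) i) ^ (2 ^ d) :: ('n, K) mpol)" for i
  \<comment> \<open>\<open>d\<close> summands are enough, because the remainder has exponent 2^d,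
    which exceeds \<open>d\<close>.\<close>
  define c where "c = (\<Prod>i\<in>A. \<Sum>n<d. var ((\<sigma> ^^ n) i) ^ (2 ^ n) :: ('n, K) mpol)"
  have "c * mon v = (\<Sum>g\<in>PiE A (\<lambda>_. {..<d}). (\<Prod>i\<in>A. var ((\<sigma> ^^ g i) i) ^ (2 ^ g i)) * mon v)"
    unfolding c_def by (subst prod_sum_PiE) (auto simp: sum_distrib_right)
  also have "\<dots> \<in> MP.span (mon ` {m. mono_deg m \<noteq> d})"
  proof (intro MP.span_sum MP.span_base)
    fix g :: "'n \<Rightarrow> nat"
    show "(\<Prod>i\<in>A. var ((\<sigma> ^^ g i) i) ^ (2 ^ g i)) * mon v \<in> mon ` {m. mono_deg m \<noteq> d}"
      using no[of g] by (auto simp: var_power prod_mon mult_single mono_deg_sum dv d_def)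
  qed
  finally have 1: "hc d (Stot \<sigma> (c * mon v)) \<in> htw \<sigma> d"
    by (rule Stot_hit_span)
  define r where "r = (\<Prod>i\<in>A. var i + w i) - mon (ind A)"
  have "r \<in> dge (2 ^ d)"
    unfolding r_def by (rule prod_var_plus_high) (simp add: w_def dge_var_power)
  then have "r * Stot \<sigma> (mon v) \<in> dge (2 ^ d + 0)" by (intro dge_mult) auto
  then have r0: "hc d (r * Stot \<sigma> (mon v)) = 0" by (intro hc_dge) auto
  have "Stot \<sigma> c = (\<Prod>i\<in>A. var i + w i)"
    unfolding c_def w_def Stot_telescope[symmetric] by (simp add: Stot_def subst_prod)
  then have "Stot \<sigma> (c * mon v) = mon (ind A) * Stot \<sigma> (mon v) + r * Stot \<sigma> (mon v)"
    by (simp add: Stot_mult r_def algebra_simps)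
  then have 2: "hc d (Stot \<sigma> (c * mon v)) = mon (ind A) * hc (2 * mono_deg v) (Stot \<sigma> (mon v))"
    by (simp add: hc_add r0 hc_mon_mult) (simp add: d_def dv)
  have "tops (2 * mono_deg v) (Stot \<sigma> (mon v)) (dbl (mon y) :: ('n, K) mpol)"
    unfolding top[symmetric] by (rule tops_Stot)
  then have "mon (ind A) * hc (2 * mono_deg v) (Stot \<sigma> (mon v)) = (mon (ind A) * dbl (mon y) :: ('n, K) mpol)"
    by (simp add: tops_def)
  then show ?thesis using 1 2 by (simp add: d_def)
qed

section \<open>The Kameko map\<close>

text \<open>\<open>up\<close> is Kameko's map, and \<open>dn\<close> is a left inverse that discards
  every monomial with an even exponent. Modulo those monomials, hit by \<open>low\<close>, the map
  \<open>up\<close> commutes with the total square: in the expansion over subsets only the empty one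
  keeps all exponents odd. Hence both maps preserve hit spaces, and \<open>up\<close> carries
  \<open>B\<close> to a basis of the higher degree.\<close>

lemma kameko:
  fixes \<sigma> :: "'n::finite \<Rightarrow> 'n" and B :: "('n, K) mpol set"
  defines "n \<equiv> CARD('n)"
  assumes low: "\<And>m i. mono_deg m = 2 * d + n \<Longrightarrow> even (Poly_Mapping.lookup m i) \<Longrightarrow> (mon m :: ('n, K) mpol) \<in> htw \<sigma> (2 * d + n)"
    and B: "qbas \<sigma> d B"
  shows "\<exists>B' :: ('n, K) mpol set. qbas \<sigma> (2 * d + n) B' \<and> card B' = card B"
proof -
  let ?D = "2 * d + n"
  define up where "up f = mon (ind UNIV) * dbl f" for f :: "('n, K) mpol"
  define dn where "dn = lext (\<lambda>m. if \<forall>i. odd (Poly_Mapping.lookup m i)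
    then mon (Abs_poly_mapping (\<lambda>i. Poly_Mapping.lookup m i div 2)) else (0 :: ('n, K) mpol))"
  have U_add: "up (f + g) = up f + up g" for f g
    by (simp add: up_def dbl_linear distrib_left)
  have U_smul: "up (smul c f) = smul c (up f)" for c f
    by (simp add: up_def dbl_linear smul_mult_right)
  have U_sum: "up (sum h T) = (\<Sum>x\<in>T. up (h x))" for h and T :: "('n, K) mpol set"
    by (simp add: up_def dbl_linear sum_distrib_left)
  have V_lin: "dn (f + g) = dn f + dn g" "dn (smul c f) = smul c (dn f)" for f g c
    by (simp_all add: dn_def lext_add lext_smul)
  have dn_0: "dn 0 = 0" by (simp add: dn_def)
  have V_sum: "dn (sum h T) = (\<Sum>x\<in>T. dn (h x))" for h and T :: "'n set set"
    by (simp add: dn_def lext_sum)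
  have V_ind: "dn (mon (ind A) * dbl f) = (if A = UNIV then f else 0)" for A f
  proof (induction f rule: mpol_induct)
    case (single m c)
    have o: "(\<forall>i. odd (Poly_Mapping.lookup (ind A + (m + m)) i)) \<longleftrightarrow> A = UNIV"
      by (auto simp: lookup_add lookup_ind)
    have h: "Abs_poly_mapping (\<lambda>i. Poly_Mapping.lookup (ind UNIV + (m + m)) i div 2) = m"
      by (intro poly_mapping_eqI) (simp add: lookup_add lookup_ind)
    have "mon (ind A) * dbl (Poly_Mapping.single m c) = smul c (mon (ind A + (m + m)))"
      using dbl_linear(2)[of c "mon m"] by (simp add: dbl_mon smul_mult_right mult_single)
    then show ?case
      unfolding dn_def by (auto simp: o h)
  qed (simp_all add: V_lin dbl_linear distrib_left, simp add: dn_def)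
  have VU: "dn (up f) = f" for f by (simp add: up_def V_ind)
  have hcU: "hc ?D (up f) = up (hc d f)" for f
    by (simp add: up_def hc_ind_dbl n_def)
  have U_hom: "up f \<in> hom ?D" if "f \<in> hom d" for f
    using that hcU[of f] by (simp add: hom_def)
  have low': "hc ?D (mon (ind A) * dbl f) \<in> htw \<sigma> ?D" if A: "A \<noteq> UNIV" for A and f :: "('n, K) mpol"
  proof (induction f rule: mpol_induct)
    case (single m c)
    obtain i where i: "i \<notin> A" using A by blast
    have eq: "hc ?D (mon (ind A) * dbl (Poly_Mapping.single m c)) = smul c (hc ?D (mon (ind A + (m + m))))"
      using dbl_linear(2)[of c "mon m"] by (simp add: dbl_mon smul_mult_right mult_single hc_single flip: hc_smul)
    have "hc ?D (mon (ind A + (m + m))) \<in> (htw \<sigma> ?D :: ('n, K) mpol set)"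
      using low[of "ind A + (m + m)" i] i by (simp add: lookup_add lookup_ind htw_closed)
    then show ?case unfolding eq by (rule htw_closed(4))
  qed (simp_all add: dbl_linear distrib_left hc_add htw_closed)
  have U_htw: "up f \<in> htw \<sigma> ?D" if f: "f \<in> htw \<sigma> d" for f
  proof -
    have "up x \<in> htw \<sigma> ?D" if xs: "x \<in> {hc d (Stot \<sigma> (mon m)) |m. mono_deg m < d}" for x
    proof -
      obtain m where m: "x = hc d (Stot \<sigma> (mon m))" "mono_deg m < d" using xs by blast
      have "hc ?D (Stot \<sigma> (up (mon m))) \<in> htw \<sigma> ?D"
        using m(2) htw_base[of "ind UNIV + (m + m)" ?D \<sigma>]
        by (simp add: up_def dbl_mon mult_single n_def)
      \<comment> \<open>The summand of the empty set is split off; every other one has lost a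
        variable from its odd part and falls under \<open>low'\<close>.\<close>
      moreover have "hc ?D (Stot \<sigma> (up (mon m))) = hc ?D (up (Stot \<sigma> (mon m))) +
          (\<Sum>A\<in>Pow UNIV - {{}}. hc ?D (mon (ind (UNIV - A)) * dbl ((\<Prod>i\<in>A. var (\<sigma> i)) * Stot \<sigma> (mon m))))"
        unfolding up_def Stot_ind_dbl hc_sum
        by (subst sum.remove[of _ "{}"]) auto
      moreover have "(\<Sum>A\<in>Pow UNIV - {{}}. hc ?D (mon (ind (UNIV - A)) * dbl ((\<Prod>i\<in>A. var (\<sigma> i)) * Stot \<sigma> (mon m)))) \<in> (htw \<sigma> ?D :: ('n, K) mpol set)"
        by (intro htw_closed(5) low') auto
      ultimately have "hc ?D (up (Stot \<sigma> (mon m))) \<in> htw \<sigma> ?D"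
        using htw_closed(3) by fastforce
      then show ?thesis by (simp add: m(1) hcU)
    qed
    then show ?thesis
      using MP_additive_span[OF U_add U_smul, of "{hc d (Stot \<sigma> (mon m)) |m. mono_deg m < d}"] f
      by (simp add: htw_def)
  qed
  have V_htw: "dn f \<in> htw \<sigma> d" if f: "f \<in> htw \<sigma> ?D" for f
  proof -
    have "dn x \<in> htw \<sigma> d" if xs: "x \<in> {hc ?D (Stot \<sigma> (mon m)) |m. mono_deg m < ?D}" for x
    proof -
      obtain m where m: "x = hc ?D (Stot \<sigma> (mon m))" "mono_deg m < ?D" using xs by blast
      obtain z y where zy: "m = ind z + (y + y)" using parity_decomp by blast
      have x: "x = (\<Sum>A\<in>Pow z. hc ?D (mon (ind (z - A)) * dbl ((\<Prod>i\<in>A. var (\<sigma> i)) * Stot \<sigma> (mon y))))"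
        using Stot_ind_dbl[of \<sigma> z "mon y"] by (simp add: m(1) zy dbl_mon mult_single hc_sum)
      show ?thesis
      proof (cases "z = UNIV")
        case True
        \<comment> \<open>A nonempty \<open>A\<close> leaves some exponent even, and
          \<open>dn\<close> discards the term.\<close>
        have "dn x = (\<Sum>A\<in>Pow (UNIV :: 'n set). if A = {} then hc d (Stot \<sigma> (mon y)) else 0)"
          unfolding x True V_sum
          by (intro sum.cong) (auto simp: hc_ind_dbl V_ind n_def dn_0)
        then have "dn x = hc d (Stot \<sigma> (mon y))" by simp
        then show ?thesis
          using m(2) htw_base[of y d \<sigma>] by (simp add: zy True n_def)
      next
        case False
        then have "dn x = (\<Sum>A\<in>Pow z. 0)"
          unfolding x V_sum
          by (intro sum.cong) (auto simp: hc_ind_dbl V_ind dn_0)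
        then show ?thesis by (simp add: htw_closed)
      qed
    qed
    then show ?thesis
      using MP_additive_span[OF V_lin, of "{hc ?D (Stot \<sigma> (mon m)) |m. mono_deg m < ?D}"] f
      by (simp add: htw_def)
  qed
  have inj: "inj up" by (rule injI) (metis VU)
  have B': "finite B" "B \<subseteq> hom d" "hom d \<subseteq> MP.span (B \<union> htw \<sigma> d)"
    "\<And>c. (\<Sum>b\<in>B. smul (c b) b) \<in> htw \<sigma> d \<Longrightarrow> \<forall>b\<in>B. c b = 0"
    using B by (auto simp: qbas_def)
  have "hom ?D \<subseteq> MP.span (up ` B \<union> htw \<sigma> ?D)"
    unfolding hom_span
  proof (rule MP.span_minimal)
    show "mon ` {m. mono_deg m = ?D} \<subseteq> MP.span (up ` B \<union> htw \<sigma> ?D)"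
    proof clarify
      fix m :: "'n \<Rightarrow>\<^sub>0 nat"
      assume m: "mono_deg m = ?D"
      obtain z y where zy: "m = ind z + (y + y)" using parity_decomp by blast
      show "mon m \<in> MP.span (up ` B \<union> htw \<sigma> ?D)"
      proof (cases "z = UNIV")
        case True
        then have "mono_deg y = d" using m by (simp add: zy n_def)
        then have "mon y \<in> MP.span (B \<union> htw \<sigma> d)" using B'(3) hom_mon by blast
        then have "up (mon y) \<in> MP.span (up ` B \<union> htw \<sigma> ?D)"
          by (rule MP_additive_span[OF U_add U_smul, rotated]) (auto intro: MP.span_base U_htw)
        then show ?thesis by (simp add: up_def dbl_mon mult_single zy True)
      next
        case False
        then obtain i where "i \<notin> z" by blast
        then have "even (Poly_Mapping.lookup m i)" by (simp add: zy lookup_add lookup_ind)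
        from low[OF m this] show ?thesis by (intro MP.span_base) simp
      qed
    qed
  qed simp
  moreover have "\<forall>b\<in>up ` B. c b = 0" if c: "(\<Sum>b\<in>up ` B. smul (c b) b) \<in> htw \<sigma> ?D" for c
  proof -
    have "(\<Sum>b\<in>up ` B. smul (c b) b) = up (\<Sum>b\<in>B. smul (c (up b)) b)"
      using inj by (simp add: sum.reindex inj_on_def inj_def U_sum U_smul)
    then have "(\<Sum>b\<in>B. smul (c (up b)) b) \<in> htw \<sigma> d"
      using V_htw[OF c] by (simp add: VU)
    then show ?thesis using B'(4)[of "\<lambda>b. c (up b)"] by blast
  qed
  ultimately have "qbas \<sigma> ?D (up ` B)"
    using B'(1,2) U_hom by (auto simp: qbas_def)
  moreover have "card (up ` B) = card B" using inj by (intro card_image) (auto simp: inj_on_def inj_def)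
  ultimately show ?thesis by blast
qed

section \<open>The hit quotient over the field with two elements\<close>

lemma scaleP_eq_smul: "scaleP = smul"
  by (intro ext) (simp add: scaleP_conv_mult smul_def)

lemma homogeneous_eq_hom: "homogeneous d = hom d"
  by (auto simp: homogeneous_def hom_iff)

lemma Sq_eq_coeff: "Sq = (\<lambda>k f. Polynomial.coeff (tsq f) k)"
  by (rule steenrod_squares_unique[OF steenrod_squares_Sq steenrod_squares_tsq])

text \<open>In the formal total square a factor t accompanies each replacement of x by x^2, so the
  coefficient at t^k is homogeneous of degree \<open>mono_deg m + k\<close>; \<open>G\<close>
  expresses this and is multiplicative. Putting t = 1 gives \<open>Stot\<close>, from which the
  degree recovers the single coefficient.\<close>

lemma coeff_tsq_mono: "Polynomial.coeff (tsq_mono m) k = hc (mono_deg m + k) (Stot (\<lambda>i. i) (mon m))"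
proof -
  define G :: "nat \<Rightarrow> 'a f2poly poly \<Rightarrow> bool" where "G e p \<longleftrightarrow> (\<forall>k. Polynomial.coeff p k \<in> hom (e + k))" for e p
  have G_mult: "G (e + f) (p * q)" if "G e p" "G f q" for e f p q
  proof -
    have "Polynomial.coeff p i * Polynomial.coeff q (k - i) \<in> hom (e + f + k)" if "i \<le> k" for i k
    proof -
      have "Polynomial.coeff p i * Polynomial.coeff q (k - i) \<in> hom ((e + i) + (f + (k - i)))"
        using \<open>G e p\<close> \<open>G f q\<close> unfolding G_def by (intro hom_mult) blast+
      moreover have "(e + i) + (f + (k - i)) = e + f + k" using that by simp
      ultimately show ?thesis by (simp only:)
    qed
    then show ?thesis
      by (auto simp: G_def coeff_mult intro!: MP.subspace_sum[OF hom_subspace])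
  qed
  have G_1: "G 0 1" by (auto simp: G_def hom_1)
  have G_power: "G (k * e) (p ^ k)" if "G e p" for k e p
    by (induction k) (simp_all add: G_1 G_mult that)
  have G_prod: "G (sum e A) (prod p A)" if "\<And>x. x \<in> A \<Longrightarrow> G (e x) (p x)" for e p and A :: "'a set"
    using that by (induction A rule: infinite_finite_induct) (simp_all add: G_1 G_mult)
  have V: "Var i = var i" for i :: 'a by (simp add: Var_def var_def)
  have "G 1 [:Var i, Var i ^ 2:]" for i
  proof -
    have "(var i :: 'a f2poly) \<in> hom (Suc 0)" "(var i ^ 2 :: 'a f2poly) \<in> hom (Suc (Suc 0))"
      unfolding var_power by (simp_all add: var_def hom_mon)
    then show ?thesis by (auto simp: G_def V coeff_pCons split: nat.split)
  qed
  then have "G (\<Sum>i\<in>UNIV. Poly_Mapping.lookup m i * 1) (tsq_mono m)"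
    unfolding tsq_mono_def by (intro G_prod G_power)
  then have G: "Polynomial.coeff (tsq_mono m) k \<in> hom (mono_deg m + k)" for k
    by (simp add: G_def mono_deg_def)
  have "Stot (\<lambda>i. i) (mon m) = poly (tsq_mono m) 1"
    by (simp add: Stot_def subst_mon tsq_mono_def poly_prod V)
  also have "\<dots> = (\<Sum>i\<le>Polynomial.degree (tsq_mono m). Polynomial.coeff (tsq_mono m) i)"
    by (simp add: poly_altdef)
  finally have "hc (mono_deg m + k) (Stot (\<lambda>i. i) (mon m)) =
      (\<Sum>i\<le>Polynomial.degree (tsq_mono m). if i = k then Polynomial.coeff (tsq_mono m) i else 0)"
    by (simp add: hc_sum hc_hom[OF G] cong: if_cong)
  also have "\<dots> = Polynomial.coeff (tsq_mono m) k"
    by (auto simp: coeff_eq_0)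
  finally show ?thesis by simp
qed

text \<open>\<open>hit\<close> is a span over all degrees at once. Since a square of a monomial is
  homogeneous, cutting a hit polynomial down to one degree leaves it hit by monomials of smaller
  degree.\<close>

lemma hit_hc: "f \<in> hit \<Longrightarrow> hc d f \<in> htw (\<lambda>i. i) d"
proof -
  assume f: "f \<in> hit"
  have mono: "hc d (Sq j g) \<in> htw (\<lambda>i. i) d" if "0 < j" for j and g :: "'a f2poly"
  proof (induction g rule: f2poly_induct)
    case (mono m)
    have "Sq j (mon m) = hc (mono_deg m + j) (Stot (\<lambda>i. i) (mon m))"
      by (simp add: Sq_eq_coeff coeff_tsq_mono)
    then have "hc d (Sq j (mon m)) = (if d = mono_deg m + j then hc d (Stot (\<lambda>i. i) (mon m)) else 0)"
      by (auto simp: hc_hom[OF hc_in_hom])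
    moreover have "(if d = mono_deg m + j then hc d (Stot (\<lambda>i. i) (mon m)) else 0) \<in> htw (\<lambda>i. i) d"
    proof (cases "d = mono_deg m + j")
      case True
      then have "mono_deg m < d" using that by simp
      from htw_base[OF this, of "\<lambda>i. i"] show ?thesis unfolding if_P[OF True] .
    next
      case False
      show ?thesis unfolding if_not_P[OF False] by (rule htw_closed(1))
    qed
    ultimately show ?case by (simp only:)
  qed (simp_all add: Sq_eq_coeff tsq_add hc_add htw_closed)
  have "f \<in> MP.span {Sq j g | j g. 0 < j}"
    using f by (simp add: hit_def scaleP_eq_smul)
  then show ?thesis
    unfolding htw_def
    by (rule MP_additive_span[OF hc_add hc_smul, rotated]) (use mono in \<open>auto simp: htw_def\<close>)
qed

lemma htw_subset_hit: "htw (\<lambda>i. i) d \<subseteq> (hit :: 'n::finite f2poly set)"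
proof -
  have "hc d (Stot (\<lambda>i. i) (mon m)) \<in> (hit :: 'n f2poly set)" if "mono_deg m < d" for m
  proof -
    have "hc d (Stot (\<lambda>i. i) (mon m)) = Sq (d - mono_deg m) (mon m :: 'n f2poly)"
      using that by (simp add: Sq_eq_coeff coeff_tsq_mono)
    then show ?thesis using that unfolding hit_def by (auto intro!: P.span_base)
  qed
  then show ?thesis
    unfolding htw_def using subspace_hit[where 'a='n] by (intro MP.span_minimal) (auto simp: scaleP_eq_smul)
qed

lemma abs_QP_eq_0_iff: "abs_QP f = 0 \<longleftrightarrow> f \<in> hit"
  by (simp add: zero_QP.abs_eq QP.abs_eq_iff hit_equiv_def)

lemma abs_QP_linear: "abs_QP (f + g) = abs_QP f + abs_QP g"
  "abs_QP (smul c f) = scaleQP c (abs_QP f)" "abs_QP (f - g) = abs_QP f - abs_QP g"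
  by (simp_all add: plus_QP.abs_eq scaleQP.abs_eq minus_QP.abs_eq scaleP_eq_smul)

lemma abs_QP_sum: "abs_QP (sum h A) = (\<Sum>x\<in>A. abs_QP (h x))"
  by (induction A rule: infinite_finite_induct) (simp_all add: abs_QP_linear zero_QP.abs_eq)

text \<open>The basis of the quotient is chosen among classes of monomials because monomials make
  sense over every field, as the extension of scalars requires.\<close>

lemma qbas_QP:
  "\<exists>M. M \<subseteq> {m. mono_deg m = d} \<and> qbas (\<lambda>i. i) d (mon ` M :: 'n::finite f2poly set) \<and>
    QP.dim (QP_deg d :: 'n QP set) = card M"
proof -
  let ?g = "\<lambda>m. abs_QP (mon m :: 'n f2poly)"
  obtain C where C: "C \<subseteq> ?g ` {m. mono_deg m = d}" "QP.independent C" "?g ` {m. mono_deg m = d} \<subseteq> QP.span C"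
    using QP.maximal_independent_subset by blast
  then obtain M where M: "M \<subseteq> {m. mono_deg m = d}" "inj_on ?g M" "C = ?g ` M"
    by (meson subset_image_inj)
  have fM: "finite M" using M(1) finite_mono_deg finite_subset by blast
  let ?B = "mon ` M :: 'n f2poly set"
  have BH: "?B \<subseteq> hom d" using M(1) hom_mon by blast
  then have spB: "MP.span ?B \<subseteq> hom d" by (intro MP.span_minimal hom_subspace)
  have lift: "\<exists>g\<in>MP.span ?B. q = abs_QP g" if "q \<in> QP.span C" for q
    using that
  proof (induction rule: QP.span_induct_alt)
    case base
    show ?case by (rule bexI[of _ 0]) (simp_all add: zero_QP.abs_eq MP.span_zero)
  next
    case (step c x y)
    then obtain m g where "m \<in> M" "x = abs_QP (mon m)" "g \<in> MP.span ?B" "y = abs_QP g"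
      using M(3) by blast
    moreover from this have "smul c (mon m) \<in> MP.span ?B" by (intro MP.span_scale MP.span_base) simp
    ultimately show ?case
      by (intro bexI[of _ "smul c (mon m) + g"])
        (simp_all add: abs_QP_linear MP.span_add del: smul_single)
  qed
  have spanC: "abs_QP f \<in> QP.span C" if "f \<in> hom d" for f
    using that unfolding hom_span
  proof (induction rule: MP.span_induct_alt)
    case base
    show ?case by (simp add: QP.span_zero flip: zero_QP.abs_eq)
  next
    case (step c x y)
    then show ?case using C(3) by (auto simp: abs_QP_linear simp del: smul_single intro!: QP.span_add QP.span_scale)
  qed
  have "f \<in> MP.span (?B \<union> htw (\<lambda>i. i) d)" if f: "f \<in> hom d" for f
  proof -
    obtain g where g: "g \<in> MP.span ?B" "abs_QP f = abs_QP g" using lift spanC[OF f] by blast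
    then have "hc d (f - g) \<in> htw (\<lambda>i. i) d"
      by (intro hit_hc) (simp add: abs_QP_linear flip: abs_QP_eq_0_iff)
    moreover have "hc d (f - g) = f - g"
      using f g(1) spB by (auto simp: hc_diff hom_def)
    ultimately have "f - g \<in> MP.span (?B \<union> htw (\<lambda>i. i) d)" by (auto intro: MP.span_base)
    moreover have "g \<in> MP.span (?B \<union> htw (\<lambda>i. i) d)"
      using g(1) MP.span_mono[of ?B "?B \<union> htw (\<lambda>i. i) d"] by blast
    ultimately show ?thesis using MP.span_add by fastforce
  qed
  moreover have "\<forall>b\<in>?B. c b = 0" if c: "(\<Sum>b\<in>?B. smul (c b) b) \<in> htw (\<lambda>i. i) d" for c
  proof -
    have injB: "inj_on abs_QP ?B" using M(2) by (auto simp: inj_on_def)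
    have CB: "C = abs_QP ` ?B" using M(3) by auto
    \<comment> \<open>\<open>abs_QP\<close> is injective on the chosen monomials, so coefficients on
      monomials can be read as coefficients on classes.\<close>
    define u where "u q = c (the_inv_into ?B abs_QP q)" for q
    have u: "u (abs_QP b) = c b" if "b \<in> ?B" for b
      using the_inv_into_f_f[OF injB that] by (simp add: u_def)
    have "0 = abs_QP (\<Sum>b\<in>?B. smul (c b) b)"
      by (rule abs_QP_eq_0_iff[THEN iffD2, symmetric]) (rule subsetD[OF htw_subset_hit c])
    also have "\<dots> = (\<Sum>b\<in>?B. scaleQP (u (abs_QP b)) (abs_QP b))"
      unfolding abs_QP_sum by (intro sum.cong) (simp_all add: abs_QP_linear(2) u del: smul_single)
    also have "\<dots> = (\<Sum>q\<in>C. scaleQP (u q) q)"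
      unfolding CB by (simp add: sum.reindex[OF injB])
    finally have "\<forall>q\<in>C. u q = 0"
      using C(2) QP.dependent_finite[of C] fM M(3) by auto
    then show ?thesis using u CB by auto
  qed
  ultimately have "qbas (\<lambda>i. i) d ?B" using fM BH by (auto simp: qbas_def)
  moreover have "card C = QP.dim (QP_deg d :: 'n QP set)"
  proof (rule QP.basis_card_eq_dim)
    show "C \<subseteq> QP_deg d"
    proof
      fix q assume "q \<in> C"
      then obtain m where "mono_deg m = d" "q = abs_QP (mon m)" using C(1) by blast
      then show "q \<in> QP_deg d" using hom_mon by (auto simp: QP_deg_def homogeneous_eq_hom)
    qed
    show "QP_deg d \<subseteq> QP.span C" using spanC by (auto simp: QP_deg_def homogeneous_eq_hom)
  qed (rule C(2))
  ultimately show ?thesis using M card_image[OF M(2)] by auto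
qed

section \<open>Extension of scalars\<close>

definition io :: "('n, bit) mpol \<Rightarrow> ('n, K) mpol"
  where "io f = Poly_Mapping.map to_ac f"

lemma lookup_io [simp]: "Poly_Mapping.lookup (io f) m = to_ac (Poly_Mapping.lookup f m)"
  by (simp add: io_def Poly_Mapping.map.rep_eq when_def)

lemma io_add: "io (f + g) = io f + io g"
  by (intro poly_mapping_eqI) (simp add: lookup_add)

lemma io_smul: "io (smul c f) = smul (to_ac c) (io f)"
  by (intro poly_mapping_eqI) simp

lemma io_single [simp]: "io (Poly_Mapping.single m c) = Poly_Mapping.single m (to_ac c)"
  by (intro poly_mapping_eqI) (simp add: lookup_single when_def)

lemma io_0 [simp]: "io 0 = 0"
  by (intro poly_mapping_eqI) simp

lemma io_mult: "io (f * g) = io f * io g"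
proof (induction f rule: mpol_induct)
  case (single a c)
  show ?case by (induction g rule: mpol_induct) (simp_all add: mult_single io_add distrib_left)
qed (simp_all add: io_add distrib_right)

lemma io_1 [simp]: "io 1 = 1"
  by (simp flip: single_one)

lemma io_power: "io (f ^ k) = io f ^ k"
  by (induction k) (simp_all add: io_mult)

lemma io_prod: "io (prod h A) = (\<Prod>x\<in>A. io (h x))"
  by (induction A rule: infinite_finite_induct) (simp_all add: io_mult)

lemma io_Stot_mon: "io (Stot \<sigma> (mon m)) = Stot \<sigma> (mon m)"
  by (simp add: Stot_def subst_mon io_prod io_power io_add var_def)

lemma io_hc: "io (hc d f) = hc d (io f)"
  by (intro poly_mapping_eqI) (simp add: lookup_hc)

lemma io_span:
  assumes "\<And>x. x \<in> A \<Longrightarrow> io x \<in> MP.span B" "x \<in> MP.span A"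
  shows "io x \<in> MP.span B"
  using assms(2)
  by (induction rule: MP.span_induct_alt)
    (simp_all add: MP.span_zero io_add io_smul MP.span_add MP.span_scale assms(1))

text \<open>A nonzero element of \<open>K\<close> is independent over F_2, so a linear functional
  with value 1 there exists. Such functionals bring relations over \<open>K\<close> down to
  F_2.\<close>

lemma ex_bit_functional:
  assumes "(c :: K) \<noteq> 0"
  shows "\<exists>l. (\<forall>x y. l (x + y) = l x + l y) \<and> (\<forall>x y. l (to_ac x * y) = x * l y) \<and> l c = (1 :: bit)"
proof -
  interpret vector_space_pair "\<lambda>x (y :: K). to_ac x * y" "(*) :: bit \<Rightarrow> bit \<Rightarrow> bit"
    by unfold_locales (simp_all add: algebra_simps)
  obtain g where g: "Vector_Spaces.linear (\<lambda>x (y :: K). to_ac x * y) ((*) :: bit \<Rightarrow> bit \<Rightarrow> bit) g" "\<forall>x\<in>{c}. g x = 1"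
    using linear_independent_extend[of "{c}" "\<lambda>_. 1"] assms by auto
  interpret g: Vector_Spaces.linear "\<lambda>x (y :: K). to_ac x * y" "(*) :: bit \<Rightarrow> bit \<Rightarrow> bit" g by fact
  show ?thesis using g(2) g.add g.scale by (intro exI[of _ g]) auto
qed

text \<open>The generators of the hit space have coefficients in F_2, so spanning survives the
  extension. For independence, a relation over \<open>K\<close> with a nonzero coefficient is
  pushed, coefficient by coefficient, through a functional with value 1 on that coefficient; the
  outcome is a nontrivial relation over F_2.\<close>

lemma qbas_io:
  fixes M :: "('n::finite \<Rightarrow>\<^sub>0 nat) set"
  assumes "qbas \<sigma> d (mon ` M :: ('n, bit) mpol set)"
  shows "qbas \<sigma> d (mon ` M :: ('n, K) mpol set)"
proof -
  let ?B = "mon ` M :: ('n, bit) mpol set" and ?C = "mon ` M :: ('n, K) mpol set"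
  have inj: "inj_on (mon :: _ \<Rightarrow> ('n, 'b::field) mpol) M" for M
    by (rule inj_onI) (metis keys_single singleton_inject zero_neq_one)
  have B: "finite ?B" "?B \<subseteq> hom d" "hom d \<subseteq> MP.span (?B \<union> htw \<sigma> d)"
    "\<And>c. (\<Sum>b\<in>?B. smul (c b) b) \<in> htw \<sigma> d \<Longrightarrow> \<forall>b\<in>?B. c b = 0"
    using assms by (auto simp: qbas_def)
  have fM: "finite M" using B(1) finite_imageD inj by blast
  have dM: "\<forall>m\<in>M. mono_deg m = d" using B(2) by (auto simp: hom_iff)
  have gens: "{hc d (Stot \<sigma> (mon m)) |m. mono_deg m < d} =
      io ` {hc d (Stot \<sigma> (mon m)) |m. mono_deg m < d}"
    unfolding setcompr_eq_image image_image by (simp add: io_hc io_Stot_mon)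
  have io_htw: "io x \<in> htw \<sigma> d" if "x \<in> htw \<sigma> d" for x
    using that unfolding htw_def by (rule io_span[rotated]) (auto intro: MP.span_base simp: gens)
  have "hom d \<subseteq> MP.span (?C \<union> htw \<sigma> d)"
    unfolding hom_span
  proof (rule MP.span_minimal)
    show "mon ` {m. mono_deg m = d} \<subseteq> MP.span (?C \<union> htw \<sigma> d)"
    proof (rule image_subsetI)
      fix m :: "'n \<Rightarrow>\<^sub>0 nat" assume "m \<in> {m. mono_deg m = d}"
      then have "mono_deg m = d" by simp
      then have "mon m \<in> MP.span (?B \<union> htw \<sigma> d)" using B(3) hom_mon by blast
      then have "io (mon m) \<in> MP.span (?C \<union> htw \<sigma> d)"
        by (rule io_span[rotated]) (auto intro: MP.span_base io_htw)
      then show "mon m \<in> MP.span (?C \<union> htw \<sigma> d)" by simp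
    qed
  qed simp
  moreover have "\<forall>b\<in>?C. c b = 0" if c: "(\<Sum>b\<in>?C. smul (c b) b) \<in> htw \<sigma> d" for c
  proof (rule ccontr)
    assume "\<not> (\<forall>b\<in>?C. c b = 0)"
    then obtain m0 where m0: "m0 \<in> M" "c (mon m0) \<noteq> 0" by auto
    obtain l where l: "\<And>x y. l (x + y) = l x + l y" "\<And>x y. l (to_ac x * y) = x * l y" "l (c (mon m0)) = (1 :: bit)"
      using ex_bit_functional[OF m0(2)] by blast
    have l0: "l 0 = 0" using l(2)[of 0 0] by simp
    define La where "La f = Poly_Mapping.map l f" for f :: "('n, K) mpol"
    have lookup_La: "Poly_Mapping.lookup (La f) m = l (Poly_Mapping.lookup f m)" for f m
      by (simp add: La_def Poly_Mapping.map.rep_eq when_def l0)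
    have La_add: "La (f + g) = La f + La g" for f g
      by (intro poly_mapping_eqI) (simp add: lookup_add lookup_La l)
    have La_0: "La 0 = 0" by (intro poly_mapping_eqI) (simp add: lookup_La l0)
    have La_sum: "La (sum h A) = (\<Sum>x\<in>A. La (h x))" for h and A :: "('n \<Rightarrow>\<^sub>0 nat) set"
      by (induction A rule: infinite_finite_induct) (simp_all add: La_0 La_add)
    have La_io: "La (smul k (io r)) = smul (l k) r" for k r
      by (intro poly_mapping_eqI) (simp add: lookup_La l(2) mult.commute[of k] mult.commute[of "l k"])
    have "La x \<in> htw \<sigma> d" if "x \<in> htw \<sigma> d" for x
      using that unfolding htw_def gens
    proof (induction rule: MP.span_induct_alt)
      case (step k x y)
      then obtain r where "x = io r" "r \<in> {hc d (Stot \<sigma> (mon m)) |m. mono_deg m < d}" by blast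
      with step show ?case by (simp only: La_add La_io MP.span_add MP.span_scale MP.span_base)
    qed (simp add: La_0 MP.span_zero)
    from this[OF c] have "(\<Sum>m\<in>M. smul (l (c (mon m))) (mon m)) \<in> (htw \<sigma> d :: ('n, bit) mpol set)"
      using La_io[of _ "mon _"] by (simp add: sum.reindex[OF inj] La_sum)
    moreover have "(\<Sum>b\<in>?B. smul (l (c (io b))) b) = (\<Sum>m\<in>M. smul (l (c (mon m))) (mon m :: ('n, bit) mpol))"
      by (simp add: sum.reindex[OF inj])
    ultimately have "\<forall>b\<in>?B. l (c (io b)) = 0"
      by (intro B(4)) simp
    then show False using m0(1) l(3) by auto
  qed
  ultimately show ?thesis using fM dM by (auto simp: qbas_def hom_mon)
qed

section \<open>Conjugation by a self-dual normal basis\<close>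

lemma UNIV_5: "(UNIV :: 5 set) = {0, 1, 2, 3, 4}"
proof -
  have "card {0, 1, 2, 3, 4 :: 5} = card (UNIV :: 5 set)" by simp
  then show ?thesis by (metis card_subset_eq finite subset_UNIV)
qed

lemma exhaust_5: "(i :: 5) = 0 \<or> i = 1 \<or> i = 2 \<or> i = 3 \<or> i = 4"
  using UNIV_5 by blast

lemma sum_5: "(\<Sum>i\<in>UNIV. f (i :: 5)) = f 0 + f 1 + f 2 + f 3 + f 4"
  unfolding UNIV_5 by (simp add: add.assoc)

text \<open>The conjugates of a root x are x, x^2, x^4, x^8, x^16. The first three equations reduce
  x^8 and x^16 and close the cycle. The last three are the sums of products of conjugates at index
  distance 0, 1 and 2; distances 3 and 4 follow by symmetry.\<close>

lemma quintic_relations: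
  fixes x :: "'a::idom"
  assumes two: "(2 :: 'a) = 0" and x: "1 + x + x^2 + x^4 + x^5 = 0"
  shows "x^8 = x + x^3"
    "(x + x^3)^2 = 1 + x^2 + x^3 + x^4"
    "(1 + x^2 + x^3 + x^4)^2 = x"
    "x * x + x^2 * x^2 + x^4 * x^4 + (x + x^3) * (x + x^3) + (1 + x^2 + x^3 + x^4) * (1 + x^2 + x^3 + x^4) = 1"
    "x * x^2 + x^2 * x^4 + x^4 * (x + x^3) + (x + x^3) * (1 + x^2 + x^3 + x^4) + (1 + x^2 + x^3 + x^4) * x = 0"
    "x * x^4 + x^2 * (x + x^3) + x^4 * (1 + x^2 + x^3 + x^4) + (x + x^3) * x + (1 + x^2 + x^3 + x^4) * x^2 = 0"
proof -
  \<comment> \<open>Each claim holds modulo the quintic and 2. The instances of \<open>q\<close> and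
    \<open>r\<close> are the two cofactors, with integer coefficients, that turn it into a
    polynomial identity.\<close>
  have mod2: "a = b" if "a = b + (1 + x + x^2 + x^4 + x^5) * q + 2 * r" for a b q r :: 'a
    using that by (simp add: x two)
  show "x^8 = x + x^3"
    by (rule mod2[of _ _ "x^3 - x^2 + x - 2" "1 + x^2 - x^3 + x^4"]) (simp add: algebra_simps eval_nat_numeral)
  show "(x + x^3)^2 = 1 + x^2 + x^3 + x^4"
    by (rule mod2[of _ _ "-1 + x" "x^4 - x^3"]) (simp add: algebra_simps eval_nat_numeral)
  show "(1 + x^2 + x^3 + x^4)^2 = x"
    by (rule mod2[of _ _ "-1 + 2*x + x^2 + x^3" "1 - x - x^3 + x^4"]) (simp add: algebra_simps eval_nat_numeral)
  show "x * x + x^2 * x^2 + x^4 * x^4 + (x + x^3) * (x + x^3) + (1 + x^2 + x^3 + x^4) * (1 + x^2 + x^3 + x^4) = 1"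
    by (rule mod2[of _ _ "-4 + 4*x + 2*x^3" "2 + 2*x^2 - 2*x^3 + 4*x^4"]) (simp add: algebra_simps eval_nat_numeral)
  show "x * x^2 + x^2 * x^4 + x^4 * (x + x^3) + (x + x^3) * (1 + x^2 + x^3 + x^4) + (1 + x^2 + x^3 + x^4) * x = 0"
    by (rule mod2[of _ _ "4 + 2*x^2" "-2 - x - 3*x^2 + x^3 - 2*x^4"]) (simp add: algebra_simps eval_nat_numeral)
  show "x * x^4 + x^2 * (x + x^3) + x^4 * (1 + x^2 + x^3 + x^4) + (x + x^3) * x + (1 + x^2 + x^3 + x^4) * x^2 = 0"
    by (rule mod2[of _ _ "2*x + x^3" "x^4 - x^3 - x"]) (simp add: algebra_simps eval_nat_numeral)
qed

text \<open>\<open>g\<close> lists the conjugates of a root of the quintic, so the sum over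
  \<open>j\<close> is the trace of \<open>g 0 * g m\<close>. The quintic is one whose roots form a
  normal basis that is orthonormal for the trace form; algebraic closedness supplies the
  root.\<close>

lemma ex_self_dual_normal:
  "\<exists>g :: 5 \<Rightarrow> K. (\<forall>i. g (i + 1) = g i ^ 2) \<and> (\<forall>m. (\<Sum>j\<in>UNIV. g j * g (j + m)) = (if m = 0 then 1 else 0))"
proof -
  obtain x :: K where "poly [:1, 1, 1, 0, 1, 1:] x = 0"
    using alg_closed_imp_poly_has_root[of "[:1, 1, 1, 0, 1, 1 :: K:]"] by auto
  then have x: "1 + x + x^2 + x^4 + x^5 = 0"
    by (simp add: algebra_simps power2_eq_square power4_eq_xxxx power_numeral_odd)
  note rel = quintic_relations[OF K_two x]
  define g :: "5 \<Rightarrow> K" where "g i = (if i = 0 then x else if i = 1 then x^2 else if i = 2 then x^4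
    else if i = 3 then x + x^3 else 1 + x^2 + x^3 + x^4)" for i
  \<comment> \<open>The literals 5 to 8 arise as sums of two indices and are read modulo 5.\<close>
  have gs: "g 0 = x" "g 1 = x^2" "g 2 = x^4" "g 3 = x + x^3" "g 4 = 1 + x^2 + x^3 + x^4" "g 5 = x" "g 6 = x^2" "g 7 = x^4" "g 8 = x + x^3"
    by (simp_all add: g_def)
  have "g (i + 1) = g i ^ 2" for i
    using exhaust_5[of i] by (elim disjE) (simp_all add: gs rel(1-3))
  moreover have "(\<Sum>j\<in>UNIV. g j * g (j + m)) = (if m = 0 then 1 else 0)" for m
    using exhaust_5[of m] rel(4-6)
    by (elim disjE) (simp_all add: sum_5 gs ac_simps)
  ultimately show ?thesis by blast
qed

text \<open>Squaring the new variable of index i - 1, the sum of g(i-1+j) x_j, moves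
  \<open>g\<close> to the next index and gives the sum of g(i+j) x_j^2. Hence the twist lowers the
  index.\<close>

definition tw :: "5 \<Rightarrow> 5" where "tw i = i - 1"

lemma bij_tw: "bij tw"
  by (rule bij_betw_byWitness[of _ "\<lambda>i. i + 1"]) (auto simp: tw_def)

text \<open>The matrix g(i+j) is symmetric and, by self-duality, its own inverse. So the
  substitution \<open>T\<close> is an involution, and \<open>comm\<close>, which says that it turns
  the total square into the twisted one, gives both directions. \<open>T\<close> preserves degrees
  because it is linear in the variables.\<close>

lemma qbas_twist:
  fixes B :: "(5, K) mpol set"
  assumes B: "qbas (\<lambda>i. i) d B"
  shows "\<exists>B' :: (5, K) mpol set. qbas tw d B' \<and> card B' = card B"
proof -
  obtain g :: "5 \<Rightarrow> K" where g: "\<And>i. g (i + 1) = g i ^ 2"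
    "\<And>m. (\<Sum>j\<in>UNIV. g j * g (j + m)) = (if m = 0 then 1 else 0)"
    using ex_self_dual_normal by blast
  define t where "t i = (\<Sum>j\<in>UNIV. smul (g (i + j)) (var j))" for i
  define T where "T = subst t"
  have T_lin: "T (a + b) = T a + T b" "T (smul c a) = smul c (T a)" for a b c
    by (simp_all add: T_def subst_linear)
  have T_0: "T 0 = 0" by (simp add: T_def)
  have T_sum: "T (sum h A) = (\<Sum>x\<in>A. T (h x))" for h and A :: "(5, K) mpol set"
    by (simp add: T_def subst_linear)
  have shift: "(\<Sum>j\<in>UNIV. h (j + k)) = (\<Sum>j\<in>UNIV. h j)" for h :: "5 \<Rightarrow> 'x::comm_monoid_add" and k :: 5
    by (rule sum.reindex_bij_betw) (rule bij_betw_byWitness[of _ "\<lambda>i. i - k"], auto)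
  have orth: "(\<Sum>j\<in>UNIV. g (i + j) * g (j + k)) = (if k = i then 1 else 0)" for i k
  proof -
    have "(\<Sum>j\<in>UNIV. g (i + j) * g (j + k)) = (\<Sum>j\<in>UNIV. g (j + i) * g ((j + i) + (k - i)))"
      by (simp add: add.commute)
    also have "\<dots> = (\<Sum>j\<in>UNIV. g j * g (j + (k - i)))" by (rule shift)
    finally show ?thesis by (simp add: g(2))
  qed
  have "subst t (t i) = var i" for i
  proof -
    have "subst t (t i) = (\<Sum>j\<in>UNIV. \<Sum>k\<in>UNIV. smul (g (i + j) * g (j + k)) (var k))"
      unfolding t_def[of i] by (simp add: subst_linear) (simp add: t_def MP.scale_sum_right)
    also have "\<dots> = (\<Sum>k\<in>UNIV. smul (\<Sum>j\<in>UNIV. g (i + j) * g (j + k)) (var k))"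
      by (subst sum.swap) (simp add: MP.scale_sum_left)
    also have "\<dots> = (\<Sum>k\<in>UNIV. if k = i then var k else 0)"
      by (intro sum.cong) (simp_all add: orth)
    finally show ?thesis by simp
  qed
  then have TT: "T (T f) = f" for f by (simp add: T_def subst_comp subst_id)
  have t_hom: "t i \<in> hom 1" for i
    unfolding t_def by (intro MP.subspace_sum[OF hom_subspace] MP.subspace_scale[OF hom_subspace])
      (simp add: var_def hom_mon)
  have T_mon: "T (mon m) \<in> hom (mono_deg m)" for m
  proof -
    have "T (mon m) \<in> hom (\<Sum>i\<in>UNIV. 1 * Poly_Mapping.lookup m i)"
      unfolding T_def subst_mon by (intro hom_prod hom_power t_hom)
    then show ?thesis by (simp add: mono_deg_def)
  qed
  have T_hc: "hc e (T f) = T (hc e f)" for e f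
  proof (induction f rule: mpol_induct)
    case (single m c)
    have "hc e (T (smul c (mon m))) = T (hc e (smul c (mon m)))"
      using hc_hom[OF T_mon, of e m] by (simp add: T_lin T_0 hc_smul del: smul_single)
    then show ?case by simp
  qed (simp_all add: T_lin T_0 hc_add)
  have T_hom: "T f \<in> hom e" if "f \<in> hom e" for e f
    using that T_hc[of e f] by (simp add: hom_def)
  have comm: "Stot tw (T f) = T (Stot (\<lambda>i. i) f)" for f
  proof -
    have "subst (\<lambda>i. var i + var (tw i) ^ 2) (t i) = subst t (var i + var i ^ 2)" for i
    proof -
      \<comment> \<open>Frobenius advances the index of \<open>g\<close>; re-indexing the sum
        transfers this shift to the variables.\<close>
      have "t i ^ 2 = (\<Sum>j\<in>UNIV. smul (g (i + j)) (var j) ^ 2)"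
        unfolding t_def by (rule mpolK_frobenius_sum) simp
      also have "\<dots> = (\<Sum>j\<in>UNIV. smul (g (i + j + 1)) (var j ^ 2))"
        by (simp add: g(1) power2_eq_square smul_mult_left smul_mult_right)
      also have "\<dots> = (\<Sum>j\<in>UNIV. smul (g (i + j)) (var (tw j) ^ 2))"
        using shift[of "\<lambda>j. smul (g (i + j)) (var (tw j) ^ 2)" 1] by (simp add: tw_def add.assoc)
      finally show ?thesis
        by (simp add: subst_linear subst_power t_def MP.scale_right_distrib sum.distrib)
    qed
    then show ?thesis by (simp add: Stot_def T_def subst_comp)
  qed
  have comm': "Stot (\<lambda>i. i) (T f) = T (Stot tw f)" for f
    using comm[of "T f"] by (metis TT)
  have low: "T (mon m) \<in> MP.span (mon ` {m. mono_deg m \<noteq> d})" if "mono_deg m < d" for m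
  proof -
    have "T (mon m) \<in> MP.span (mon ` {k. mono_deg k = mono_deg m})"
      using T_mon by (simp add: hom_span)
    then show ?thesis
      using MP.span_mono[of "mon ` {k. mono_deg k = mono_deg m}" "mon ` {k. mono_deg k \<noteq> d}"] that
      by fastforce
  qed
  have T_htw: "T f \<in> htw tw d" if "f \<in> htw (\<lambda>i. i) d" for f
    using that unfolding htw_def[of "\<lambda>i. i"]
  proof (induction rule: MP.span_induct_alt)
    case (step c x y)
    then obtain m where m: "x = hc d (Stot (\<lambda>i. i) (mon m))" "mono_deg m < d" by blast
    have "T x = hc d (Stot tw (T (mon m)))" by (simp add: m(1) comm T_hc)
    then have "T x \<in> htw tw d" using Stot_hit_span[OF low[OF m(2)], of tw] by simp
    then show ?case using step by (simp add: T_lin htw_closed)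
  qed (simp add: T_def htw_closed)
  have T_htw': "T f \<in> htw (\<lambda>i. i) d" if "f \<in> htw tw d" for f
    using that unfolding htw_def[of tw]
  proof (induction rule: MP.span_induct_alt)
    case (step c x y)
    then obtain m where m: "x = hc d (Stot tw (mon m))" "mono_deg m < d" by blast
    have "T x = hc d (Stot (\<lambda>i. i) (T (mon m)))" by (simp add: m(1) comm' T_hc)
    then have "T x \<in> htw (\<lambda>i. i) d" using Stot_hit_span[OF low[OF m(2)], of "\<lambda>i. i"] by simp
    then show ?case using step by (simp add: T_lin htw_closed)
  qed (simp add: T_def htw_closed)
  have inj: "inj T" by (rule injI) (metis TT)
  have B': "finite B" "B \<subseteq> hom d" "hom d \<subseteq> MP.span (B \<union> htw (\<lambda>i. i) d)"
    "\<And>c. (\<Sum>b\<in>B. smul (c b) b) \<in> htw (\<lambda>i. i) d \<Longrightarrow> \<forall>b\<in>B. c b = 0"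
    using B by (auto simp: qbas_def)
  have "f \<in> MP.span (T ` B \<union> htw tw d)" if "f \<in> hom d" for f
  proof -
    have "T f \<in> MP.span (B \<union> htw (\<lambda>i. i) d)" using B'(3) T_hom[OF that] by blast
    then have "T (T f) \<in> MP.span (T ` B \<union> htw tw d)"
      by (rule MP_additive_span[OF T_lin, rotated]) (auto intro: MP.span_base T_htw)
    then show ?thesis by (simp add: TT)
  qed
  moreover have "\<forall>b\<in>T ` B. c b = 0" if c: "(\<Sum>b\<in>T ` B. smul (c b) b) \<in> htw tw d" for c
  proof -
    have "(\<Sum>b\<in>T ` B. smul (c b) b) = T (\<Sum>b\<in>B. smul (c (T b)) b)"
      using inj by (simp add: sum.reindex inj_on_def inj_def T_sum T_lin)
    then have "(\<Sum>b\<in>B. smul (c (T b)) b) \<in> htw (\<lambda>i. i) d"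
      using T_htw'[OF c] by (simp add: TT)
    then show ?thesis using B'(4)[of "\<lambda>b. c (T b)"] by blast
  qed
  ultimately have "qbas tw d (T ` B)"
    using B'(1,2) T_hom by (auto simp: qbas_def)
  moreover have "card (T ` B) = card B" using inj by (intro card_image) (auto simp: inj_on_def inj_def)
  ultimately show ?thesis by blast
qed

section \<open>Reduction to degree 25\<close>

text \<open>In binary 15 * 2^s - 2 has s + 2 ones, so it is not a power of 2. The proof compares
  parity and size after one halving.\<close>

lemma power2_eq_cases: "(2::nat) ^ a + 2 \<noteq> 15 * 2 ^ s" if s: "0 < s"
proof
  assume eq: "(2::nat) ^ a + 2 = 15 * 2 ^ s"
  obtain t where t: "s = Suc t" using gr0_implies_Suc[OF s] by blast
  show False
  proof (cases a)
    case 0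
    have "even (2 ^ a + 2 :: nat)" unfolding eq t by simp
    then show ?thesis using 0 by simp
  next
    case (Suc b)
    then have e: "2 ^ b + 1 = 15 * (2::nat) ^ t" using eq t by simp
    show ?thesis
    proof (cases t)
      case 0
      then have "2 ^ b = (14::nat)" using e by simp
      moreover have "2 ^ b \<le> (8::nat) \<or> 16 \<le> (2::nat) ^ b"
      proof (cases "b \<le> 3")
        case True
        then have "(2::nat) ^ b \<le> 2 ^ 3" by (intro power_increasing) auto
        then show ?thesis by simp
      next
        case False
        then have "(2::nat) ^ 4 \<le> 2 ^ b" by (intro power_increasing) auto
        then show ?thesis by simp
      qed
      ultimately show ?thesis by simp
    next
      case (Suc u)
      then have "even (2 ^ b + 1 :: nat)" using e by simp
      then have "b = 0" by (cases b) auto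
      moreover have "(30::nat) \<le> 15 * 2 ^ t" using power_increasing[of 1 t "2::nat"] Suc by simp
      ultimately show ?thesis using e by simp
    qed
  qed
qed

text \<open>In binary 15 * 2^s - 1 has s + 3 ones, too many for three powers of 2. By parity one of
  the powers is 1, which leaves the case of two powers, \<open>main\<close>.\<close>

lemma power2_eq_cases3: "(2::nat) ^ a + 2 ^ b + 2 ^ c + 1 \<noteq> 15 * 2 ^ s" if s: "0 < s"
proof -
  have main: "(2::nat) ^ a + 2 ^ b + 2 \<noteq> 15 * 2 ^ s" for a b
  proof
    assume eq: "(2::nat) ^ a + 2 ^ b + 2 = 15 * 2 ^ s"
    obtain t where t: "s = Suc t" using gr0_implies_Suc[OF s] by blast
    have ev: "even (2 ^ a + 2 ^ b + 2 :: nat)" unfolding eq t by simp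
    show False
    proof (cases "a = 0 \<or> b = 0")
      case True
      then have "a = 0" "b = 0" using ev by (cases a; cases b; simp)+
      moreover have "(30::nat) \<le> 15 * 2 ^ s" using s power_increasing[of 1 s "2::nat"] by simp
      ultimately show ?thesis using eq by simp
    next
      case False
      then obtain a' b' where ab: "a = Suc a'" "b = Suc b'" by (meson not0_implies_Suc)
      have e: "2 ^ a' + 2 ^ b' + 1 = 15 * (2::nat) ^ t" using eq t ab by simp
      have small: "x = 1 \<or> x = 2 \<or> x = 4 \<or> x = 8 \<or> 16 \<le> x" if "x = 2 ^ k" for x k :: nat
      proof (cases "k \<le> 3")
        case True
        then have "k = 0 \<or> k = 1 \<or> k = 2 \<or> k = 3" by auto
        then show ?thesis using that by auto
      next
        case False
        then have "(2::nat) ^ 4 \<le> 2 ^ k" by (intro power_increasing) auto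
        then show ?thesis using that by simp
      qed
      show ?thesis
      proof (cases t)
        case 0
        then show ?thesis using e small[of "2 ^ a'" a'] small[of "2 ^ b'" b'] by auto
      next
        case (Suc u)
        then have "even (2 ^ a' + 2 ^ b' + 1 :: nat)" unfolding e by simp
        then consider "a' = 0" "b' \<noteq> 0" | "b' = 0" "a' \<noteq> 0" by (cases a'; cases b'; simp)
        then show ?thesis
          using e power2_eq_cases[of t b'] power2_eq_cases[of t a'] Suc by cases simp_all
      qed
    qed
  qed
  show ?thesis
  proof
    assume eq: "(2::nat) ^ a + 2 ^ b + 2 ^ c + 1 = 15 * 2 ^ s"
    have "even (2 ^ a + 2 ^ b + 2 ^ c + 1 :: nat)" unfolding eq using s by simp
    then consider "a = 0" | "b = 0" | "c = 0" by (cases a; cases b; cases c; simp)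
    then show False
      using eq main[of b c] main[of a c] main[of a b] by cases (simp_all add: ac_simps)
  qed
qed

text \<open>The target degree \<open>2 * (?Q - 5) + 5\<close> is odd, so a monomial with an even
  exponent has one or three odd ones. For these the \<chi>-trick asks that \<open>?Q - 2\<close> is
  not a power of 2 and that \<open>?Q - 1\<close> is not a sum of three.\<close>

lemma twisted_step:
  fixes B :: "(5, K) mpol set"
  assumes s: "0 < s" and B: "qbas tw (15 * 2 ^ s - 5) B"
  shows "\<exists>B' :: (5, K) mpol set. qbas tw (15 * 2 ^ Suc s - 5) B' \<and> card B' = card B"
proof -
  let ?Q = "15 * 2 ^ s :: nat"
  have Q: "?Q \<ge> 30" using s power_increasing[of 1 s "2::nat"] by simp
  then have D: "2 * (?Q - 5) + CARD(5) = 15 * 2 ^ Suc s - 5" by simp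
  have "(mon m :: (5, K) mpol) \<in> htw tw (2 * (?Q - 5) + CARD(5))"
    if m: "mono_deg m = 2 * (?Q - 5) + CARD(5)" "even (Poly_Mapping.lookup m i)" for m i
  proof -
    obtain z y where zy: "m = ind z + (y + y)" using parity_decomp by blast
    have iz: "i \<notin> z" using m(2) by (auto simp: zy lookup_add lookup_ind)
    have deg: "card z + 2 * mono_deg y = 2 * (?Q - 5) + 5" using m(1) by (simp add: zy)
    have "card z < 5" using psubset_card_mono[of UNIV z] iz by auto
    moreover have "odd (card z)"
    proof -
      have "odd (card z + 2 * mono_deg y)" unfolding deg by simp
      then show ?thesis by simp
    qed
    moreover have "c = 1 \<or> c = 3" if "c < 5" "odd c" for c :: nat using that by presburger
    ultimately have "card z = 1 \<or> card z = 3" by blast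
    then have "(\<Sum>j\<in>z. 2 ^ a j) \<noteq> card z + mono_deg y" for a :: "5 \<Rightarrow> nat"
    proof
      assume c: "card z = 1"
      then obtain p where p: "z = {p}" using card_1_singletonE by blast
      have "mono_deg y + 3 = ?Q" using deg c Q by linarith
      then show ?thesis using power2_eq_cases[OF s, of "a p"] c p by auto
    next
      assume c: "card z = 3"
      then obtain p q r where p: "z = {p, q, r}" "p \<noteq> q" "q \<noteq> r" "p \<noteq> r" by (auto simp: card_3_iff)
      have "mono_deg y + 4 = ?Q" using deg c Q by linarith
      then show ?thesis using power2_eq_cases3[OF s, of "a p" "a q" "a r"] c p by auto
    qed
    from hit_monomial[OF bij_tw this]
    have "mon (ind z) * dbl (mon y) \<in> (htw tw (card z + 2 * mono_deg y) :: (5, K) mpol set)" .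
    then show ?thesis unfolding deg by (simp add: dbl_mon mult_single zy)
  qed
  from kameko[OF this B] show ?thesis unfolding D .
qed

text \<open>Climbing from degree 25 gives one basis in the twisted variables; extending scalars and
  twisting a monomial basis of the quotient gives another. Their sizes agree.\<close>

lemma reduction_to_degree_25:
  assumes s: "0 < s" and B: "qbas tw 25 (B :: (5, K) mpol set)"
  shows "QP.dim (QP_deg (15 * 2 ^ s - 5) :: 5 QP set) = card B"
proof -
  have "\<exists>B' :: (5, K) mpol set. qbas tw (15 * 2 ^ s - 5) B' \<and> card B' = card B"
    using s
  proof (induction s rule: nat_induct_non_zero)
    case 1
    then show ?case using B by (intro exI[of _ B]) simp
  next
    case (Suc s)
    then show ?case using twisted_step by metis
  qed
  moreover obtain M where "qbas (\<lambda>i. i) (15 * 2 ^ s - 5) (mon ` M :: 5 f2poly set)"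
    and dim: "QP.dim (QP_deg (15 * 2 ^ s - 5) :: 5 QP set) = card M"
    using qbas_QP[of "15 * 2 ^ s - 5"] by blast
  from qbas_twist[OF qbas_io[OF this(1)]]
  obtain C :: "(5, K) mpol set" where "qbas tw (15 * 2 ^ s - 5) C" "card C = card (mon ` M :: (5, K) mpol set)"
    by blast
  moreover have "card (mon ` M :: (5, K) mpol set) = card M"
    by (intro card_image inj_onI) (metis keys_single singleton_inject zero_neq_one)
  ultimately show ?thesis using qbas_card_unique dim by metis
qed

section \<open>Linear functionals\<close>

text \<open>A functional is encoded as a linear extension with constant polynomials as values, so
  that linearity is inherited from \<open>lext\<close>.\<close>

definition fext :: "(('n \<Rightarrow>\<^sub>0 nat) \<Rightarrow> 'a::field) \<Rightarrow> ('n, 'a) mpol \<Rightarrow> 'a"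
  where "fext \<phi> f = Poly_Mapping.lookup (lext (\<lambda>m. Poly_Mapping.single (0 :: 'n \<Rightarrow>\<^sub>0 nat) (\<phi> m)) f) 0"

lemma fext_add: "fext \<phi> (f + g) = fext \<phi> f + fext \<phi> g"
  and fext_smul: "fext \<phi> (smul c f) = c * fext \<phi> f"
  and fext_sum: "fext \<phi> (sum h A) = (\<Sum>x\<in>A. fext \<phi> (h x))"
  and fext_0 [simp]: "fext \<phi> 0 = 0"
  and fext_single [simp]: "fext \<phi> (Poly_Mapping.single m c) = c * \<phi> m"
  by (simp_all add: fext_def lext_add lext_smul lext_sum lookup_add lookup_sum)

lemma fext_span:
  assumes "\<And>x. x \<in> A \<Longrightarrow> fext \<phi> x = 0" "x \<in> MP.span A"
  shows "fext \<phi> x = 0"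
  using assms(2) by (induction rule: MP.span_induct_alt) (simp_all add: fext_add fext_smul assms(1))

section \<open>Structure of the hit relations in degree 25\<close>

abbreviation sqz :: "5 set \<Rightarrow> (5, K) mpol \<Rightarrow> (5, K) mpol"
  where "sqz z f \<equiv> mon (ind z) * dbl f"

abbreviation tvars :: "5 set \<Rightarrow> (5, K) mpol"
  where "tvars A \<equiv> (\<Prod>i\<in>A. var (i - 1))"

lemma sqz_mon: "sqz z (mon y) = mon (ind z + (y + y))"
  by (simp add: dbl_mon mult_single)

lemma sqz_linear: "sqz z (f + g) = sqz z f + sqz z g" "sqz z (smul c f) = smul c (sqz z f)" "sqz z 0 = 0"
  "sqz z (sum h A) = (\<Sum>x\<in>A. sqz z (h x))"
  by (simp_all add: dbl_linear distrib_left smul_mult_right sum_distrib_left)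

lemma card_le_5: "card (z :: 5 set) \<le> 5"
  using card_mono[of UNIV z] by simp

lemma tvars_mon: "tvars A = mon (ind ((\<lambda>i. i - 1) ` A))"
  by (simp add: mon_ind prod.reindex inj_on_def)

lemma hc_tvars: "hc D (tvars A * f) = (if card A \<le> D then tvars A * hc (D - card A) f else 0)"
  using hc_mon_mult[of D "ind ((\<lambda>i. i - 1) ` A)" f]
  by (simp add: tvars_mon card_image inj_on_def)

text \<open>\<open>z - A\<close> must have odd size because 25 is odd. The degree left for the total
  square of \<open>y\<close> is (25 - |z - A|) / 2 - |A|, which simplifies to the quotient
  shown.\<close>

lemma Stot_sqz_25:
  "hc 25 (Stot tw (sqz z (mon y))) =
    (\<Sum>A | A \<subseteq> z \<and> odd (card (z - A)). sqz (z - A) (tvars A * hc ((25 - card z - card A) div 2) (Stot tw (mon y))))"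
proof -
  have c: "card (z - A) = card z - card A" "card A \<le> card z" if "A \<subseteq> z" for A
    using that by (simp_all add: card_Diff_subset card_mono)
  have "hc 25 (Stot tw (sqz z (mon y))) = (\<Sum>A\<in>Pow z. hc 25 (sqz (z - A) (tvars A * Stot tw (mon y))))"
    unfolding Stot_ind_dbl hc_sum by (simp add: tw_def)
  also have "\<dots> = (\<Sum>A | A \<subseteq> z \<and> odd (card (z - A)). sqz (z - A) (tvars A * hc ((25 - card z - card A) div 2) (Stot tw (mon y))))"
  proof (rule sum.mono_neutral_cong_right)
    show "\<forall>A\<in>Pow z - {A. A \<subseteq> z \<and> odd (card (z - A))}. hc 25 (sqz (z - A) (tvars A * Stot tw (mon y))) = 0"
      by (auto simp: hc_ind_dbl)
    fix A assume A: "A \<in> {A. A \<subseteq> z \<and> odd (card (z - A))}"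
    then have o: "odd (card (z - A))" and s: "A \<subseteq> z" by auto
    have le: "card (z - A) \<le> 5" "card z \<le> 5" using card_le_5 by blast+
    have k: "(25 - card (z - A)) div 2 - card A = (25 - card z - card A) div 2"
      using c[OF s] le by linarith
    have "card A \<le> (25 - card (z - A)) div 2" using c[OF s] le by linarith
    moreover have "even (25 - card (z - A))" using o le by simp
    ultimately show "hc 25 (sqz (z - A) (tvars A * Stot tw (mon y))) =
        sqz (z - A) (tvars A * hc ((25 - card z - card A) div 2) (Stot tw (mon y)))"
      using le by (simp add: hc_ind_dbl hc_tvars k)
  qed auto
  finally show ?thesis .
qed

text \<open>The \<chi>-trick for a single odd exponent applies: 1 + 12 = 13 is not a power of
  2.\<close>

lemma hit_one_odd: "card z = 1 \<Longrightarrow> sqz z (hc 12 f) \<in> htw tw 25"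
proof (induction f rule: mpol_induct)
  case (single m c)
  have "sqz z (mon m) \<in> htw tw 25" if "mono_deg m = 12"
  proof -
    obtain p where p: "z = {p}" using single card_1_singletonE by blast
    have "(2::nat) ^ k \<noteq> 13" for k
    proof (cases "k \<le> 3")
      case True
      then have "(2::nat) ^ k \<le> 2 ^ 3" by (intro power_increasing) auto
      then show ?thesis by simp
    next
      case False
      then have "(2::nat) ^ 4 \<le> 2 ^ k" by (intro power_increasing) auto
      then show ?thesis by simp
    qed
    then have "(\<Sum>i\<in>z. 2 ^ a i) \<noteq> card z + mono_deg m" for a :: "5 \<Rightarrow> nat"
      using p that by simp
    from hit_monomial[OF bij_tw this] show ?thesis using p that by simp
  qed
  then have "smul c (sqz z (hc 12 (mon m))) \<in> htw tw 25"
    by (intro htw_closed(4)) (simp add: sqz_linear htw_closed del: hc_single)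
  then have "sqz z (hc 12 (smul c (mon m))) \<in> htw tw 25"
    by (simp only: hc_smul sqz_linear)
  then show ?case by simp
qed (simp_all add: sqz_linear hc_add htw_closed)

text \<open>The same trick one level down, in the degree of the square part: 1 + 5 = 6 is not a
  power of 2.\<close>

lemma hit_one_odd_11: "mono_deg y = 11 \<Longrightarrow> card {i. odd (Poly_Mapping.lookup y i)} = 1 \<Longrightarrow> (mon y :: (5, K) mpol) \<in> htw tw 11"
proof -
  assume y: "mono_deg y = 11" "card {i. odd (Poly_Mapping.lookup y i)} = 1"
  obtain z v where zv: "y = ind z + (v + v)" using parity_decomp by blast
  then have "card z = 1" using y(2) by simp
  then obtain p where p: "z = {p}" using card_1_singletonE by blast
  have v: "mono_deg v = 5" using y(1) by (simp add: zv p)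
  have "(2::nat) ^ k \<noteq> 6" for k
  proof (cases "k \<le> 2")
    case True
    then have "(2::nat) ^ k \<le> 2 ^ 2" by (intro power_increasing) auto
    then show ?thesis by simp
  next
    case False
    then have "(2::nat) ^ 3 \<le> 2 ^ k" by (intro power_increasing) auto
    then show ?thesis by simp
  qed
  then have "(\<Sum>i\<in>z. 2 ^ a i) \<noteq> card z + mono_deg v" for a :: "5 \<Rightarrow> nat"
    using p v by simp
  from hit_monomial[OF bij_tw this] show ?thesis using p v by (simp add: sqz_mon zv)
qed

lemma htw_25_base: "card z + 2 * mono_deg y < 25 \<Longrightarrow> hc 25 (Stot tw (sqz z (mon y))) \<in> htw tw 25"
  unfolding sqz_mon by (rule htw_base) simp

lemma sqz_span:
  assumes "\<And>y. mono_deg y < k \<Longrightarrow> sqz z (hc k (Stot tw (mon y))) \<in> htw tw 25" "f \<in> htw tw k"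
  shows "sqz z f \<in> htw tw 25"
  unfolding htw_def[of tw 25]
  by (rule MP_additive_span[OF _ _ _ assms(2)[unfolded htw_def]])
    (use assms(1) in \<open>auto simp: sqz_linear htw_def\<close>)

lemma odd_subsets:
  assumes z: "card (z :: 5 set) = n"
  shows "n = 3 \<Longrightarrow> {A. A \<subseteq> z \<and> odd (card (z - A))} = insert {} {A. A \<subseteq> z \<and> card A = 2}"
    and "n = 4 \<Longrightarrow> {A. A \<subseteq> z \<and> odd (card (z - A))} = (\<lambda>i. {i}) ` z \<union> {A. A \<subseteq> z \<and> card A = 3}"
    and "n = 5 \<Longrightarrow> {A. A \<subseteq> z \<and> odd (card (z - A))} =
      insert {} ({A. A \<subseteq> z \<and> card A = 2} \<union> {A. A \<subseteq> z \<and> card A = 4})"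
proof -
  have c: "card (z - A) = n - card A" "card A \<le> n" "card A = 0 \<longleftrightarrow> A = {}" if "A \<subseteq> z" for A
    using that z card_mono[of z A] by (simp_all add: card_Diff_subset)
  have "odd (card (z - A)) \<longleftrightarrow> A = {} \<or> card A = 2" if "A \<subseteq> z" "n = 3" for A
  proof -
    have "odd (n - k) \<longleftrightarrow> k = 0 \<or> k = 2" if "k \<le> n" for k
      using that \<open>n = 3\<close> by presburger
    then show ?thesis using c[OF that(1)] by metis
  qed
  then show "{A. A \<subseteq> z \<and> odd (card (z - A))} = insert {} {A. A \<subseteq> z \<and> card A = 2}" if "n = 3"
    using that by auto
  have "odd (card (z - A)) \<longleftrightarrow> (\<exists>i. A = {i}) \<or> card A = 3" if "A \<subseteq> z" "n = 4" for A
  proof -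
    have "odd (n - k) \<longleftrightarrow> k = 1 \<or> k = 3" if "k \<le> n" for k
      using that \<open>n = 4\<close> by presburger
    then show ?thesis using c[OF that(1)] card_1_singleton_iff[of A] by (metis One_nat_def)
  qed
  then show "{A. A \<subseteq> z \<and> odd (card (z - A))} = (\<lambda>i. {i}) ` z \<union> {A. A \<subseteq> z \<and> card A = 3}" if "n = 4"
    using that by auto
  have "odd (card (z - A)) \<longleftrightarrow> A = {} \<or> card A = 2 \<or> card A = 4" if "A \<subseteq> z" "n = 5" for A
  proof -
    have "odd (n - k) \<longleftrightarrow> k = 0 \<or> k = 2 \<or> k = 4" if "k \<le> n" for k
      using that \<open>n = 5\<close> by presburger
    then show ?thesis using c[OF that(1)] by metis
  qed
  then show "{A. A \<subseteq> z \<and> odd (card (z - A))} =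
      insert {} ({A. A \<subseteq> z \<and> card A = 2} \<union> {A. A \<subseteq> z \<and> card A = 4})" if "n = 5"
    using that by auto
qed

lemma Stot_sqz_3:
  assumes z: "card z = 3"
  shows "hc 25 (Stot tw (sqz z (mon y))) = sqz z (hc 11 (Stot tw (mon y))) +
    (\<Sum>A | A \<subseteq> z \<and> card A = 2. sqz (z - A) (tvars A * hc 10 (Stot tw (mon y))))"
  unfolding Stot_sqz_25 odd_subsets(1)[OF z refl] by (subst sum.insert) (auto simp: z)

lemma Stot_sqz_4:
  assumes z: "card z = 4"
  shows "hc 25 (Stot tw (sqz z (mon y))) = (\<Sum>i\<in>z. sqz (z - {i}) (var (i - 1) * hc 10 (Stot tw (mon y)))) +
    (\<Sum>A | A \<subseteq> z \<and> card A = 3. sqz (z - A) (tvars A * hc 9 (Stot tw (mon y))))"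
  unfolding Stot_sqz_25 odd_subsets(2)[OF z refl]
  by (subst sum.union_disjoint) (auto simp: z sum.reindex)

lemma Stot_sqz_5:
  "hc 25 (Stot tw (sqz UNIV (mon y))) = sqz UNIV (hc 10 (Stot tw (mon y))) +
    (\<Sum>A | card A = 2. sqz (UNIV - A) (tvars A * hc 9 (Stot tw (mon y)))) +
    (\<Sum>A | card A = 4. sqz (UNIV - A) (tvars A * hc 8 (Stot tw (mon y))))"
proof -
  have "(\<Sum>A\<in>{A. A \<subseteq> UNIV \<and> card A = 2} \<union> {A. A \<subseteq> UNIV \<and> card A = 4}.
      sqz (UNIV - A) (tvars A * hc ((25 - card (UNIV :: 5 set) - card A) div 2) (Stot tw (mon y)))) =
    (\<Sum>A | card A = 2. sqz (UNIV - A) (tvars A * hc 9 (Stot tw (mon y)))) +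
    (\<Sum>A | card A = 4. sqz (UNIV - A) (tvars A * hc 8 (Stot tw (mon y))))"
    by (subst sum.union_disjoint) auto
  note * = this
  have S: "{A. A \<subseteq> (UNIV :: 5 set) \<and> odd (card (UNIV - A))} =
      insert {} ({A. A \<subseteq> UNIV \<and> card A = 2} \<union> {A. A \<subseteq> UNIV \<and> card A = 4})"
    by (rule odd_subsets(3)[of _ 5]) simp_all
  show ?thesis
    unfolding Stot_sqz_25 S by (subst sum.insert) (simp_all only: * add.assoc, simp_all)
qed

lemma sqz_tvars_hit:
  assumes "card (z - A) = 1" "card A + k = 12"
  shows "sqz (z - A) (tvars A * hc k f) \<in> htw tw 25"
proof -
  have "tvars A * hc k f = hc 12 (tvars A * f)"
  proof -
    have "12 - card A = k" "card A \<le> 12" using assms(2) by auto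
    then show ?thesis by (simp add: hc_tvars)
  qed
  then show ?thesis using hit_one_odd[OF assms(1)] by simp
qed

text \<open>In the expansion for three odd exponents the terms with |A| = 2 keep one odd exponent
  and are hit. So a hit polynomial of degree 11 stays hit after being placed in the square
  part.\<close>

lemma hit_three_odd:
  assumes z: "card z = 3" and f: "f \<in> htw tw 11"
  shows "sqz z f \<in> htw tw 25"
proof (rule sqz_span[OF _ f])
  fix y :: "5 \<Rightarrow>\<^sub>0 nat" assume y: "mono_deg y < 11"
  have "(\<Sum>A | A \<subseteq> z \<and> card A = 2. sqz (z - A) (tvars A * hc 10 (Stot tw (mon y)))) \<in> htw tw 25"
    using z by (intro htw_closed(5) sqz_tvars_hit) (auto simp: card_Diff_subset)
  moreover have "hc 25 (Stot tw (sqz z (mon y))) \<in> htw tw 25"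
    using z y by (intro htw_25_base) simp
  ultimately show "sqz z (hc 11 (Stot tw (mon y))) \<in> htw tw 25"
    using htw_closed(3) unfolding Stot_sqz_3[OF z] by fastforce
qed

text \<open>The counterpart of \<open>tops\<close> at the lowest degree, used to see that the
  twisted Sq^0 is the identity.\<close>

definition bots :: "nat \<Rightarrow> ('n::finite, 'a::field) mpol \<Rightarrow> ('n, 'a) mpol \<Rightarrow> bool"
  where "bots D p t \<longleftrightarrow> p \<in> dge D \<and> t \<in> dge D \<and> p - t \<in> dge (Suc D)"

lemma bots_mult: "bots D p t \<Longrightarrow> bots E q s \<Longrightarrow> bots (D + E) (p * q) (t * s)"
proof -
  assume a: "bots D p t" "bots E q s"
  have e: "p * q - t * s = (p - t) * q + t * (q - s)" by (simp add: algebra_simps)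
  have "(p - t) * q \<in> dge (Suc D + E)" "t * (q - s) \<in> dge (D + Suc E)"
    using a unfolding bots_def by (blast intro: dge_mult)+
  then have "p * q - t * s \<in> dge (Suc (D + E))" unfolding e by (simp add: dge_closed)
  then show ?thesis using a by (auto simp: bots_def intro!: dge_mult)
qed

lemma hc_Stot_self: "hc (mono_deg m) (Stot \<sigma> (mon m)) = (mon m :: ('n::finite, 'a::field) mpol)"
proof -
  have one: "bots 0 1 (1 :: ('n, 'a) mpol)" by (simp add: bots_def dge_closed)
  have pow: "bots (k * D) (p ^ k) (t ^ k)" if "bots D p t" for D k and p t :: "('n, 'a) mpol"
    by (induction k) (simp_all add: one bots_mult that)
  have prod: "bots (\<Sum>x\<in>A. e x) (\<Prod>x\<in>A. p x) (\<Prod>x\<in>A. t x)" if "\<And>x. bots (e x) (p x) (t x)"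
    for e and p t :: "'n \<Rightarrow> ('n, 'a) mpol" and A
    by (induction A rule: infinite_finite_induct) (simp_all add: one bots_mult that)
  have "bots 1 (var i + var (\<sigma> i) ^ 2) (var i :: ('n, 'a) mpol)" for i
  proof -
    have v: "(var j ^ k :: ('n, 'a) mpol) \<in> dge k" for j k by (rule dge_var_power)
    show ?thesis
      using v[of i 1] v[of "\<sigma> i" 2] dge_mono[OF v[of "\<sigma> i" 2], of 1]
      by (simp add: bots_def dge_closed numeral_2_eq_2 del: power_Suc)
  qed
  then have "bots (\<Sum>i\<in>UNIV. Poly_Mapping.lookup m i * 1) (Stot \<sigma> (mon m)) (\<Prod>i\<in>UNIV. (var i :: ('n, 'a) mpol) ^ Poly_Mapping.lookup m i)"
    unfolding Stot_def subst_mon by (intro prod pow)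
  then have "bots (mono_deg m) (Stot \<sigma> (mon m)) (mon m :: ('n, 'a) mpol)"
    by (simp add: mono_deg_def flip: mon_eq_prod)
  then have "hc (mono_deg m) (Stot \<sigma> (mon m) - mon m :: ('n, 'a) mpol) = 0"
    by (intro hc_dge[of _ "Suc (mono_deg m)"]) (simp_all add: bots_def)
  then show ?thesis by (simp add: hc_diff)
qed

text \<open>The source has degree 4 + 2 * 10 = 24, so this is the twisted Sq^1, which differentiates
  the squarefree factor. The terms with |A| = 3 would involve degree 9 of the total square of
  \<open>mon g\<close>, which is zero.\<close>

lemma hit_four_odd:
  assumes z: "card z = 4" and g: "mono_deg g = 10"
  shows "(\<Sum>i\<in>z. sqz (z - {i}) (var (i - 1) * mon g)) \<in> htw tw 25"
proof -
  have "hc 9 (Stot tw (mon g)) = (0 :: (5, K) mpol)"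
    using hc_dge[OF Stot_dge, of 9 g] g by simp
  moreover have "hc 10 (Stot tw (mon g)) = (mon g :: (5, K) mpol)"
    using hc_Stot_self[of g tw] g by simp
  moreover have "hc 25 (Stot tw (sqz z (mon g))) \<in> htw tw 25"
    using z g by (intro htw_25_base) simp
  ultimately show ?thesis unfolding Stot_sqz_4[OF z] by (simp add: sqz_linear)
qed

text \<open>The terms with |A| = 4 keep one odd exponent and are dropped as hit. Those with |A| = 2
  link the full set to the three-element sets.\<close>

lemma hit_five_odd:
  assumes y: "mono_deg y < 10"
  shows "sqz UNIV (hc 10 (Stot tw (mon y))) +
    (\<Sum>A | card A = 2. sqz (UNIV - A) (tvars A * hc 9 (Stot tw (mon y)))) \<in> htw tw 25"
proof -
  have "(\<Sum>A | card A = 4. sqz (UNIV - A) (tvars A * hc 8 (Stot tw (mon y)))) \<in> htw tw 25"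
    by (intro htw_closed(5) sqz_tvars_hit) (auto simp: card_Diff_subset)
  moreover have "hc 25 (Stot tw (sqz UNIV (mon y))) \<in> htw tw 25"
    using y by (intro htw_25_base) simp
  ultimately show ?thesis
    using htw_closed(3) unfolding Stot_sqz_5 by fastforce
qed

text \<open>Up to monomials with fewer than three odd exponents, where \<open>\<phi>\<close> is
  zero, each generator of the hit space in degree 25 is one of the three kinds of relations above or
  a sum of them. Hence the conditions on \<open>\<phi>\<close> form a finite check.\<close>

lemma functional_vanishes:
  fixes \<phi> :: "(5 \<Rightarrow>\<^sub>0 nat) \<Rightarrow> K"
  assumes few: "\<And>m. card {i. odd (Poly_Mapping.lookup m i)} < 3 \<Longrightarrow> \<phi> m = 0"
    and three: "\<And>z y. card z = 3 \<Longrightarrow> mono_deg y < 11 \<Longrightarrow> fext \<phi> (sqz z (hc 11 (Stot tw (mon y)))) = 0"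
    and four: "\<And>z g. card z = 4 \<Longrightarrow> mono_deg g = 10 \<Longrightarrow> (\<Sum>i\<in>z. fext \<phi> (sqz (z - {i}) (var (i - 1) * mon g))) = 0"
    and five: "\<And>y. mono_deg y < 10 \<Longrightarrow> fext \<phi> (sqz UNIV (hc 10 (Stot tw (mon y)))) +
      (\<Sum>A | card A = 2. fext \<phi> (sqz (UNIV - A) (tvars A * hc 9 (Stot tw (mon y))))) = 0"
    and x: "x \<in> htw tw 25"
  shows "fext \<phi> x = 0"
proof (rule fext_span[OF _ x[unfolded htw_def]])
  have few': "fext \<phi> (sqz z f) = 0" if "card z < 3" for z f
  proof (induction f rule: mpol_induct)
    case (single m c)
    have "sqz z (Poly_Mapping.single m c) = smul c (mon (ind z + (m + m)))"
      using sqz_linear(2)[of z c "mon m"] by (simp add: sqz_mon)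
    then show ?case using few[of "ind z + (m + m)"] that by simp
  qed (simp_all add: sqz_linear fext_add)
  have four': "(\<Sum>i\<in>z. fext \<phi> (sqz (z - {i}) (var (i - 1) * hc 10 f))) = 0" if "card z = 4" for z f
  proof (induction f rule: mpol_induct)
    case (single m c)
    have "(\<Sum>i\<in>z. fext \<phi> (sqz (z - {i}) (var (i - 1) * hc 10 (smul c (mon m))))) =
      c * (\<Sum>i\<in>z. fext \<phi> (sqz (z - {i}) (var (i - 1) * hc 10 (mon m))))"
      by (simp add: hc_smul smul_mult_right sqz_linear fext_smul sum_distrib_left del: smul_single hc_mon)
    then show ?case using four[OF that, of m] by (simp add: sqz_linear)
  qed (simp_all add: sqz_linear hc_add distrib_left fext_add sum.distrib)
  fix x :: "(5, K) mpol"
  assume "x \<in> {hc 25 (Stot tw (mon m)) |m. mono_deg m < 25}"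
  then obtain m where m: "x = hc 25 (Stot tw (mon m))" "mono_deg m < 25" by blast
  obtain z y where zy: "m = ind z + (y + y)" using parity_decomp by blast
  have x: "x = hc 25 (Stot tw (sqz z (mon y)))" by (simp add: m(1) zy sqz_mon)
  have deg: "card z + 2 * mono_deg y < 25" using m(2) by (simp add: zy)
  have le: "card (z - A) \<le> card z" for A by (rule card_mono) auto
  consider "card z < 3" | "card z = 3" | "card z = 4" | "card z = 5"
    using card_le_5[of z] by linarith
  then show "fext \<phi> x = 0"
  proof cases
    case 1
    have "fext \<phi> (sqz (z - A) f) = 0" for A f
      using few' le[of A] 1 by simp
    then show ?thesis by (simp add: x Stot_sqz_25 fext_sum)
  next
    case 2
    have "fext \<phi> (sqz (z - A) f) = 0" if "A \<subseteq> z" "card A = 2" for A f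
      using few'[of "z - A"] that 2 by (simp add: card_Diff_subset)
    then show ?thesis using three[OF 2, of y] deg 2 by (simp add: x Stot_sqz_3[OF 2] fext_add fext_sum)
  next
    case 3
    have "fext \<phi> (sqz (z - A) f) = 0" if "A \<subseteq> z" "card A = 3" for A f
      using few'[of "z - A"] that 3 by (simp add: card_Diff_subset)
    then show ?thesis using four'[OF 3] by (simp add: x Stot_sqz_4[OF 3] fext_add fext_sum)
  next
    case 4
    then have z: "z = UNIV" by (intro card_subset_eq) auto
    have "fext \<phi> (sqz (UNIV - A) f) = 0" if "card A = 4" for A f
      using few'[of "UNIV - A"] that by (simp add: card_Diff_subset)
    then show ?thesis using five[of y] deg 4 by (simp add: x z Stot_sqz_5 fext_add fext_sum)
  qed
qed

section \<open>Executable encoding\<close>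

text \<open>Evaluation is by rewriting alone, with naturals in unary notation.\<close>

abbreviation (input) "N3 \<equiv> Suc (Suc (Suc 0))"
abbreviation (input) "N4 \<equiv> Suc N3"
abbreviation (input) "N5 \<equiv> Suc N4"
abbreviation (input) "N6 \<equiv> Suc N5"
abbreviation (input) "N7 \<equiv> Suc N6"
abbreviation (input) "N8 \<equiv> Suc N7"
abbreviation (input) "N9 \<equiv> Suc N8"
abbreviation (input) "N10 \<equiv> Suc N9"
abbreviation (input) "N11 \<equiv> Suc N10"
abbreviation (input) "N12 \<equiv> Suc N11"
abbreviation (input) "N13 \<equiv> Suc N12"
abbreviation (input) "N14 \<equiv> Suc N13"
abbreviation (input) "N15 \<equiv> Suc N14"
abbreviation (input) "N16 \<equiv> Suc N15"
abbreviation (input) "N18 \<equiv> Suc (Suc N16)"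
abbreviation (input) "N19 \<equiv> Suc N18"
abbreviation (input) "N20 \<equiv> Suc N19"
abbreviation (input) "N21 \<equiv> Suc N20"
abbreviation (input) "N22 \<equiv> Suc N21"
abbreviation (input) "N25 \<equiv> Suc (Suc (Suc N22))"
abbreviation (input) "N26 \<equiv> Suc N25"
abbreviation (input) "N28 \<equiv> Suc (Suc N26)"
abbreviation (input) "N31 \<equiv> Suc (Suc (Suc N28))"
abbreviation (input) "N32 \<equiv> Suc N31"
abbreviation (input) "N40 \<equiv> Suc (Suc (Suc (Suc (Suc (Suc (Suc (Suc N32)))))))"

text \<open>One type of digits serves as four bits, as an exponent, as the label of a set of odd
  exponents and as the index of a variable; every table is then a list of digits.\<close>

datatype hx = H0 | H1 | H2 | H3 | H4 | H5 | H6 | H7 | H8 | H9 | HA | HB | HC | HD | HE | HF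

type_synonym tup = "nat \<times> nat \<times> nat \<times> nat \<times> nat"

primrec hex_nat :: "hx \<Rightarrow> nat" where
  "hex_nat H0 = 0" |
  "hex_nat H1 = (Suc 0)" |
  "hex_nat H2 = (Suc (Suc 0))" |
  "hex_nat H3 = N3" |
  "hex_nat H4 = N4" |
  "hex_nat H5 = N5" |
  "hex_nat H6 = N6" |
  "hex_nat H7 = N7" |
  "hex_nat H8 = N8" |
  "hex_nat H9 = N9" |
  "hex_nat HA = N10" |
  "hex_nat HB = N11" |
  "hex_nat HC = N12" |
  "hex_nat HD = N13" |
  "hex_nat HE = N14" |
  "hex_nat HF = N15"

primrec hbits :: "hx \<Rightarrow> bool list" where
  "hbits H0 = [False, False, False, False]" |
  "hbits H1 = [True, False, False, False]" |
  "hbits H2 = [False, True, False, False]" |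
  "hbits H3 = [True, True, False, False]" |
  "hbits H4 = [False, False, True, False]" |
  "hbits H5 = [True, False, True, False]" |
  "hbits H6 = [False, True, True, False]" |
  "hbits H7 = [True, True, True, False]" |
  "hbits H8 = [False, False, False, True]" |
  "hbits H9 = [True, False, False, True]" |
  "hbits HA = [False, True, False, True]" |
  "hbits HB = [True, True, False, True]" |
  "hbits HC = [False, False, True, True]" |
  "hbits HD = [True, False, True, True]" |
  "hbits HE = [False, True, True, True]" |
  "hbits HF = [True, True, True, True]"

primrec xor_hex :: "hx \<Rightarrow> hx \<Rightarrow> hx" where
  "xor_hex H0 = case_hx H0 H1 H2 H3 H4 H5 H6 H7 H8 H9 HA HB HC HD HE HF" |
  "xor_hex H1 = case_hx H1 H0 H3 H2 H5 H4 H7 H6 H9 H8 HB HA HD HC HF HE" |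
  "xor_hex H2 = case_hx H2 H3 H0 H1 H6 H7 H4 H5 HA HB H8 H9 HE HF HC HD" |
  "xor_hex H3 = case_hx H3 H2 H1 H0 H7 H6 H5 H4 HB HA H9 H8 HF HE HD HC" |
  "xor_hex H4 = case_hx H4 H5 H6 H7 H0 H1 H2 H3 HC HD HE HF H8 H9 HA HB" |
  "xor_hex H5 = case_hx H5 H4 H7 H6 H1 H0 H3 H2 HD HC HF HE H9 H8 HB HA" |
  "xor_hex H6 = case_hx H6 H7 H4 H5 H2 H3 H0 H1 HE HF HC HD HA HB H8 H9" |
  "xor_hex H7 = case_hx H7 H6 H5 H4 H3 H2 H1 H0 HF HE HD HC HB HA H9 H8" |
  "xor_hex H8 = case_hx H8 H9 HA HB HC HD HE HF H0 H1 H2 H3 H4 H5 H6 H7" |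
  "xor_hex H9 = case_hx H9 H8 HB HA HD HC HF HE H1 H0 H3 H2 H5 H4 H7 H6" |
  "xor_hex HA = case_hx HA HB H8 H9 HE HF HC HD H2 H3 H0 H1 H6 H7 H4 H5" |
  "xor_hex HB = case_hx HB HA H9 H8 HF HE HD HC H3 H2 H1 H0 H7 H6 H5 H4" |
  "xor_hex HC = case_hx HC HD HE HF H8 H9 HA HB H4 H5 H6 H7 H0 H1 H2 H3" |
  "xor_hex HD = case_hx HD HC HF HE H9 H8 HB HA H5 H4 H7 H6 H1 H0 H3 H2" |
  "xor_hex HE = case_hx HE HF HC HD HA HB H8 H9 H6 H7 H4 H5 H2 H3 H0 H1" |
  "xor_hex HF = case_hx HF HE HD HC HB HA H9 H8 H7 H6 H5 H4 H3 H2 H1 H0"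

fun xor_vec :: "hx list \<Rightarrow> hx list \<Rightarrow> hx list" where
  "xor_vec [] ys = ys" | "xor_vec (x # xs) [] = x # xs" | "xor_vec (x # xs) (y # ys) = xor_hex x y # xor_vec xs ys"

fun xor_pair :: "hx \<times> hx \<Rightarrow> hx \<times> hx \<Rightarrow> hx \<times> hx" where
  "xor_pair (a, b) (c, d) = (xor_hex a c, xor_hex b d)"

fun two :: "hx list \<Rightarrow> hx \<times> hx" where
  "two [] = (H0, H0)" | "two [a] = (a, H0)" | "two (a # b # l) = (a, b)"

fun drop_two :: "hx list \<Rightarrow> hx list" where
  "drop_two (a # b # l) = l" | "drop_two l = []"

text \<open>Extracts the two digits belonging to one three-element set from a packed vector. Stored
  vectors end with their last nonzero digit, so missing digits count as zero.\<close>

primrec sl :: "hx \<Rightarrow> hx list \<Rightarrow> hx \<times> hx" where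
  "sl H0 l = two l" |
  "sl H1 l = two (drop_two l)" |
  "sl H2 l = two (drop_two (drop_two l))" |
  "sl H3 l = two (drop_two (drop_two (drop_two l)))" |
  "sl H4 l = two (drop_two (drop_two (drop_two (drop_two l))))" |
  "sl H5 l = two (drop_two (drop_two (drop_two (drop_two (drop_two l)))))" |
  "sl H6 l = two (drop_two (drop_two (drop_two (drop_two (drop_two (drop_two l))))))" |
  "sl H7 l = two (drop_two (drop_two (drop_two (drop_two (drop_two (drop_two (drop_two l)))))))" |
  "sl H8 l = two (drop_two (drop_two (drop_two (drop_two (drop_two (drop_two (drop_two (drop_two l))))))))" |
  "sl H9 l = two (drop_two (drop_two (drop_two (drop_two (drop_two (drop_two (drop_two (drop_two (drop_two l)))))))))" |
  "sl HA l = (H0, H0)" |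
  "sl HB l = (H0, H0)" |
  "sl HC l = (H0, H0)" |
  "sl HD l = (H0, H0)" |
  "sl HE l = (H0, H0)" |
  "sl HF l = (H0, H0)"

lemma xor_hex_0 [simp]: "xor_hex H0 a = a" "xor_hex a H0 = a"
  by (cases a; simp)+

lemma case_hx_id [simp]: "case_hx H0 H1 H2 H3 H4 H5 H6 H7 H8 H9 HA HB HC HD HE HF a = a"
  by (cases a) simp_all

lemma two_xor_vec: "two (xor_vec a b) = xor_pair (two a) (two b)"
  by (cases a rule: two.cases; cases b rule: two.cases; simp)

lemma drop_two_xor_vec: "drop_two (xor_vec a b) = xor_vec (drop_two a) (drop_two b)"
proof -
  have "xor_vec a [] = a" for a by (cases a) auto
  then show ?thesis by (cases a rule: drop_two.cases; cases b rule: drop_two.cases; simp)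
qed

lemma sl_xor_vec: "sl z (xor_vec a b) = xor_pair (sl z a) (sl z b)"
  by (cases z) (simp_all add: two_xor_vec drop_two_xor_vec)

fun zero_vec :: "hx list \<Rightarrow> bool" where
  "zero_vec [] = True" | "zero_vec (H0 # l) = zero_vec l" | "zero_vec l = False"

lemma zero_vec_sl: "zero_vec l \<Longrightarrow> sl z l = (H0, H0)"
proof -
  have zero_vec_iff: "zero_vec l \<longleftrightarrow> (\<forall>x\<in>set l. x = H0)" for l
    by (induction l rule: zero_vec.induct) auto
  have d: "zero_vec (drop_two l)" if "zero_vec l" for l using that by (cases l rule: drop_two.cases) (auto simp: zero_vec_iff)
  have t: "two l = (H0, H0)" if "zero_vec l" for l using that by (cases l rule: two.cases) (auto simp: zero_vec_iff)
  show "zero_vec l \<Longrightarrow> sl z l = (H0, H0)" by (cases z) (simp_all add: t d)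
qed

text \<open>Moves one packed bit into \<open>K\<close>, where exclusive or becomes addition because
  the characteristic is 2.\<close>

definition hex_comp :: "nat \<Rightarrow> hx \<times> hx \<Rightarrow> K"
  where "hex_comp r d = of_bool ((hbits (fst d) @ hbits (snd d)) ! r)"

lemma hbits_xor_hex: "hbits (xor_hex a b) = map2 (\<noteq>) (hbits a) (hbits b)"
  by (cases a; cases b; simp)

lemma length_hbits [simp]: "length (hbits a) = 4"
  by (cases a) auto

lemma hex_comp_xor_pair: "r < 8 \<Longrightarrow> hex_comp r (xor_pair d e) = hex_comp r d + hex_comp r e"
proof -
  assume r: "r < 8"
  have *: "of_bool (p \<noteq> q) = (of_bool p + of_bool q :: K)" for p q by auto
  show ?thesis using r
    by (cases d; cases e) (auto simp: hex_comp_def nth_append hbits_xor_hex *)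
qed

lemma hex_comp_0 [simp]: "r < 8 \<Longrightarrow> hex_comp r (H0, H0) = 0"
proof -
  assume "r < 8"
  then have "r = 0 \<or> r = 1 \<or> r = 2 \<or> r = 3 \<or> r = 4 \<or> r = 5 \<or> r = 6 \<or> r = 7" by auto
  then show ?thesis by (elim disjE) (simp_all add: hex_comp_def)
qed

text \<open>The digits \<open>H0\<close> to \<open>H9\<close> encode the three-element subsets of the variables, \<open>HA\<close> the full set.\<close>

primrec zs :: "hx \<Rightarrow> 5 set" where
  "zs H0 = {0, 1, 2}" |
  "zs H1 = {0, 1, 3}" |
  "zs H2 = {0, 1, 4}" |
  "zs H3 = {0, 2, 3}" |
  "zs H4 = {0, 2, 4}" |
  "zs H5 = {0, 3, 4}" |
  "zs H6 = {1, 2, 3}" |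
  "zs H7 = {1, 2, 4}" |
  "zs H8 = {1, 3, 4}" |
  "zs H9 = {2, 3, 4}" |
  "zs HA = UNIV" |
  "zs HB = {}" |
  "zs HC = {}" |
  "zs HD = {}" |
  "zs HE = {}" |
  "zs HF = {}"

primrec is3 :: "hx \<Rightarrow> bool" where
  "is3 H0 = True" |
  "is3 H1 = True" |
  "is3 H2 = True" |
  "is3 H3 = True" |
  "is3 H4 = True" |
  "is3 H5 = True" |
  "is3 H6 = True" |
  "is3 H7 = True" |
  "is3 H8 = True" |
  "is3 H9 = True" |
  "is3 HA = False" |
  "is3 HB = False" |
  "is3 HC = False" |
  "is3 HD = False" |
  "is3 HE = False" |
  "is3 HF = False"

primrec rot_set :: "hx \<Rightarrow> hx" where
  "rot_set H0 = H6" |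
  "rot_set H1 = H7" |
  "rot_set H2 = H0" |
  "rot_set H3 = H8" |
  "rot_set H4 = H1" |
  "rot_set H5 = H2" |
  "rot_set H6 = H9" |
  "rot_set H7 = H3" |
  "rot_set H8 = H4" |
  "rot_set H9 = H5" |
  "rot_set HA = HA" |
  "rot_set HB = HB" |
  "rot_set HC = HC" |
  "rot_set HD = HD" |
  "rot_set HE = HE" |
  "rot_set HF = HF"

primrec pos :: "hx \<Rightarrow> 5" where
  "pos H0 = 0" |
  "pos H1 = 1" |
  "pos H2 = 2" |
  "pos H3 = 3" |
  "pos H4 = 4" |
  "pos H5 = 0" |
  "pos H6 = 0" |
  "pos H7 = 0" |
  "pos H8 = 0" |
  "pos H9 = 0" |
  "pos HA = 0" |
  "pos HB = 0" |
  "pos HC = 0" |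
  "pos HD = 0" |
  "pos HE = 0" |
  "pos HF = 0"

fun inc :: "hx \<Rightarrow> tup \<Rightarrow> tup" where
  "inc H0 (a, b, c, d, e) = (Suc a, b, c, d, e)"
| "inc H1 (a, b, c, d, e) = (a, Suc b, c, d, e)"
| "inc H2 (a, b, c, d, e) = (a, b, Suc c, d, e)"
| "inc H3 (a, b, c, d, e) = (a, b, c, Suc d, e)"
| "inc H4 (a, b, c, d, e) = (a, b, c, d, Suc e)"
| "inc z t = t"

fun rot_tup :: "tup \<Rightarrow> tup" where "rot_tup (a, b, c, d, e) = (e, a, b, c, d)"

fun ad :: "nat \<Rightarrow> nat \<Rightarrow> nat" where "ad a 0 = a" | "ad a (Suc b) = Suc (ad a b)"

fun sub_opt :: "nat \<Rightarrow> nat \<Rightarrow> nat option" where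
  "sub_opt a 0 = Some a" | "sub_opt 0 (Suc b) = None" | "sub_opt (Suc a) (Suc b) = sub_opt a b"

fun tup_deg :: "tup \<Rightarrow> nat" where "tup_deg (a, b, c, d, e) = ad (ad (ad (ad a b) c) d) e"

lemma ad_eq [simp]: "ad a b = a + b"
  by (induction a b rule: ad.induct) auto

lemma sub_opt_eq: "sub_opt a b = (if b \<le> a then Some (a - b) else None)"
  by (induction a b rule: sub_opt.induct) auto

definition ym :: "tup \<Rightarrow> 5 \<Rightarrow>\<^sub>0 nat"
  where "ym = (\<lambda>(a, b, c, d, e). Poly_Mapping.single 0 a + Poly_Mapping.single 1 b + Poly_Mapping.single 2 c +
    Poly_Mapping.single 3 d + Poly_Mapping.single 4 e)"

definition tup :: "(5 \<Rightarrow>\<^sub>0 nat) \<Rightarrow> tup"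
  where "tup m = (Poly_Mapping.lookup m 0, Poly_Mapping.lookup m 1, Poly_Mapping.lookup m 2,
    Poly_Mapping.lookup m 3, Poly_Mapping.lookup m 4)"

lemma lookup_ym: "Poly_Mapping.lookup (ym (a, b, c, d, e)) 0 = a" "Poly_Mapping.lookup (ym (a, b, c, d, e)) 1 = b"
  "Poly_Mapping.lookup (ym (a, b, c, d, e)) 2 = c" "Poly_Mapping.lookup (ym (a, b, c, d, e)) 3 = d"
  "Poly_Mapping.lookup (ym (a, b, c, d, e)) 4 = e"
  by (simp_all add: ym_def lookup_add lookup_single)

lemma tup_ym [simp]: "tup (ym t) = t"
  by (cases t) (simp add: tup_def lookup_ym)

lemma ym_tup [simp]: "ym (tup m) = m"
proof (rule poly_mapping_eqI)
  fix i show "Poly_Mapping.lookup (ym (tup m)) i = Poly_Mapping.lookup m i"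
    using exhaust_5[of i] by (auto simp: tup_def lookup_ym)
qed

lemma mono_deg_ym [simp]: "mono_deg (ym t) = tup_deg t"
  by (cases t) (simp add: mono_deg_def sum_5 lookup_ym)

lemma ym_inc:
  assumes "k \<in> {H0, H1, H2, H3, H4}"
  shows "ym (inc k t) = Poly_Mapping.single (pos k) 1 + ym t"
proof (rule poly_mapping_eqI)
  fix i
  show "Poly_Mapping.lookup (ym (inc k t)) i = Poly_Mapping.lookup (Poly_Mapping.single (pos k) 1 + ym t) i"
    using exhaust_5[of i] assms by (cases t) (auto simp: lookup_ym lookup_add lookup_single)
qed

lemma mon_ym_inc: "k \<in> {H0, H1, H2, H3, H4} \<Longrightarrow> mon (ym (inc k t)) = (var (pos k) * mon (ym t) :: (5, K) mpol)"
  by (simp only: ym_inc) (simp add: var_def mult_single)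

lemma tup_deg_inc: "k \<in> {H0, H1, H2, H3, H4} \<Longrightarrow> tup_deg (inc k t) = Suc (tup_deg t)"
  by (cases t) auto

lemma minus_1_5: "(-1 :: 5) = 4" "(0 :: 5) - 1 = 4" "(1 :: 5) - 1 = 0" "(2 :: 5) - 1 = 1" "(3 :: 5) - 1 = 2" "(4 :: 5) - 1 = 3"
  by simp_all

section \<open>Executable squares\<close>

text \<open>The terms of (u + v^2)^n in characteristic 2, as triples of the rise in degree, the
  exponent of u and the exponent of v.\<close>

definition subs :: "nat \<Rightarrow> (nat \<times> nat \<times> nat) list"
  where "subs n = map (\<lambda>b. (b, n - b, 2 * b)) (filter (\<lambda>b. odd (n choose b)) [0..<Suc n])"

text \<open>The chosen terms arrive in reverse order. Variable i collects p from its own factor and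
  q from the factor of variable i + 1, whose square term lies in variable i.\<close>

fun fin :: "(nat \<times> nat) list \<Rightarrow> tup" where
  "fin [(p4, q4), (p3, q3), (p2, q2), (p1, q1), (p0, q0)] = (ad p0 q1, ad p1 q2, ad p2 q3, ad p3 q4, ad p4 q0)"
| "fin l = (0, 0, 0, 0, 0)"

text \<open>Depth-first choice of one term per variable with total rise \<open>a\<close>, where
  \<open>sub_opt\<close> prunes choices that rise too far. The split into three functions turns each
  case distinction into a pattern match, so that plain rewriting can run it.\<close>

function (sequential) go and goL and goM where
  "go 0 acc [] = [fin acc]" | "go (Suc a) acc [] = []" | "go a acc (ys # yss) = goL a acc ys yss"
| "goL a acc [] yss = []" | "goL a acc ((b, p, q) # ys) yss = goM (sub_opt a b) acc p q yss @ goL a acc ys yss"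
| "goM None acc p q yss = []" | "goM (Some a) acc p q yss = go a ((p, q) # acc) yss"
  by pat_completeness auto
termination
  by (relation "measure (\<lambda>x. case x of Inl (a, acc, yss) \<Rightarrow> 2 * length (concat yss) + 3 * length yss
      | Inr (Inl (a, acc, ys, yss)) \<Rightarrow> 2 * length ys + 2 * length (concat yss) + 3 * length yss + 2
      | Inr (Inr (a, acc, p, q, yss)) \<Rightarrow> 2 * length (concat yss) + 3 * length yss + 1)") auto

fun sq_tups :: "nat \<Rightarrow> tup \<Rightarrow> tup list" where
  "sq_tups a (y0, y1, y2, y3, y4) = go a [] [subs y0, subs y1, subs y2, subs y3, subs y4]"

lemma go_eq:
  "go a acc yss = map (\<lambda>ch. fin (rev (map snd ch) @ acc)) (filter (\<lambda>ch. sum_list (map fst ch) = a) (product_lists yss))"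
  "goL a acc ys yss = map (\<lambda>ch. fin (rev (map snd ch) @ acc)) (filter (\<lambda>ch. sum_list (map fst ch) = a) (product_lists (ys # yss)))"
  "goM m acc p q yss = (case m of None \<Rightarrow> [] | Some a \<Rightarrow>
     map (\<lambda>ch. fin (rev (map snd ch) @ (p, q) # acc)) (filter (\<lambda>ch. sum_list (map fst ch) = a) (product_lists yss)))"
proof (induction a acc yss and a acc ys yss and m acc p q yss rule: go_goL_goM.induct)
  case (5 a acc b p q ys yss)
  have "filter (\<lambda>ch. sum_list (map fst ch) = a) (map ((#) (b, p, q)) (product_lists yss)) =
     map ((#) (b, p, q)) (filter (\<lambda>ch. b + sum_list (map fst ch) = a) (product_lists yss))"
    by (simp add: filter_map o_def)
  moreover have "filter (\<lambda>ch. b + sum_list (map fst ch) = a) (product_lists yss) =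
      (if b \<le> a then filter (\<lambda>ch. sum_list (map fst ch) = a - b) (product_lists yss) else [])"
    by (auto intro!: filter_cong)
  ultimately show ?case using 5 by (auto simp: sub_opt_eq o_def)
qed auto

lemma sum_list_product_lists_5:
  "(\<Sum>ch\<leftarrow>product_lists [A, B, C, D, E]. f ch) =
    (\<Sum>a\<leftarrow>A. \<Sum>b\<leftarrow>B. \<Sum>c\<leftarrow>C. \<Sum>d\<leftarrow>D. \<Sum>e\<leftarrow>E. (f [a, b, c, d, e] :: 'a::comm_monoid_add))"
proof -
  have c: "sum_list (concat xss) = (\<Sum>xs\<leftarrow>xss. sum_list xs)" for xss :: "'a list list"
    by (induction xss) auto
  show ?thesis by (simp add: map_concat c o_def)
qed

lemma Kpoly_of_nat: "(of_nat n :: (5, K) mpol) = of_bool (odd n)"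
proof (induction n)
  case (Suc n)
  then show ?case by (cases "even n") simp_all
qed simp

lemma subs_binomial:
  "(u + v ^ 2) ^ n = (\<Sum>(b, p, q)\<leftarrow>subs n. u ^ p * (v :: (5, K) mpol) ^ q)"
proof -
  have "(v ^ 2 + u) ^ n = (\<Sum>k\<le>n. of_nat (n choose k) * (v ^ 2) ^ k * u ^ (n - k))"
    by (rule binomial_ring)
  also have "\<dots> = (\<Sum>k\<in>{0..<Suc n}. if odd (n choose k) then u ^ (n - k) * v ^ (2 * k) else 0)"
    by (intro sum.cong) (auto simp: Kpoly_of_nat power_mult)
  also have "\<dots> = (\<Sum>k\<leftarrow>[0..<Suc n]. if odd (n choose k) then u ^ (n - k) * v ^ (2 * k) else 0)"
    by (simp add: interv_sum_list_conv_sum_set_nat del: upt_Suc)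
  also have "\<dots> = (\<Sum>k\<leftarrow>filter (\<lambda>b. odd (n choose b)) [0..<Suc n]. u ^ (n - k) * v ^ (2 * k))"
    by (simp add: sum_list_map_filter' del: upt_Suc)
  also have "\<dots> = (\<Sum>(b, p, q)\<leftarrow>subs n. u ^ p * v ^ q)"
    by (simp add: subs_def o_def del: upt_Suc)
  finally show ?thesis by (simp add: add.commute)
qed

lemma subs_deg: "(b, p, q) \<in> set (subs n) \<Longrightarrow> p + q = n + b"
  by (auto simp: subs_def le_Suc_eq)

lemma hc_sum_list: "hc d (sum_list l) = (\<Sum>f\<leftarrow>l. hc d f)"
  by (induction l) (simp_all add: hc_add)

lemma sum_list_mult_5:
  fixes f0 f1 f2 f3 f4 :: "'b \<Rightarrow> 'a::comm_semiring_1"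
  shows "(\<Sum>a\<leftarrow>A. f0 a) * (\<Sum>a\<leftarrow>B. f1 a) * (\<Sum>a\<leftarrow>C. f2 a) * (\<Sum>a\<leftarrow>D. f3 a) * (\<Sum>a\<leftarrow>E. f4 a) =
    (\<Sum>a\<leftarrow>A. \<Sum>b\<leftarrow>B. \<Sum>c\<leftarrow>C. \<Sum>d\<leftarrow>D. \<Sum>e\<leftarrow>E. f0 a * f1 b * f2 c * f3 d * f4 e)"
  by (simp add: sum_list_const_mult sum_list_mult_const mult.assoc)

lemma mon_ym: "mon (ym (a, b, c, d, e)) = var 0 ^ a * var 1 ^ b * var 2 ^ c * var 3 ^ d * var 4 ^ e"
  by (simp add: ym_def var_power mult_single)

text \<open>Expanding the five binomial powers gives one monomial for each choice of terms, and the
  total rise of the choice fixes its degree. Monomials may occur repeatedly in the list; they cancel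
  in pairs.\<close>

lemma sq_tups_correct:
  "hc (tup_deg y + a) (Stot tw (mon (ym y))) = (\<Sum>t\<leftarrow>sq_tups a y. (mon (ym t) :: (5, K) mpol))"
proof -
  obtain y0 y1 y2 y3 y4 where y: "y = (y0, y1, y2, y3, y4)" by (cases y)
  let ?L = "product_lists [subs y0, subs y1, subs y2, subs y3, subs y4]"
  let ?f = "\<lambda>ch. fin (rev (map snd ch))"
  have prod5: "(\<Prod>i\<in>UNIV. h i) = h 0 * h 1 * h 2 * h 3 * h (4::5)" for h :: "5 \<Rightarrow> (5, K) mpol"
    unfolding UNIV_5 by (simp add: mult.assoc)
  have tw5: "tw 0 = 4" "tw 1 = 0" "tw 2 = 1" "tw 3 = 2" "tw 4 = 3"
    by (simp_all add: tw_def)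
  have "Stot tw (mon (ym y)) = (var 0 + var 4 ^ 2) ^ y0 * (var 1 + var 0 ^ 2) ^ y1 * (var 2 + var 1 ^ 2) ^ y2 *
      (var 3 + var 2 ^ 2) ^ y3 * ((var 4 + var 3 ^ 2) ^ y4 :: (5, K) mpol)"
    by (simp only: Stot_def subst_mon prod5 y lookup_ym tw5)
  also have "\<dots> = (\<Sum>x0\<leftarrow>subs y0. \<Sum>x1\<leftarrow>subs y1. \<Sum>x2\<leftarrow>subs y2. \<Sum>x3\<leftarrow>subs y3. \<Sum>x4\<leftarrow>subs y4.
      mon (ym (?f [x0, x1, x2, x3, x4])))"
    unfolding subs_binomial sum_list_mult_5
    by (intro arg_cong[where f = sum_list] map_cong refl)
      (auto simp: mon_ym power_add ac_simps)
  also have "\<dots> = (\<Sum>ch\<leftarrow>?L. mon (ym (?f ch)))"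
    by (simp only: sum_list_product_lists_5)
  finally have S: "Stot tw (mon (ym y)) = (\<Sum>ch\<leftarrow>?L. (mon (ym (?f ch)) :: (5, K) mpol))" .
  have deg: "tup_deg (?f ch) = tup_deg y + sum_list (map fst ch)" if chL: "ch \<in> set ?L" for ch
  proof -
    obtain x0 x1 x2 x3 x4 where ch: "ch = [x0, x1, x2, x3, x4]" "x0 \<in> set (subs y0)" "x1 \<in> set (subs y1)"
      "x2 \<in> set (subs y2)" "x3 \<in> set (subs y3)" "x4 \<in> set (subs y4)"
      using chL by auto
    obtain b0 p0 q0 b1 p1 q1 b2 p2 q2 b3 p3 q3 b4 p4 q4 where
      x: "x0 = (b0, p0, q0)" "x1 = (b1, p1, q1)" "x2 = (b2, p2, q2)" "x3 = (b3, p3, q3)" "x4 = (b4, p4, q4)"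
      by (metis prod_cases3)
    have "p0 + q0 = y0 + b0" "p1 + q1 = y1 + b1" "p2 + q2 = y2 + b2" "p3 + q3 = y3 + b3" "p4 + q4 = y4 + b4"
      using ch(2-6) x subs_deg by blast+
    then show ?thesis by (simp add: ch(1) x y)
  qed
  have "hc (tup_deg y + a) (Stot tw (mon (ym y))) = (\<Sum>ch\<leftarrow>?L. if sum_list (map fst ch) = a then (mon (ym (?f ch)) :: (5, K) mpol) else 0)"
    unfolding S hc_sum_list map_map by (intro arg_cong[where f = sum_list] map_cong refl) (simp add: deg del: product_lists.simps)
  also have "\<dots> = (\<Sum>ch\<leftarrow>filter (\<lambda>ch. sum_list (map fst ch) = a) ?L. mon (ym (?f ch)))"
    by (simp only: sum_list_map_filter')
  finally show ?thesis by (simp add: y go_eq o_def del: product_lists.simps)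
qed

lemma tup_deg_sq_tups: "t \<in> set (sq_tups a y) \<Longrightarrow> tup_deg t = tup_deg y + a"
proof -
  assume t: "t \<in> set (sq_tups a y)"
  obtain y0 y1 y2 y3 y4 where y: "y = (y0, y1, y2, y3, y4)" by (cases y)
  obtain ch where ch: "ch \<in> set (product_lists [subs y0, subs y1, subs y2, subs y3, subs y4])"
    "sum_list (map fst ch) = a" "t = fin (rev (map snd ch))"
    using t by (auto simp: y go_eq simp del: product_lists.simps)
  obtain x0 x1 x2 x3 x4 where c: "ch = [x0, x1, x2, x3, x4]" "x0 \<in> set (subs y0)" "x1 \<in> set (subs y1)"
    "x2 \<in> set (subs y2)" "x3 \<in> set (subs y3)" "x4 \<in> set (subs y4)"
    using ch(1) by auto
  obtain b0 p0 q0 b1 p1 q1 b2 p2 q2 b3 p3 q3 b4 p4 q4 where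
    x: "x0 = (b0, p0, q0)" "x1 = (b1, p1, q1)" "x2 = (b2, p2, q2)" "x3 = (b3, p3, q3)" "x4 = (b4, p4, q4)"
    by (metis prod_cases3)
  have "p0 + q0 = y0 + b0" "p1 + q1 = y1 + b1" "p2 + q2 = y2 + b2" "p3 + q3 = y3 + b3" "p4 + q4 = y4 + b4"
    using c(2-6) x subs_deg by blast+
  then show ?thesis using ch(2) by (simp add: ch(3) c(1) x y)
qed

section \<open>Executable relations\<close>

abbreviation trm :: "hx \<times> tup \<Rightarrow> (5, K) mpol"
  where "trm x \<equiv> sqz (zs (fst x)) (mon (ym (snd x)))"

definition psum :: "(hx \<times> tup) list \<Rightarrow> (5, K) mpol"
  where "psum l = (\<Sum>x\<leftarrow>l. trm x)"

lemma psum_simps [simp]: "psum [] = 0" "psum (x # l) = trm x + psum l" "psum (l @ l') = psum l + psum l'"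
  by (simp_all add: psum_def)

text \<open>\<open>r1\<close>, \<open>r2\<close> and \<open>r3\<close> are the executable forms of
  the relations coming from three, four and five odd exponents. In \<open>r1\<close> and
  \<open>r3\<close>, \<open>a\<close> is the rise in degree within the square part.\<close>

definition r1 :: "hx \<Rightarrow> nat \<Rightarrow> tup \<Rightarrow> (hx \<times> tup) list"
  where "r1 z a y = map (Pair z) (sq_tups a y)"

text \<open>The digit names the variable that is missing from the four-element set; each term drops
  one more index i and multiplies the square part by the variable i - 1.\<close>

fun r2 :: "hx \<Rightarrow> tup \<Rightarrow> (hx \<times> tup) list" where
  "r2 H0 g = [(H9, inc H0 g), (H8, inc H1 g), (H7, inc H2 g), (H6, inc H3 g)]" |
  "r2 H1 g = [(H9, inc H4 g), (H5, inc H1 g), (H4, inc H2 g), (H3, inc H3 g)]" |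
  "r2 H2 g = [(H8, inc H4 g), (H5, inc H0 g), (H2, inc H2 g), (H1, inc H3 g)]" |
  "r2 H3 g = [(H7, inc H4 g), (H4, inc H0 g), (H2, inc H1 g), (H0, inc H3 g)]" |
  "r2 H4 g = [(H6, inc H4 g), (H3, inc H0 g), (H1, inc H1 g), (H0, inc H2 g)]" |
  "r2 z g = []"

text \<open>One term for each two-element \<open>A\<close> taken out of the full set; the two
  increments are the indices of \<open>A\<close> lowered by one, cyclically.\<close>

definition pairs :: "tup \<Rightarrow> (hx \<times> tup) list"
  where "pairs t = [(H9, inc H4 (inc H0 t)),
    (H8, inc H4 (inc H1 t)),
    (H7, inc H4 (inc H2 t)),
    (H6, inc H4 (inc H3 t)),
    (H5, inc H0 (inc H1 t)),
    (H4, inc H0 (inc H2 t)),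
    (H3, inc H0 (inc H3 t)),
    (H2, inc H1 (inc H2 t)),
    (H1, inc H1 (inc H3 t)),
    (H0, inc H2 (inc H3 t))]"

fun cpairs :: "tup list \<Rightarrow> (hx \<times> tup) list" where
  "cpairs [] = []" | "cpairs (t # l) = pairs t @ cpairs l"

text \<open>The rise \<open>a - 1\<close> in the second part is forced by degrees: two odd exponents
  fewer leave room for one more degree in the square part, and the two new variables take up
  two.\<close>

fun r3 :: "nat \<Rightarrow> tup \<Rightarrow> (hx \<times> tup) list" where
  "r3 0 y = []"
| "r3 (Suc a) y = map (Pair HA) (sq_tups (Suc a) y) @ cpairs (sq_tups a y)"

lemma is3_iff: "is3 z \<longleftrightarrow> card (zs z) = 3"
  by (cases z) simp_all

lemma psum_map_Pair: "psum (map (Pair z) l) = sqz (zs z) (\<Sum>t\<leftarrow>l. mon (ym t))"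
  by (induction l) (simp_all add: sqz_linear)

lemma r1_psum: "psum (r1 z a y) = sqz (zs z) (hc (tup_deg y + a) (Stot tw (mon (ym y))))"
  by (simp only: r1_def psum_map_Pair sq_tups_correct)

lemma r1_hit: "is3 z \<Longrightarrow> 0 < a \<Longrightarrow> tup_deg y + a = 11 \<Longrightarrow> psum (r1 z a y) \<in> htw tw 25"
  unfolding r1_psum by (rule hit_three_odd) (auto simp: is3_iff intro: htw_base)

lemma r2_psum: "k \<in> {H0, H1, H2, H3, H4} \<Longrightarrow>
  psum (r2 k g) = (\<Sum>i\<in>- {pos k}. sqz (- {pos k} - {i}) (var (i - 1) * mon (ym g)))"
proof -
  have U: "- {0::5} = {1, 2, 3, 4}" "- {1::5} = {0, 2, 3, 4}" "- {2::5} = {0, 1, 3, 4}"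
    "- {3::5} = {0, 1, 2, 4}" "- {4::5} = {0, 1, 2, 3}"
    unfolding Compl_eq_Diff_UNIV UNIV_5 by auto
  assume "k \<in> {H0, H1, H2, H3, H4}"
  then consider "k = H0" | "k = H1" | "k = H2" | "k = H3" | "k = H4" by blast
  then show ?thesis
    by cases (simp_all add: U mon_ym_inc minus_1_5 insert_Diff_if)
qed

lemma r2_hit: "k \<in> {H0, H1, H2, H3, H4} \<Longrightarrow> tup_deg g = 10 \<Longrightarrow> psum (r2 k g) \<in> htw tw 25"
  unfolding r2_psum by (rule hit_four_odd) (simp_all add: Compl_eq_Diff_UNIV card_Diff_subset)

lemma sum_pairs:
  "(\<Sum>A | card (A :: 5 set) = 2. f A) =
  (f {0, 1} + f {0, 2} + f {0, 3} + f {0, 4} + f {1, 2} + f {1, 3} + f {1, 4} + f {2, 3} + f {2, 4} + f {3, 4} :: 'a::comm_monoid_add)"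
proof -
  have "{A :: 5 set. card A = 2} = {{0, 1}, {0, 2}, {0, 3}, {0, 4}, {1, 2}, {1, 3}, {1, 4}, {2, 3}, {2, 4}, {3, 4}}"
  proof (intro equalityI subsetI)
    fix A :: "5 set" assume "A \<in> {A. card A = 2}"
    then obtain x y where "A = {x, y}" "x \<noteq> y" by (auto simp: card_2_iff)
    then show "A \<in> {{0, 1}, {0, 2}, {0, 3}, {0, 4}, {1, 2}, {1, 3}, {1, 4}, {2, 3}, {2, 4}, {3, 4}}"
      using exhaust_5[of x] exhaust_5[of y] by (elim disjE) (simp_all add: insert_commute)
  qed auto
  then show ?thesis by (simp add: doubleton_eq_iff add.assoc)
qed

lemma pairs_psum: "psum (pairs t) = (\<Sum>A | card A = 2. sqz (UNIV - A) (tvars A * mon (ym t)))"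
proof -
  have U: "UNIV - {0, 1 :: 5} = {2, 3, 4}" "UNIV - {0, 2 :: 5} = {1, 3, 4}" "UNIV - {0, 3 :: 5} = {1, 2, 4}" "UNIV - {0, 4 :: 5} = {1, 2, 3}" "UNIV - {1, 2 :: 5} = {0, 3, 4}" "UNIV - {1, 3 :: 5} = {0, 2, 4}" "UNIV - {1, 4 :: 5} = {0, 2, 3}" "UNIV - {2, 3 :: 5} = {0, 1, 4}" "UNIV - {2, 4 :: 5} = {0, 1, 3}" "UNIV - {3, 4 :: 5} = {0, 1, 2}"
    unfolding UNIV_5 by auto
  show ?thesis unfolding sum_pairs pairs_def
    by (simp add: U mon_ym_inc minus_1_5 mult.assoc add.assoc)
qed

lemma psum_cpairs: "psum (cpairs l) = (\<Sum>A | card A = 2. sqz (UNIV - A) (tvars A * (\<Sum>t\<leftarrow>l. mon (ym t))))"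
  by (induction l) (simp_all add: sqz_linear pairs_psum distrib_left sum.distrib)

lemma r3_psum: "0 < a \<Longrightarrow> psum (r3 a y) = sqz UNIV (hc (tup_deg y + a) (Stot tw (mon (ym y)))) +
    (\<Sum>A | card A = 2. sqz (UNIV - A) (tvars A * hc (tup_deg y + a - 1) (Stot tw (mon (ym y)))))"
  by (cases a) (simp_all add: psum_map_Pair psum_cpairs sq_tups_correct del: sq_tups.simps flip: add_Suc_right)

lemma r3_hit: "0 < a \<Longrightarrow> tup_deg y + a = 10 \<Longrightarrow> psum (r3 a y) \<in> htw tw 25"
  unfolding r3_psum using hit_five_odd[of "ym y"] by simp

section \<open>Executable certificate checker\<close>

fun xsum :: "(hx \<Rightarrow> tup \<Rightarrow> hx \<times> hx) \<Rightarrow> (hx \<times> tup) list \<Rightarrow> hx \<times> hx" where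
  "xsum F [] = (H0, H0)" | "xsum F ((z, t) # l) = xor_pair (F z t) (xsum F l)"

text \<open>Value of the high digit of a rank or of a position in a basis list. Positions are below
  40, so for them the digits up to 2 suffice; the remaining digits get the default 0.\<close>

primrec hex_nat16 :: "hx \<Rightarrow> nat" where
  "hex_nat16 H0 = 0" |
  "hex_nat16 H1 = N16" |
  "hex_nat16 H2 = N32" |
  "hex_nat16 H3 = 0" |
  "hex_nat16 H4 = 0" |
  "hex_nat16 H5 = 0" |
  "hex_nat16 H6 = 0" |
  "hex_nat16 H7 = 0" |
  "hex_nat16 H8 = 0" |
  "hex_nat16 H9 = 0" |
  "hex_nat16 HA = 0" |
  "hex_nat16 HB = 0" |
  "hex_nat16 HC = 0" |
  "hex_nat16 HD = 0" |
  "hex_nat16 HE = 0" |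
  "hex_nat16 HF = 0"

fun less_nat :: "nat \<Rightarrow> nat \<Rightarrow> bool" where
  "less_nat a 0 = False" | "less_nat 0 (Suc b) = True" | "less_nat (Suc a) (Suc b) = less_nat a b"

fun rank_of :: "hx list \<Rightarrow> nat" where
  "rank_of (lo # hi # l) = ad (hex_nat16 hi) (hex_nat lo)" | "rank_of l = 0"

text \<open>Lists represent polynomials over F_2: adding a monomial that is already present cancels
  it.\<close>

function (sequential) toggle and toggle_aux where
  "toggle x [] = [x]" | "toggle x (y # ys) = toggle_aux (x = y) x y ys"
| "toggle_aux True x y ys = ys" | "toggle_aux False x y ys = y # toggle x ys"
  by pat_completeness auto
termination
  by (relation "measure (\<lambda>x. case x of Inl (x, l) \<Rightarrow> 2 * length l | Inr (b, x, y, l) \<Rightarrow> 2 * length l + 1)") auto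

fun toggle_unless :: "bool \<Rightarrow> 'a \<Rightarrow> 'a list \<Rightarrow> 'a list" where
  "toggle_unless True x acc = acc" | "toggle_unless False x acc = toggle x acc"

text \<open>Adds a relation while forgetting its monomials of rank below \<open>r\<close>, which the
  induction on the rank has already placed in the span.\<close>

fun toggle_high :: "(hx \<Rightarrow> tup \<Rightarrow> hx list) \<Rightarrow> nat \<Rightarrow> (hx \<times> tup) list \<Rightarrow> (hx \<times> tup) list \<Rightarrow> (hx \<times> tup) list" where
  "toggle_high cert_entry r [] acc = acc"
| "toggle_high cert_entry r ((z, t) # l) acc = toggle_unless (less_nat (rank_of (cert_entry z t)) r) (z, t) (toggle_high cert_entry r l acc)"

primrec ispos :: "hx \<Rightarrow> bool" where
  "ispos H0 = True" |
  "ispos H1 = True" |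
  "ispos H2 = True" |
  "ispos H3 = True" |
  "ispos H4 = True" |
  "ispos H5 = False" |
  "ispos H6 = False" |
  "ispos H7 = False" |
  "ispos H8 = False" |
  "ispos H9 = False" |
  "ispos HA = False" |
  "ispos HB = False" |
  "ispos HC = False" |
  "ispos HD = False" |
  "ispos HE = False" |
  "ispos HF = False"

fun relation1 :: "bool \<Rightarrow> hx \<Rightarrow> tup \<Rightarrow> nat option \<Rightarrow> (hx \<times> tup) list option" where "relation1 True ax y (Some (Suc a)) = Some (r1 ax (Suc a) y)" | "relation1 b ax y m = None"
fun relation2 :: "bool \<Rightarrow> hx \<Rightarrow> tup \<Rightarrow> nat option \<Rightarrow> (hx \<times> tup) list option" where "relation2 True ax y (Some 0) = Some (r2 ax y)" | "relation2 b ax y m = None"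
fun relation3 :: "tup \<Rightarrow> nat option \<Rightarrow> (hx \<times> tup) list option" where "relation3 y (Some (Suc a)) = Some (r3 (Suc a) y)" | "relation3 y m = None"

primrec relation_of :: "hx \<Rightarrow> hx \<Rightarrow> tup \<Rightarrow> (hx \<times> tup) list option" where
  "relation_of H0 ax y = None" |
  "relation_of H1 ax y = relation1 (is3 ax) ax y (sub_opt N11 (tup_deg y))" |
  "relation_of H2 ax y = relation2 (ispos ax) ax y (sub_opt N10 (tup_deg y))" |
  "relation_of H3 ax y = relation3 y (sub_opt N10 (tup_deg y))" |
  "relation_of H4 ax y = None" |
  "relation_of H5 ax y = None" |
  "relation_of H6 ax y = None" |
  "relation_of H7 ax y = None" |
  "relation_of H8 ax y = None" |
  "relation_of H9 ax y = None" |
  "relation_of HA ax y = None" |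
  "relation_of HB ax y = None" |
  "relation_of HC ax y = None" |
  "relation_of HD ax y = None" |
  "relation_of HE ax y = None" |
  "relation_of HF ax y = None"

text \<open>A relation is a block of seven digits: its kind, its argument and five exponents. The
  single digit at the end is a sentinel: entries are stored as numerals with the last digit leading,
  and zeros at the end of the last block would otherwise be lost.\<close>

function (sequential) rel and rl where
  "rel cert_entry r acc (ty # ax # a # b # c # d # e # l) =
     rl cert_entry r acc (relation_of ty ax (hex_nat a, hex_nat b, hex_nat c, hex_nat d, hex_nat e)) l"
| "rel cert_entry r acc [x] = Some acc"
| "rel cert_entry r acc l = None"
| "rl cert_entry r acc None l = None"
| "rl cert_entry r acc (Some ts) l = rel cert_entry r (toggle_high cert_entry r ts acc) l"
  by pat_completeness auto
termination
  by (relation "measure (\<lambda>x. case x of Inl (e, r, acc, l) \<Rightarrow> 2 * length l | Inr (e, r, acc, m, l) \<Rightarrow> 2 * length l + 1)") auto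

fun ev :: "nat \<Rightarrow> bool" where "ev 0 = True" | "ev (Suc 0) = False" | "ev (Suc (Suc n)) = ev n"

fun cnt :: "bool list \<Rightarrow> nat" where
  "cnt [] = 0" | "cnt (True # l) = cnt l" | "cnt (False # l) = Suc (cnt l)"

fun odd1 :: "tup \<Rightarrow> bool" where
  "odd1 (a, b, c, d, e) = (cnt [ev a, ev b, ev c, ev d, ev e] = Suc 0)"

fun rot :: "hx \<times> tup \<Rightarrow> hx \<times> tup" where "rot (z, t) = (rot_set z, rot_tup t)"

fun nth_opt :: "'a list \<Rightarrow> nat \<Rightarrow> 'a option" where
  "nth_opt [] n = None" | "nth_opt (x # xs) 0 = Some x" | "nth_opt (x # xs) (Suc n) = nth_opt xs n"

fun rot_opt :: "nat \<Rightarrow> (hx \<times> tup) option \<Rightarrow> (hx \<times> tup) option" where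
  "rot_opt k None = None" | "rot_opt 0 (Some x) = Some x" | "rot_opt (Suc k) (Some x) = rot_opt k (Some (rot x))"

text \<open>An entry of rank 0 consists of a number of rotations, the number of a basis list and the
  low and high digit of the position in it.\<close>

fun basis_member :: "(nat \<Rightarrow> (hx \<times> tup) list) \<Rightarrow> hx list \<Rightarrow> hx \<times> tup \<Rightarrow> bool" where
  "basis_member basis_list (k # c # p # q # l) x = (rot_opt (hex_nat k) (nth_opt (basis_list (hex_nat c)) (ad (hex_nat16 q) (hex_nat p))) = Some x)"
| "basis_member basis_list l x = False"

fun certified_rank where
  "certified_rank cert_entry basis_list 0 z t l = basis_member basis_list l (z, t)"
| "certified_rank cert_entry basis_list (Suc r) z t l = (rel cert_entry (Suc r) [] l = Some [(z, t)])"

fun certified where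
  "certified cert_entry basis_list z t [] = (is3 z \<and> odd1 t)"
| "certified cert_entry basis_list z t [x] = False"
| "certified cert_entry basis_list z t (lo # hi # l) = certified_rank cert_entry basis_list (ad (hex_nat16 hi) (hex_nat lo)) z t l"

text \<open>The monomials of degree 25 with three or five odd exponents: 25 = 3 + 2 * 11 = 5 + 2 *
  10.\<close>

definition valid :: "hx \<times> tup \<Rightarrow> bool"
  where "valid x \<longleftrightarrow> is3 (fst x) \<and> tup_deg (snd x) = 11 \<or> fst x = HA \<and> tup_deg (snd x) = 10"

lemma less_nat_eq: "less_nat a b \<longleftrightarrow> a < b"
  by (induction a b rule: less_nat.induct) auto

lemma ispos_iff: "ispos k \<longleftrightarrow> k \<in> {H0, H1, H2, H3, H4}"
  by (cases k) auto

lemma psum_toggle: "psum (toggle x l) = trm x + psum l"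
proof (induction l)
  case (Cons y l)
  show ?case
  proof (cases "x = y")
    case True
    have "trm x + (trm x + psum l) = psum l" by (simp flip: add.assoc)
    then show ?thesis using True by simp
  qed (use Cons in \<open>simp add: ac_simps\<close>)
qed simp

lemma ev_eq: "ev n \<longleftrightarrow> even n"
  by (induction n rule: ev.induct) auto

lemma odd1_correct: "odd1 t \<Longrightarrow> card {i. odd (Poly_Mapping.lookup (ym t) i)} = 1"
proof -
  obtain a b c d e where t: "t = (a, b, c, d, e)" by (cases t)
  have "card {i. odd (Poly_Mapping.lookup m i)} = (\<Sum>i\<in>UNIV. of_bool (odd (Poly_Mapping.lookup m (i :: 5))))" for m
    by (simp add: of_bool_def sum.If_cases)
  note * = this[of "ym t"]
  have "card {i. odd (Poly_Mapping.lookup (ym t) i)} =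
      of_bool (odd a) + of_bool (odd b) + of_bool (odd c) + of_bool (odd d) + of_bool (odd e)"
    unfolding * by (simp only: sum_5 t lookup_ym)
  also have "\<dots> = cnt [ev a, ev b, ev c, ev d, ev e]"
    by (cases "even a"; cases "even b"; cases "even c"; cases "even d"; cases "even e") (simp_all add: ev_eq)
  finally have "card {i. odd (Poly_Mapping.lookup (ym t) i)} = cnt [ev a, ev b, ev c, ev d, ev e]" .
  then show "odd1 t \<Longrightarrow> ?thesis" by (simp add: t)
qed

lemma valid_r1: "is3 z \<Longrightarrow> tup_deg y + a = 11 \<Longrightarrow> \<forall>x\<in>set (r1 z a y). valid x"
  by (auto simp: r1_def valid_def dest!: tup_deg_sq_tups)

lemma valid_r2: "tup_deg g = 10 \<Longrightarrow> \<forall>x\<in>set (r2 k g). valid x"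
  by (cases k) (simp_all add: valid_def tup_deg_inc)

lemma set_cpairs: "set (cpairs l) = (\<Union>t\<in>set l. set (pairs t))"
  by (induction l) auto

lemma valid_r3: "tup_deg y + a = 10 \<Longrightarrow> \<forall>x\<in>set (r3 a y). valid x"
proof (cases a)
  case (Suc b)
  assume d: "tup_deg y + a = 10"
  have "\<forall>x\<in>set (pairs t). valid x" if "t \<in> set (sq_tups b y)" for t
  proof -
    have "tup_deg t = 9" using tup_deg_sq_tups[OF that] d Suc by simp
    then show ?thesis by (simp add: pairs_def valid_def tup_deg_inc)
  qed
  then have p: "valid x" if "t \<in> set (sq_tups b y)" "x \<in> set (pairs t)" for t x
    using that by blast
  have q: "valid (HA, t)" if "t \<in> set (sq_tups (Suc b) y)" for t
    using tup_deg_sq_tups[OF that] d Suc by (simp add: valid_def)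
  show ?thesis
    using p q by (auto simp: Suc set_cpairs simp del: sq_tups.simps)
qed simp

lemma relation_of_correct:
  assumes "relation_of ty ax y = Some l"
  shows "psum l \<in> htw tw 25 \<and> (\<forall>x\<in>set l. valid x)"
proof -
  have 1: ?thesis if t: "relation1 (is3 ax) ax y (sub_opt 11 (tup_deg y)) = Some l"
  proof -
    have "is3 ax" using t by (cases "is3 ax") auto
    moreover obtain a where a: "sub_opt 11 (tup_deg y) = Some (Suc a)" "l = r1 ax (Suc a) y"
      using t \<open>is3 ax\<close> by (auto elim!: relation1.elims)
    then have "tup_deg y + Suc a = 11" by (auto simp: sub_opt_eq split: if_splits)
    ultimately show ?thesis using r1_hit[of ax "Suc a" y] valid_r1[of ax y "Suc a"] a(2) by simp
  qed
  have 2: ?thesis if t: "relation2 (ispos ax) ax y (sub_opt 10 (tup_deg y)) = Some l"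
  proof -
    have "ispos ax" using t by (cases "ispos ax") auto
    moreover have a: "sub_opt 10 (tup_deg y) = Some 0" "l = r2 ax y"
      using t by (auto elim!: relation2.elims)
    then have "tup_deg y = 10" by (auto simp: sub_opt_eq split: if_splits)
    ultimately show ?thesis using r2_hit[of ax y] valid_r2[of y ax] a(2) unfolding ispos_iff by simp
  qed
  have 3: ?thesis if t: "relation3 y (sub_opt 10 (tup_deg y)) = Some l"
  proof -
    obtain a where a: "sub_opt 10 (tup_deg y) = Some (Suc a)" "l = r3 (Suc a) y"
      using t by (auto elim!: relation3.elims)
    then have "tup_deg y + Suc a = 10" by (auto simp: sub_opt_eq split: if_splits)
    then show ?thesis using r3_hit[of "Suc a" y] valid_r3[of y "Suc a"] a(2) by (simp del: r3.simps)
  qed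
  show ?thesis
    using assms 1 2 3 by (cases ty) (simp_all add: eval_nat_numeral)
qed

text \<open>In characteristic 2 the sum of the old and the new total is their difference. It
  consists of forgotten monomials, which lie in \<open>S\<close> by \<open>low\<close>.\<close>

lemma toggle_high_correct:
  assumes S: "MP.subspace S"
    and low: "\<And>z t. valid (z, t) \<Longrightarrow> rank_of (cert_entry z t) < r \<Longrightarrow> trm (z, t) \<in> S"
    and v: "\<forall>x\<in>set l. valid x"
  shows "psum (toggle_high cert_entry r l acc) + (psum l + psum acc) \<in> S"
  using v
proof (induction l)
  case Nil
  then show ?case using MP.subspace_0[OF S] by simp
next
  case (Cons x l)
  obtain z t where x: "x = (z, t)" by (cases x)
  have IH: "psum (toggle_high cert_entry r l acc) + (psum l + psum acc) \<in> S" using Cons by simp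
  show ?case
  proof (cases "rank_of (cert_entry z t) < r")
    case True
    then have "trm x + (psum (toggle_high cert_entry r l acc) + (psum l + psum acc)) \<in> S"
      using low[of z t] Cons.prems x by (intro MP.subspace_add[OF S _ IH]) auto
    then show ?thesis using True by (simp add: x less_nat_eq ac_simps)
  next
    case False
    have "trm x + psum (toggle_high cert_entry r l acc) + (trm x + psum l + psum acc) =
        (trm x + trm x) + (psum (toggle_high cert_entry r l acc) + (psum l + psum acc))"
      by (simp only: ac_simps)
    then show ?thesis using False IH by (simp add: x less_nat_eq psum_toggle)
  qed
qed

text \<open>Each block adds a hit polynomial and forgets elements of \<open>S\<close>, so the
  accumulated sum is constant modulo \<open>S\<close>.\<close>

lemma rel_correct:
  assumes S: "MP.subspace S" "htw tw 25 \<subseteq> S"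
    and low: "\<And>z t. valid (z, t) \<Longrightarrow> rank_of (cert_entry z t) < r \<Longrightarrow> trm (z, t) \<in> S"
  shows "rel cert_entry r acc l = Some out \<Longrightarrow> psum out + psum acc \<in> S"
    and "rl cert_entry r acc m l = Some out \<Longrightarrow> (\<And>ts. m = Some ts \<Longrightarrow> psum ts \<in> htw tw 25 \<and> (\<forall>x\<in>set ts. valid x)) \<Longrightarrow>
      psum out + psum acc \<in> S"
  using low
proof (induction cert_entry r acc l and cert_entry r acc m l rule: rel_rl.induct)
  case (1 cert_entry r acc ty ax a b c d e l)
  then show ?case using relation_of_correct[of ty ax "(hex_nat a, hex_nat b, hex_nat c, hex_nat d, hex_nat e)"] by simp
next
  case (5 cert_entry r acc ts l)
  have t: "psum ts \<in> S" "\<forall>x\<in>set ts. valid x" using 5(3) S(2) by auto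
  have "psum out + psum (toggle_high cert_entry r ts acc) \<in> S" using 5 by simp
  moreover have "psum (toggle_high cert_entry r ts acc) + (psum ts + psum acc) \<in> S"
    using toggle_high_correct[OF S(1) 5(4) t(2)] by blast
  ultimately have "(psum out + psum (toggle_high cert_entry r ts acc)) + (psum (toggle_high cert_entry r ts acc) + (psum ts + psum acc)) + psum ts \<in> S"
    by (rule MP.subspace_add[OF S(1) MP.subspace_add[OF S(1)] t(1)])
  moreover have "(psum out + psum (toggle_high cert_entry r ts acc)) + (psum (toggle_high cert_entry r ts acc) + (psum ts + psum acc)) + psum ts =
      (psum out + psum acc) + (psum (toggle_high cert_entry r ts acc) + psum (toggle_high cert_entry r ts acc)) + (psum ts + psum ts)"
    by (simp only: ac_simps)
  ultimately show ?case by (simp only: mpolK_double add_0_right)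
qed (use MP.subspace_0[OF S(1)] in auto)

section \<open>Rotation and weights\<close>

text \<open>The twist is a translation of the index, so rotating the variables commutes with the
  twisted total square.\<close>

definition R5 :: "(5, K) mpol \<Rightarrow> (5, K) mpol"
  where "R5 = subst (\<lambda>i. var (i + 1))"

lemma R5_linear: "R5 (f + g) = R5 f + R5 g" "R5 (smul c f) = smul c (R5 f)" "R5 0 = 0"
  by (simp_all add: R5_def subst_linear)

lemma R5_Stot: "R5 (Stot tw f) = Stot tw (R5 f)"
  by (simp add: R5_def Stot_def subst_comp subst_linear subst_power tw_def)

lemma R5_hom: "R5 (mon m) \<in> hom (mono_deg m)"
proof -
  have "(var (i + 1) :: (5, K) mpol) \<in> hom 1" for i by (simp add: var_def hom_mon)
  then have "R5 (mon m) \<in> hom (\<Sum>i\<in>UNIV. 1 * Poly_Mapping.lookup m i)"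
    unfolding R5_def subst_mon by (intro hom_prod hom_power)
  then show ?thesis by (simp add: mono_deg_def)
qed

lemma R5_hc: "hc d (R5 f) = R5 (hc d f)"
proof (induction f rule: mpol_induct)
  case (single m c)
  have "hc d (R5 (smul c (mon m))) = R5 (hc d (smul c (mon m)))"
    using hc_hom[OF R5_hom, of d m] by (simp add: R5_linear hc_smul del: smul_single)
  then show ?case by simp
qed (simp_all add: R5_linear hc_add)

lemma R5_htw: "f \<in> htw tw d \<Longrightarrow> R5 f \<in> htw tw d"
  unfolding htw_def
proof (induction rule: MP.span_induct_alt)
  case (step c x y)
  then obtain m where m: "x = hc d (Stot tw (mon m))" "mono_deg m < d" by blast
  have "R5 (mon m) \<in> MP.span (mon ` {k. mono_deg k \<noteq> d})"
    using R5_hom[of m] MP.span_mono[of "mon ` {k. mono_deg k = mono_deg m}" "mon ` {k. mono_deg k \<noteq> d}"] m(2)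
    by (fastforce simp: hom_span)
  then have "R5 x \<in> htw tw d"
    using Stot_hit_span[of "R5 (mon m)" d tw] by (simp add: m(1) R5_Stot flip: R5_hc)
  then show ?case using step by (simp add: R5_linear MP.span_add MP.span_scale htw_def)
qed (simp add: R5_linear MP.span_zero)

lemma R5_trm: "R5 (trm x) = trm (rot x)"
proof -
  obtain z a b c d e where x: "x = (z, a, b, c, d, e)" by (cases x) auto
  have i: "(i :: 5) + 1 \<in> zs (rot_set z) \<longleftrightarrow> i \<in> zs z" for i
    using exhaust_5[of i] by (cases z) auto
  have im: "(\<lambda>i. i + 1) ` zs z = zs (rot_set z)"
  proof (intro equalityI subsetI)
    fix j assume "j \<in> zs (rot_set z)"
    then show "j \<in> (\<lambda>i. i + 1) ` zs z" using i[of "j - 1"] by (intro image_eqI[of _ _ "j - 1"]) simp_all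
  qed (use i in auto)
  have 1: "R5 (mon (ind (zs z))) = mon (ind (zs (rot_set z)))"
  proof -
    have "R5 (mon (ind (zs z))) = (\<Prod>j\<in>(\<lambda>i. i + 1) ` zs z. var j)"
      by (simp add: R5_def mon_ind subst_prod prod.reindex inj_on_def)
    then show ?thesis by (simp only: im mon_ind)
  qed
  have 2: "R5 (mon (ym (a, b, c, d, e))) = mon (ym (e, a, b, c, d))"
  proof -
    have "(0 :: 5) + 1 = 1" "(1 :: 5) + 1 = 2" "(2 :: 5) + 1 = 3" "(3 :: 5) + 1 = 4" "(4 :: 5) + 1 = 0"
      by simp_all
    then have "R5 (mon (ym (a, b, c, d, e))) = var 1 ^ a * var 2 ^ b * var 3 ^ c * var 4 ^ d * var 0 ^ e"
      by (simp only: R5_def mon_ym subst_mult subst_power subst_var)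
    then show ?thesis by (simp only: mon_ym ac_simps)
  qed
  have 3: "R5 (dbl f) = dbl (R5 f)" for f
    by (simp add: R5_def dbl_def subst_comp subst_power)
  have "R5 (f * g) = R5 f * R5 g" for f g by (simp add: R5_def subst_mult)
  then show ?thesis by (simp add: x 1 2 3)
qed

text \<open>Powers of 2, so that passing to the next index doubles the weight; modulo 31 this closes
  up cyclically because 2^5 = 32.\<close>

definition wcoef :: "5 \<Rightarrow> nat"
  where "wcoef i = (if i = 0 then 1 else if i = 1 then 2 else if i = 2 then 4 else if i = 3 then 8 else 16)"

lemma wcoef_simps: "wcoef 0 = 1" "wcoef 1 = 2" "wcoef 2 = 4" "wcoef 3 = 8" "wcoef 4 = 16"
  by (simp_all add: wcoef_def)

definition mono_weight :: "(5 \<Rightarrow>\<^sub>0 nat) \<Rightarrow> nat"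
  where "mono_weight m = (\<Sum>i\<in>UNIV. wcoef i * Poly_Mapping.lookup m i)"

lemma mono_weight_add: "mono_weight (a + b) = mono_weight a + mono_weight b"
  by (simp add: mono_weight_def lookup_add distrib_left sum.distrib)

lemma mono_weight_single: "mono_weight (Poly_Mapping.single i k) = wcoef i * k"
  by (simp add: mono_weight_def lookup_single when_def if_distrib[of "(*) _"] cong: if_cong)

definition wh :: "nat \<Rightarrow> (5, K) mpol set"
  where "wh w = {f. \<forall>m\<in>Poly_Mapping.keys f. mono_weight m mod 31 = w mod 31}"

lemma wh_mult: "f \<in> wh a \<Longrightarrow> g \<in> wh b \<Longrightarrow> f * g \<in> wh (a + b)"
  unfolding wh_def using keys_mult[of f g] by (fastforce simp: mono_weight_add intro: mod_add_cong)

lemma wh_1: "1 \<in> wh 0"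
  by (simp add: wh_def mono_weight_def flip: single_one)

lemma wh_power: "f \<in> wh a \<Longrightarrow> f ^ k \<in> wh (a * k)"
  by (induction k) (simp_all add: wh_1 wh_mult)

lemma wh_prod: "(\<And>x. x \<in> A \<Longrightarrow> f x \<in> wh (e x)) \<Longrightarrow> prod f A \<in> wh (sum e A)"
  by (induction A rule: infinite_finite_induct) (simp_all add: wh_1 wh_mult)

text \<open>\<open>var i\<close> and the square of \<open>var (i - 1)\<close> have the same weight
  modulo 31. The wrap-around at index 0 is 2 * 16 = 32.\<close>

lemma Stot_wh: "Stot tw (mon m) \<in> wh (mono_weight m)"
proof -
  have "(var i + var (tw i) ^ 2 :: (5, K) mpol) \<in> wh (wcoef i)" for i
  proof -
    have "2 * wcoef (i - 1) mod 31 = wcoef i mod 31"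
      using exhaust_5[of i] by (elim disjE) (simp_all add: minus_1_5 wcoef_simps)
    then show ?thesis
      unfolding wh_def var_power using keys_add[of "var i" "mon (Poly_Mapping.single (tw i) 2) :: (5, K) mpol"]
      by (auto simp: var_def mono_weight_single tw_def mult.commute)
  qed
  then have "Stot tw (mon m) \<in> wh (\<Sum>i\<in>UNIV. wcoef i * Poly_Mapping.lookup m i)"
    unfolding Stot_def subst_mon by (intro wh_prod wh_power)
  then show ?thesis by (simp add: mono_weight_def)
qed

definition prw :: "nat \<Rightarrow> (5, K) mpol \<Rightarrow> (5, K) mpol"
  where "prw w = lext (\<lambda>m. if mono_weight m mod 31 = w then mon m else 0)"

lemma lookup_prw: "Poly_Mapping.lookup (prw w f) m = (if mono_weight m mod 31 = w then Poly_Mapping.lookup f m else 0)"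
  by (induction f rule: mpol_induct) (auto simp: prw_def lext_add lookup_add lookup_single when_def)

text \<open>Each generator is homogeneous for the weight, so the projection either keeps or kills
  it.\<close>

lemma prw_htw: "f \<in> htw tw d \<Longrightarrow> prw w f \<in> htw tw d"
  unfolding htw_def
proof (induction rule: MP.span_induct_alt)
  case (step c x y)
  then obtain m where m: "x = hc d (Stot tw (mon m))" "mono_deg m < d" by blast
  have "mono_weight k mod 31 = mono_weight m mod 31" if "Poly_Mapping.lookup x k \<noteq> 0" for k
    using that Stot_wh[of m] by (auto simp: m(1) lookup_hc wh_def in_keys_iff split: if_splits)
  then have "Poly_Mapping.lookup (prw w x) k = Poly_Mapping.lookup (if mono_weight m mod 31 = w then x else 0) k" for k
    by (cases "Poly_Mapping.lookup x k = 0") (auto simp: lookup_prw)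
  then have "prw w x = (if mono_weight m mod 31 = w then x else 0)" by (intro poly_mapping_eqI)
  then have "prw w x \<in> htw tw d"
  proof -
    have "x \<in> htw tw d" unfolding m(1) by (rule htw_base[OF m(2)])
    then show ?thesis using \<open>prw w x = _\<close> by (simp add: htw_closed)
  qed
  then show ?case using step by (simp add: prw_def lext_add lext_smul MP.span_add MP.span_scale htw_def)
qed (simp add: prw_def MP.span_zero)

section \<open>From a certificate to a basis\<close>

definition ex :: "hx \<times> tup \<Rightarrow> 5 \<Rightarrow>\<^sub>0 nat"
  where "ex x = ind (zs (fst x)) + (ym (snd x) + ym (snd x))"

lemma trm_ex: "trm x = mon (ex x)"
  by (simp add: ex_def sqz_mon)

text \<open>A decision tree inverting \<open>zs\<close> on the three-element sets and the full
  set.\<close>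

definition cz :: "5 set \<Rightarrow> hx"
  where "cz Z = (if 0 \<in> Z
    then if 1 \<in> Z then if 2 \<in> Z then if 3 \<in> Z then HA else H0 else if 3 \<in> Z then H1 else H2
      else if 2 \<in> Z then if 3 \<in> Z then H3 else H4 else H5
    else if 1 \<in> Z then if 2 \<in> Z then if 3 \<in> Z then H6 else H7 else H8 else H9)"

lemma cz_zs: "is3 z \<or> z = HA \<Longrightarrow> cz (zs z) = z"
  by (cases z) (simp_all add: cz_def)

lemma zs_cz: "card Z = 3 \<Longrightarrow> zs (cz Z) = Z \<and> is3 (cz Z)" "card Z = 5 \<Longrightarrow> zs (cz Z) = Z \<and> cz Z = HA"
proof -
  have c: "card Z = of_bool (0 \<in> Z) + of_bool (1 \<in> Z) + of_bool (2 \<in> Z) + of_bool (3 \<in> Z) + of_bool (4 \<in> Z)"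
    using sum_5[of "\<lambda>i. of_bool (i \<in> Z) :: nat"] by (simp add: of_bool_def sum.If_cases)
  have eq: "A = Z" if "0 \<in> A \<longleftrightarrow> 0 \<in> Z" "1 \<in> A \<longleftrightarrow> 1 \<in> Z" "2 \<in> A \<longleftrightarrow> 2 \<in> Z" "3 \<in> A \<longleftrightarrow> 3 \<in> Z" "4 \<in> A \<longleftrightarrow> 4 \<in> Z" for A
  proof (rule Set.set_eqI)
    fix i show "i \<in> A \<longleftrightarrow> i \<in> Z" using exhaust_5[of i] that by (elim disjE) simp_all
  qed
  show "card Z = 3 \<Longrightarrow> zs (cz Z) = Z \<and> is3 (cz Z)"
    unfolding c by (cases "0 \<in> Z"; cases "1 \<in> Z"; cases "2 \<in> Z"; cases "3 \<in> Z"; cases "4 \<in> Z";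
      simp add: cz_def; rule eq; simp)
  show "card Z = 5 \<Longrightarrow> zs (cz Z) = Z \<and> cz Z = HA"
  proof -
    assume "card Z = 5"
    then have "Z = UNIV" by (intro card_subset_eq) auto
    then show ?thesis by (simp add: cz_def)
  qed
qed

lemma rot_5: "(rot ^^ 5) x = x"
proof -
  obtain z a b c d e where "x = (z, a, b, c, d, e)" by (cases x) auto
  then show ?thesis by (cases z) (simp_all add: eval_nat_numeral)
qed

lemma R5_pow_trm: "(R5 ^^ n) (trm x) = trm ((rot ^^ n) x)"
  by (induction n) (simp_all del: rot.simps add: R5_trm)

lemma valid_rot: "valid (rot x) = valid x"
proof -
  obtain z a b c d e where "x = (z, a, b, c, d, e)" by (cases x) auto
  then show ?thesis by (cases z) (auto simp: valid_def)
qed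

lemma valid_rot_pow: "valid ((rot ^^ n) x) = valid x"
  by (induction n) (simp_all add: valid_rot del: rot.simps)

text \<open>Rotation doubles every weight coefficient except the last, which becomes 1 in place of
  32; the defect is 31 times the exponent of \<open>var 4\<close>.\<close>

lemma mono_weight_rot: "mono_weight (ex (rot x)) mod 31 = 2 * mono_weight (ex x) mod 31"
proof -
  have l: "Poly_Mapping.lookup (ex (rot x)) i = Poly_Mapping.lookup (ex x) (i - 1)" for i
  proof -
    have "mon (ex (rot x)) = R5 (mon (ex x))" using R5_trm[of x] by (simp only: trm_ex)
    also have "\<dots> = (\<Prod>j\<in>UNIV. var (j + 1) ^ Poly_Mapping.lookup (ex x) j)" by (simp add: R5_def subst_mon)
    also have "\<dots> = (\<Prod>j\<in>UNIV. var j ^ Poly_Mapping.lookup (ex x) (j - 1))"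
      by (rule prod.reindex_bij_witness[of _ "\<lambda>j. j - 1" "\<lambda>j. j + 1"]) auto
    also have "\<dots> = mon (Abs_poly_mapping (\<lambda>j. Poly_Mapping.lookup (ex x) (j - 1)))"
      by (subst mon_eq_prod) simp
    finally have "ex (rot x) = Abs_poly_mapping (\<lambda>j. Poly_Mapping.lookup (ex x) (j - 1))"
      by (metis keys_single singleton_inject zero_neq_one)
    then show ?thesis by simp
  qed
  have "2 * mono_weight (ex x) = mono_weight (ex (rot x)) + 31 * Poly_Mapping.lookup (ex x) 4"
    unfolding mono_weight_def l sum_5 wcoef_simps minus_1_5 by simp
  then show ?thesis by simp
qed

lemma mono_weight_rot_pow: "mono_weight (ex ((rot ^^ n) x)) mod 31 = 2 ^ n * mono_weight (ex x) mod 31"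
proof (induction n)
  case (Suc n)
  have "mono_weight (ex ((rot ^^ Suc n) x)) mod 31 = 2 * (mono_weight (ex ((rot ^^ n) x)) mod 31) mod 31"
    using mono_weight_rot[of "(rot ^^ n) x"] by (simp add: mod_mult_right_eq del: rot.simps)
  then show ?case unfolding Suc by (simp add: mod_mult_right_eq mult.assoc)
qed simp

text \<open>Doubling modulo 31 has the fixed point 0 and six orbits of length five. Rotation doubles
  weights, so basis monomials have to be listed for these seven representatives only.\<close>

definition wreps :: "nat list" where "wreps = [0, 1, 3, 5, 7, 11, 15]"

definition orbit_pos :: "(nat \<times> nat) list"
  where "orbit_pos = [(0, 0), (0, 1), (1, 1), (0, 2), (2, 1), (0, 3), (1, 2), (0, 4), (3, 1), (3, 3), (1, 3), (0, 5), (2, 2), (2, 5), (1, 4), (0, 6), (4, 1), (4, 2), (4, 3), (4, 4), (2, 3), (4, 5), (1, 5), (4, 6), (3, 2), (3, 4), (3, 5), (3, 6), (2, 4), (2, 6), (1, 6)]"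

lemma orbit_pos_correct:
  assumes "w < 31"
  shows "fst (orbit_pos ! w) < 5 \<and> snd (orbit_pos ! w) < 7 \<and> 2 ^ fst (orbit_pos ! w) * wreps ! snd (orbit_pos ! w) mod 31 = w"
proof -
  have l: "length orbit_pos = 31" by (simp add: orbit_pos_def)
  have "list_all (\<lambda>x. fst x < 5 \<and> snd x < 7) orbit_pos" by (simp add: orbit_pos_def)
  then have "fst (orbit_pos ! w) < 5 \<and> snd (orbit_pos ! w) < 7"
    using assms l by (simp add: list_all_length)
  moreover have "map (\<lambda>x. 2 ^ fst x * wreps ! snd x mod 31) orbit_pos = [0..<31]"
    by code_simp
  then have "map (\<lambda>x. 2 ^ fst x * wreps ! snd x mod 31) orbit_pos ! w = [0..<31] ! w" by (simp only:)
  then have "2 ^ fst (orbit_pos ! w) * wreps ! snd (orbit_pos ! w) mod 31 = w"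
    using assms l by (simp add: nth_map)
  ultimately show ?thesis by simp
qed

text \<open>The weight 0 is fixed by doubling, hence its class is listed with rotation count 0
  alone.\<close>

lemma orbit_pos_surj:
  assumes "k < 5" "c < 7"
  shows "\<exists>w<31. orbit_pos ! w = (if c = 0 then 0 else k, c)"
proof -
  have "k = 0 \<or> k = 1 \<or> k = 2 \<or> k = 3 \<or> k = 4"
    "c = 0 \<or> c = 1 \<or> c = 2 \<or> c = 3 \<or> c = 4 \<or> c = 5 \<or> c = 6"
    using assms by linarith+
  then have "(if c = 0 then 0 else k, c) \<in> set orbit_pos"
    by (elim disjE) (simp_all add: orbit_pos_def)
  moreover have "length orbit_pos = 31" by (simp add: orbit_pos_def)
  ultimately show ?thesis by (simp only: in_set_conv_nth)
qed

text \<open>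
  \<open>F z t\<close> packs the values of the eight functionals at the monomial \<open>z y\<^sup>2\<close> into two hexadecimal digits,
  \<open>basis_list c\<close> lists the basis monomials of weight \<open>wreps ! c\<close>, and \<open>cert_entry z t\<close> is the reduction of
  the monomial modulo hit polynomials.
\<close>

locale certificate =
  fixes F :: "hx \<Rightarrow> tup \<Rightarrow> hx \<times> hx" and cert_entry :: "hx \<Rightarrow> tup \<Rightarrow> hx list" and basis_list :: "nat \<Rightarrow> (hx \<times> tup) list"
  assumes F1: "\<And>z a y. is3 z \<Longrightarrow> 0 < a \<Longrightarrow> tup_deg y + a = 11 \<Longrightarrow> xsum F (r1 z a y) = (H0, H0)"
    and F2: "\<And>k g. ispos k \<Longrightarrow> tup_deg g = 10 \<Longrightarrow> xsum F (r2 k g) = (H0, H0)"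
    and F3: "\<And>a y. 0 < a \<Longrightarrow> tup_deg y + a = 10 \<Longrightarrow> xsum F (r3 a y) = (H0, H0)"
    and E1: "\<And>x. valid x \<Longrightarrow> \<exists>n z t. (rot ^^ n) x = (z, t) \<and> z \<in> {H0, H1, HA} \<and> cert_entry z t = cert_entry (fst x) (snd x)"
    and E2: "\<And>z t. z \<in> {H0, H1, HA} \<Longrightarrow> valid (z, t) \<Longrightarrow> certified cert_entry basis_list z t (cert_entry z t)"
    and B1: "\<And>c. c < 7 \<Longrightarrow> length (basis_list c) = 40" "\<And>c. 7 \<le> c \<Longrightarrow> basis_list c = []"
    and B2: "\<And>c p. c < 7 \<Longrightarrow> p < 40 \<Longrightarrow> valid (basis_list c ! p)" 
    and B3: "\<And>c p. c < 7 \<Longrightarrow> p < 40 \<Longrightarrow> mono_weight (ex (basis_list c ! p)) mod 31 = wreps ! c"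
    and B4: "\<And>c p n r. c < 7 \<Longrightarrow> p < 40 \<Longrightarrow> n < 5 \<Longrightarrow> r < 8 \<Longrightarrow>
      hex_comp r (case (rot ^^ n) (basis_list c ! p) of (z, t) \<Rightarrow> F z t) = of_bool (p = 8 * n + r)"
    and B5: "\<And>b. b \<in> set (basis_list 0) \<Longrightarrow> rot b \<in> set (basis_list 0)"
begin

section \<open>Eight functionals that vanish on hit polynomials\<close>

definition phi :: "nat \<Rightarrow> (5 \<Rightarrow>\<^sub>0 nat) \<Rightarrow> K"
  where "phi r m = (let Z = {i. odd (Poly_Mapping.lookup m i)} in
    if card Z = 3 \<or> card Z = 5
    then hex_comp r (F (cz Z) (tup (Abs_poly_mapping (\<lambda>i. Poly_Mapping.lookup m i div 2)))) else 0)"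

lemma phi_ex: "is3 z \<or> z = HA \<Longrightarrow> phi r (ex (z, t)) = hex_comp r (F z t)"
proof -
  assume z: "is3 z \<or> z = HA"
  have "{i. odd (Poly_Mapping.lookup (ex (z, t)) i)} = zs z" by (simp add: ex_def)
  moreover have "Abs_poly_mapping (\<lambda>i. Poly_Mapping.lookup (ex (z, t)) i div 2) = ym t"
    by (rule poly_mapping_eqI) (simp add: ex_def lookup_add lookup_ind)
  moreover have "card (zs z) = 3 \<or> card (zs z) = 5" using z by (auto simp: is3_iff)
  ultimately show ?thesis using z by (simp add: phi_def cz_zs)
qed

lemma fext_psum:
  assumes "r < 8" "\<forall>x\<in>set l. is3 (fst x) \<or> fst x = HA"
  shows "fext (phi r) (psum l) = hex_comp r (xsum F l)"
  using assms(2)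
proof (induction l)
  case (Cons x l)
  obtain z t where x: "x = (z, t)" by (cases x)
  have "fext (phi r) (trm x) = hex_comp r (F z t)"
    unfolding trm_ex using phi_ex[of z r t] Cons.prems by (simp add: x)
  then show ?case using Cons assms(1) by (simp add: x fext_add hex_comp_xor_pair)
qed (simp add: assms)

text \<open>\<open>F1\<close>, \<open>F2\<close> and \<open>F3\<close> are the checks for three,
  four and five odd exponents; \<open>cz\<close> and \<open>tup\<close> translate arbitrary sets and
  exponent vectors into their codes.\<close>

lemma phi_vanishes:
  assumes r: "r < 8" and x: "x \<in> htw tw 25"
  shows "fext (phi r) x = 0"
proof (rule functional_vanishes[OF _ _ _ _ x])
  fix m :: "5 \<Rightarrow>\<^sub>0 nat" assume "card {i. odd (Poly_Mapping.lookup m i)} < 3"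
  then show "phi r m = 0" by (simp add: phi_def)
next
  fix z :: "5 set" and y :: "5 \<Rightarrow>\<^sub>0 nat" assume z: "card z = 3" and y: "mono_deg y < 11"
  let ?a = "11 - tup_deg (tup y)"
  have d: "tup_deg (tup y) = mono_deg y" using mono_deg_ym[of "tup y"] by simp
  have "sqz z (hc 11 (Stot tw (mon y))) = psum (r1 (cz z) ?a (tup y))"
    using zs_cz(1)[OF z] y d by (simp add: r1_psum)
  moreover have "fext (phi r) (psum (r1 (cz z) ?a (tup y))) = hex_comp r (xsum F (r1 (cz z) ?a (tup y)))"
    using zs_cz(1)[OF z] by (intro fext_psum r) (auto simp: r1_def)
  ultimately show "fext (phi r) (sqz z (hc 11 (Stot tw (mon y)))) = 0"
    using F1[of "cz z" ?a "tup y"] zs_cz(1)[OF z] y d r by simp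
next
  fix z :: "5 set" and g :: "5 \<Rightarrow>\<^sub>0 nat" assume z: "card z = 4" and g: "mono_deg g = 10"
  have d: "tup_deg (tup g) = 10" using mono_deg_ym[of "tup g"] g by simp
  have "card (- z) = 1" using z by (simp add: Compl_eq_Diff_UNIV card_Diff_subset)
  then obtain i where "- z = {i}" using card_1_singletonE by blast
  then have zi: "z = - {i}" by blast
  obtain k where k: "ispos k" "pos k = i"
    using exhaust_5[of i] by (elim disjE) (use pos.simps ispos.simps in metis)+
  have "(\<Sum>i\<in>z. fext (phi r) (sqz (z - {i}) (var (i - 1) * mon g))) = fext (phi r) (psum (r2 k (tup g)))"
    using k(1) unfolding ispos_iff by (simp add: r2_psum zi k(2) fext_sum)
  also have "\<dots> = hex_comp r (xsum F (r2 k (tup g)))"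
    using valid_r2[OF d, of k] by (intro fext_psum r) (auto simp: valid_def)
  finally show "(\<Sum>i\<in>z. fext (phi r) (sqz (z - {i}) (var (i - 1) * mon g))) = 0"
    using F2[OF k(1) d] r by simp
next
  fix y :: "5 \<Rightarrow>\<^sub>0 nat" assume y: "mono_deg y < 10"
  let ?a = "10 - tup_deg (tup y)"
  have d: "tup_deg (tup y) = mono_deg y" using mono_deg_ym[of "tup y"] by simp
  have a: "0 < ?a" "tup_deg (tup y) + ?a = 10" using y d by auto
  have "fext (phi r) (psum (r3 ?a (tup y))) = hex_comp r (xsum F (r3 ?a (tup y)))"
    using valid_r3[OF a(2)] by (intro fext_psum r) (auto simp: valid_def)
  then show "fext (phi r) (sqz UNIV (hc 10 (Stot tw (mon y)))) +
      (\<Sum>A | card A = 2. fext (phi r) (sqz (UNIV - A) (tvars A * hc 9 (Stot tw (mon y))))) = 0"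
    using F3[OF a] r a(2) by (simp add: r3_psum[OF a(1)] fext_add fext_sum)
qed

section \<open>Dual families of 1240 monomials and functionals\<close>

definition el :: "nat \<times> nat \<Rightarrow> hx \<times> tup"
  where "el i = (rot ^^ fst (orbit_pos ! fst i)) (basis_list (snd (orbit_pos ! fst i)) ! snd i)"

abbreviation idx :: "(nat \<times> nat) set" where "idx \<equiv> {..<31} \<times> {..<40}"

definition bas :: "(5, K) mpol set" where "bas = (\<lambda>i. trm (el i)) ` idx"

lemma valid_el: "i \<in> idx \<Longrightarrow> valid (el i)"
  using orbit_pos_correct[of "fst i"] by (auto simp: el_def valid_rot_pow B2)

text \<open>\<open>el\<close> rotates a listed monomial k times, which multiplies the weight of its
  representative by 2^k; \<open>orbit_pos\<close> is made so that the result is the first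
  index.\<close>

lemma mono_weight_el: "i \<in> idx \<Longrightarrow> mono_weight (ex (el i)) mod 31 = fst i"
proof -
  assume i: "i \<in> idx"
  let ?k = "fst (orbit_pos ! fst i)" and ?c = "snd (orbit_pos ! fst i)"
  have kc: "?c < 7" "2 ^ ?k * wreps ! ?c mod 31 = fst i" using orbit_pos_correct[of "fst i"] i by auto
  have "mono_weight (ex (el i)) mod 31 = 2 ^ ?k * (mono_weight (ex (basis_list ?c ! snd i)) mod 31) mod 31"
    unfolding el_def mono_weight_rot_pow by (simp add: mod_mult_right_eq)
  then show ?thesis using B3[of ?c "snd i"] kc i by auto
qed

text \<open>Project to the weight, undo the k rotations of \<open>el\<close> by 5 - k further ones,
  rotate once more for each full block of eight in the position, and read the component given by the
  remainder. The forty positions are the pairs of five rotations and eight components.\<close>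

definition dual :: "nat \<times> nat \<Rightarrow> (5, K) mpol \<Rightarrow> K"
  where "dual i f = fext (phi (snd i mod 8)) ((R5 ^^ (snd i div 8 + (5 - fst (orbit_pos ! fst i)))) (prw (fst i) f))"

lemma dual_linear: "dual i (f + g) = dual i f + dual i g" "dual i (smul c f) = c * dual i f" "dual i 0 = 0"
proof -
  have R: "(R5 ^^ n) (f + g) = (R5 ^^ n) f + (R5 ^^ n) g" "(R5 ^^ n) (smul c f) = smul c ((R5 ^^ n) f)" "(R5 ^^ n) 0 = 0" for n f g c
    by (induction n) (simp_all add: R5_linear)
  show "dual i (f + g) = dual i f + dual i g" "dual i (smul c f) = c * dual i f" "dual i 0 = 0"
    by (simp_all add: dual_def prw_def lext_add lext_smul R fext_add fext_smul)
qed

lemma dual_htw: "f \<in> htw tw 25 \<Longrightarrow> dual i f = 0"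
proof -
  assume f: "f \<in> htw tw 25"
  have "(R5 ^^ n) (prw w f) \<in> htw tw 25" for n w
    by (induction n) (simp_all add: prw_htw f R5_htw)
  then show ?thesis unfolding dual_def by (intro phi_vanishes) simp_all
qed

text \<open>The projection separates different weights. Within one weight the rotations cancel
  modulo 5, and \<open>B4\<close> says that the matrix of size 40 is the identity.\<close>

lemma dual_el:
  assumes i: "i \<in> idx" and j: "j \<in> idx"
  shows "dual i (trm (el j)) = of_bool (i = j)"
proof (cases "fst i = fst j")
  case False
  then have "prw (fst i) (trm (el j)) = 0"
    using mono_weight_el[OF j] by (simp add: trm_ex prw_def)
  moreover have "(R5 ^^ n) 0 = 0" for n by (induction n) (simp_all add: R5_linear)
  ultimately show ?thesis using False by (auto simp: dual_def)
next
  case True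
  let ?k = "fst (orbit_pos ! fst i)" and ?c = "snd (orbit_pos ! fst i)" and ?n = "snd i div 8" and ?r = "snd i mod 8"
  have kc: "?k < 5" "?c < 7" using orbit_pos_correct[of "fst i"] i by auto
  have n: "?n < 5" "snd j < 40" using i j by auto
  have "prw (fst i) (trm (el j)) = trm (el j)"
    using mono_weight_el[OF j] True by (simp add: trm_ex prw_def)
  then have "dual i (trm (el j)) = fext (phi ?r) (trm ((rot ^^ (?n + (5 - ?k) + ?k)) (basis_list ?c ! snd j)))"
    by (simp only: dual_def R5_pow_trm el_def True funpow_add o_def)
  also have "?n + (5 - ?k) + ?k = ?n + 5" using kc by simp
  also have "(rot ^^ (?n + 5)) (basis_list ?c ! snd j) = (rot ^^ ?n) (basis_list ?c ! snd j)"
    by (simp only: funpow_add o_def rot_5)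
  also obtain z t where zt: "(rot ^^ ?n) (basis_list ?c ! snd j) = (z, t)" by (cases "(rot ^^ ?n) (basis_list ?c ! snd j)")
  also have "fext (phi ?r) (trm (z, t)) = hex_comp ?r (F z t)"
  proof -
    have "valid (z, t)" using B2[OF kc(2) n(2)] valid_rot_pow[of ?n "basis_list ?c ! snd j"] zt by simp
    then show ?thesis unfolding trm_ex using phi_ex[of z ?r t] by (auto simp: valid_def)
  qed
  also have "\<dots> = of_bool (snd j = 8 * ?n + ?r)"
    using B4[OF kc(2) n(2) n(1), of ?r] zt by simp
  also have "\<dots> = of_bool (i = j)" using True by (auto simp: prod_eq_iff)
  finally show ?thesis .
qed

lemma inj_el: "inj_on (\<lambda>i. trm (el i)) idx"
proof (rule inj_onI)
  fix i j assume "i \<in> idx" "j \<in> idx" "trm (el i) = trm (el j)"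
  then show "i = j" using dual_el[of i i] dual_el[of i j] by (auto split: if_splits)
qed

lemma card_bas: "card bas = 1240"
  unfolding bas_def card_image[OF inj_el] by (simp add: card_cartesian_product)

lemma bas_independent:
  assumes c: "(\<Sum>b\<in>bas. smul (c b) b) \<in> htw tw 25"
  shows "\<forall>b\<in>bas. c b = 0"
proof
  fix b assume "b \<in> bas"
  then obtain i where i: "i \<in> idx" "b = trm (el i)" by (auto simp: bas_def)
  have d: "dual i (sum h A) = (\<Sum>x\<in>A. dual i (h x))" for h and A :: "(nat \<times> nat) set"
    by (induction A rule: infinite_finite_induct) (simp_all add: dual_linear)
  have "(\<Sum>b\<in>bas. smul (c b) b) = (\<Sum>j\<in>idx. smul (c (trm (el j))) (trm (el j)))"
    unfolding bas_def by (subst sum.reindex[OF inj_el]) simp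
  then have "dual i (\<Sum>b\<in>bas. smul (c b) b) = (\<Sum>j\<in>idx. c (trm (el j)) * of_bool (i = j))"
    unfolding d[symmetric] by (simp only: d dual_linear) (intro sum.cong, simp_all add: dual_el i(1) del: mult_eq_0_iff)
  also have "\<dots> = c b" using i by (simp add: of_bool_def sum.delta' if_distrib cong: if_cong)
  finally show "c b = 0" using dual_htw[OF c, of i] by simp
qed

section \<open>Spanning modulo hit polynomials\<close>

abbreviation Sp :: "(5, K) mpol set" where "Sp \<equiv> MP.span (bas \<union> htw tw 25)"

text \<open>For a nonzero weight, rotation leads to the other weights of the orbit, whose monomials
  are defined as rotations. Weight 0 is fixed, so its list must itself be closed under rotation,
  which is \<open>B5\<close>.\<close>

lemma rot_basis_list: "c < 7 \<Longrightarrow> b \<in> set (basis_list c) \<Longrightarrow> trm ((rot ^^ n) b) \<in> bas"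
proof -
  assume c: "c < 7" and b: "b \<in> set (basis_list c)"
  have m: "(rot ^^ n) b = (rot ^^ (n mod 5)) b" for b
  proof -
    have f: "(rot ^^ (5 * q)) x = x" for q x
      by (induction q arbitrary: x) (simp_all only: mult_0_right funpow_0 mult_Suc_right funpow_add o_def rot_5)
    have "(rot ^^ n) b = (rot ^^ (5 * (n div 5) + n mod 5)) b" by simp
    then show ?thesis by (simp only: funpow_add o_def f)
  qed
  obtain w where w: "w < 31" "orbit_pos ! w = (if c = 0 then 0 else n mod 5, c)"
    using orbit_pos_surj[of "n mod 5" c] c by auto
  define b' where "b' = (if c = 0 then (rot ^^ n) b else b)"
  have "(rot ^^ n) b \<in> set (basis_list 0)" if "c = 0"
    using b that by (induction n) (simp_all add: B5 del: rot.simps)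
  then have "b' \<in> set (basis_list c)" using b by (simp add: b'_def)
  then obtain p where p: "p < 40" "b' = basis_list c ! p" using B1(1)[OF c] by (metis in_set_conv_nth)
  have "el (w, p) = (rot ^^ n) b"
    using w(2) p(2) by (auto simp: el_def b'_def m[of b] split: if_splits)
  then show ?thesis using w(1) p(1) unfolding bas_def by (intro image_eqI[of _ _ "(w, p)"]) auto
qed

lemma R5_Sp: "f \<in> Sp \<Longrightarrow> R5 f \<in> Sp"
proof (rule MP_additive_span[OF R5_linear(1,2)])
  fix x assume x: "x \<in> bas \<union> htw tw 25"
  show "R5 x \<in> Sp"
  proof (cases "x \<in> bas")
    case True
    then obtain i where i: "i \<in> idx" "x = trm (el i)" by (auto simp: bas_def)
    have "snd (orbit_pos ! fst i) < 7" "snd i < length (basis_list (snd (orbit_pos ! fst i)))"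
      using orbit_pos_correct[of "fst i"] i(1) B1(1)[of "snd (orbit_pos ! fst i)"] by auto
    from rot_basis_list[OF this(1) nth_mem[OF this(2)], of "Suc (fst (orbit_pos ! fst i))"]
    have "R5 x \<in> bas" by (simp add: i(2) R5_trm el_def del: rot.simps)
    then show ?thesis by (intro MP.span_base) simp
  next
    case False
    then show ?thesis using x R5_htw by (intro MP.span_base) auto
  qed
qed

lemma R5_pow_Sp: "f \<in> Sp \<Longrightarrow> (R5 ^^ n) f \<in> Sp"
  by (induction n) (simp_all add: R5_Sp)

text \<open>List numbers beyond the seven classes yield an empty list, so a successful lookup always
  finds a rotated basis monomial.\<close>

lemma basis_member_Sp: "basis_member basis_list l x \<Longrightarrow> trm x \<in> Sp"
proof -
  assume b: "basis_member basis_list l x"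
  have n: "nth_opt l n = Some y \<Longrightarrow> y \<in> set l" for l n and y :: "hx \<times> tup"
    by (induction l n rule: nth_opt.induct) auto
  have r: "rot_opt k m = Some x \<Longrightarrow> m = Some (the m) \<and> x = (rot ^^ k) (the m)" for k m x
    by (induction k m rule: rot_opt.induct) (simp_all only: rot_opt.simps option.sel funpow_0 funpow_Suc_right o_def option.inject option.distinct)
  obtain k c p q l' where l: "rot_opt (hex_nat k) (nth_opt (basis_list (hex_nat c)) (ad (hex_nat16 q) (hex_nat p))) = Some x"
    using basis_member.elims(2)[OF b] by metis
  then obtain y where y: "nth_opt (basis_list (hex_nat c)) (ad (hex_nat16 q) (hex_nat p)) = Some y" "x = (rot ^^ hex_nat k) y"
    using r by blast
  have y': "y \<in> set (basis_list (hex_nat c))" using n[OF y(1)] .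
  then have "hex_nat c < 7" using B1(2)[of "hex_nat c"] by (cases "hex_nat c < 7") auto
  from rot_basis_list[OF this y'] show ?thesis unfolding y(2) by (intro MP.span_base) simp
qed

lemma htw_Sp: "htw tw 25 \<subseteq> Sp"
  by (auto intro: MP.span_base)

text \<open>Induction on the rank: an entry expresses its monomial by hit polynomials and monomials
  of lower rank. A monomial with another set of odd exponents is rotated to one of the three
  certified sets, with the same entry and hence the same rank, and rotated back at the end.\<close>

lemma trm_Sp: "valid x \<Longrightarrow> trm x \<in> Sp"
proof (induction "rank_of (cert_entry (fst x) (snd x))" arbitrary: x rule: less_induct)
  case less
  obtain n z t where z: "(rot ^^ n) x = (z, t)" "z \<in> {H0, H1, HA}" "cert_entry z t = cert_entry (fst x) (snd x)"
    using E1[OF less.prems] by blast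
  have v: "valid (z, t)" using valid_rot_pow[of n x] less.prems z(1) by simp
  have low: "trm (z', t') \<in> Sp" if "valid (z', t')" "rank_of (cert_entry z' t') < rank_of (cert_entry z t)" for z' t'
    using less.hyps[of "(z', t')"] that z(3) by simp
  have "trm (z, t) \<in> Sp"
  proof (cases "(cert_entry, basis_list, z, t, cert_entry z t)" rule: certified.cases)
    case (1 e B z' t')
    then have e: "is3 z" "odd1 t" using E2[OF z(2) v] by auto
    then have "(mon (ym t) :: (5, K) mpol) \<in> htw tw 11"
      using v odd1_correct[OF e(2)] by (intro hit_one_odd_11) (auto simp: valid_def)
    then have "trm (z, t) \<in> htw tw 25"
      using hit_three_odd[of "zs z" "mon (ym t)"] e(1) by (simp add: is3_iff)
    then show ?thesis using htw_Sp by blast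
  next
    case (2 e B z' t' y)
    then show ?thesis using E2[OF z(2) v] by auto
  next
    case (3 e B z' t' lo hi l)
    then have o: "certified_rank cert_entry basis_list (rank_of (cert_entry z t)) z t l" using E2[OF z(2) v] by auto
    show ?thesis
    proof (cases "rank_of (cert_entry z t)")
      case 0
      then show ?thesis using o basis_member_Sp[of l "(z, t)"] by simp
    next
      case (Suc r)
      then have "rel cert_entry (rank_of (cert_entry z t)) [] l = Some [(z, t)]" using o by simp
      from rel_correct(1)[OF MP.subspace_span htw_Sp low this]
      show ?thesis by simp
    qed
  qed
  \<comment> \<open>Another 4n rotations make 5n in all, which is the identity.\<close>
  then have "(R5 ^^ (4 * n)) (trm (z, t)) \<in> Sp" by (rule R5_pow_Sp)
  moreover have "(R5 ^^ (4 * n)) (trm (z, t)) = trm x"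
  proof -
    have f: "(rot ^^ (5 * q)) y = y" for q y
      by (induction q arbitrary: y) (simp_all only: mult_0_right funpow_0 mult_Suc_right funpow_add o_def rot_5)
    have "(rot ^^ (4 * n)) (z, t) = (rot ^^ (4 * n + n)) x" by (simp only: funpow_add o_def z(1))
    also have "4 * n + n = 5 * n" by simp
    finally show ?thesis by (simp only: R5_pow_trm f)
  qed
  ultimately show ?case by (simp only:)
qed

lemma hom_Sp: "hom 25 \<subseteq> Sp"
  unfolding hom_span
proof (rule MP.span_minimal)
  show "mon ` {m. mono_deg m = 25} \<subseteq> Sp"
  proof (rule image_subsetI)
    fix m :: "5 \<Rightarrow>\<^sub>0 nat" assume "m \<in> {m. mono_deg m = 25}"
    then have m: "mono_deg m = 25" by simp
    obtain z y where zy: "m = ind z + (y + y)" using parity_decomp by blast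
    have deg: "card z + 2 * mono_deg y = 25" using m by (simp add: zy)
    have d: "tup_deg (tup y) = mono_deg y" using mono_deg_ym[of "tup y"] by simp
    have occurs_in: "mon m = sqz z (mon y)" by (simp add: zy sqz_mon)
    have "odd (card z)" using deg by presburger
    moreover have "card z \<le> 5" by (rule card_le_5)
    moreover have "k = 1 \<or> k = 3 \<or> k = 5" if "odd k" "k \<le> 5" for k :: nat using that by presburger
    ultimately consider "card z = 1" | "card z = 3" | "card z = 5" by blast
    then show "mon m \<in> Sp"
    proof cases
      case 1
      then have "mono_deg y = 12" using deg by simp
      then have "sqz z (mon y) \<in> htw tw 25" using hit_one_odd[OF 1, of "mon y"] by simp
      then show ?thesis unfolding occurs_in using htw_Sp by blast
    next
      case 2
      then have "valid (cz z, tup y)" using zs_cz(1)[OF 2] deg d by (simp add: valid_def)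
      moreover have "trm (cz z, tup y) = sqz z (mon y)"
        by (simp only: fst_conv snd_conv ym_tup zs_cz(1)[OF 2, THEN conjunct1])
      ultimately show ?thesis unfolding occurs_in using trm_Sp by metis
    next
      case 3
      then have "valid (cz z, tup y)" using zs_cz(2)[OF 3] deg d by (simp add: valid_def)
      moreover have "trm (cz z, tup y) = sqz z (mon y)"
        by (simp only: fst_conv snd_conv ym_tup zs_cz(2)[OF 3, THEN conjunct1])
      ultimately show ?thesis unfolding occurs_in using trm_Sp by metis
    qed
  qed
qed simp

theorem qbas_25: "qbas tw 25 bas"
proof -
  have "(mon (ex x) :: (5, K) mpol) \<in> hom 25" if "valid x" for x
    using that by (intro hom_mon) (auto simp: ex_def valid_def is3_iff simp del: tup_deg.simps)
  then have "bas \<subseteq> hom 25"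
    using valid_el unfolding bas_def trm_ex by blast
  moreover have "finite bas" by (simp add: bas_def)
  ultimately show ?thesis
    using hom_Sp bas_independent by (simp add: qbas_def)
qed

end

section \<open>Tables\<close>

text \<open>Tables are stored as numerals whose hexadecimal digits, lowest first, form the entry.\<close>

fun dbits :: "nat \<Rightarrow> bool list"
  where "dbits n = (if n = 0 then [] else odd n # dbits (n div 2))"

declare dbits.simps [simp del]

lemma dbits_rules: "dbits 0 = []" "dbits 1 = [True]" "dbits (numeral Num.One) = [True]"
  "dbits (numeral (Num.Bit0 k)) = False # dbits (numeral k)"
  "dbits (numeral (Num.Bit1 k)) = True # dbits (numeral k)"
  by (subst dbits.simps, simp add: dbits.simps[of 0])+

text \<open>Inverts \<open>hbits\<close> on blocks of four bits, lowest first, padding the last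
  block with zeros. With the choice operator a single uniqueness lemma yields all the rewrite
  rules.\<close>

fun grp :: "bool list \<Rightarrow> hx list" where
  "grp (a # b # c # d # l) = (SOME h. hbits h = [a, b, c, d]) # grp l"
| "grp [] = []"
| "grp [a] = [SOME h. hbits h = [a, False, False, False]]"
| "grp [a, b] = [SOME h. hbits h = [a, b, False, False]]"
| "grp [a, b, c] = [SOME h. hbits h = [a, b, c, False]]"

lemma hbits_inj: "(SOME h. hbits h = [a, b, c, d]) = x" if "hbits x = [a, b, c, d]"
proof (rule some_equality)
  show "h = x" if "hbits h = [a, b, c, d]" for h
    using that \<open>hbits x = _\<close> by (cases h; cases x) simp_all
qed (rule that)

lemma grp_rules: "grp [] = []"
  "grp (False # False # False # False # l) = H0 # grp l"
  "grp (True # False # False # False # l) = H1 # grp l"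
  "grp (False # True # False # False # l) = H2 # grp l"
  "grp (True # True # False # False # l) = H3 # grp l"
  "grp (False # False # True # False # l) = H4 # grp l"
  "grp (True # False # True # False # l) = H5 # grp l"
  "grp (False # True # True # False # l) = H6 # grp l"
  "grp (True # True # True # False # l) = H7 # grp l"
  "grp (False # False # False # True # l) = H8 # grp l"
  "grp (True # False # False # True # l) = H9 # grp l"
  "grp (False # True # False # True # l) = HA # grp l"
  "grp (True # True # False # True # l) = HB # grp l"
  "grp (False # False # True # True # l) = HC # grp l"
  "grp (True # False # True # True # l) = HD # grp l"
  "grp (False # True # True # True # l) = HE # grp l"
  "grp (True # True # True # True # l) = HF # grp l"
  "grp [True] = [H1]"
  "grp [False, True] = [H2]"
  "grp [True, True] = [H3]"
  "grp [False, False, True] = [H4]"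
  "grp [True, False, True] = [H5]"
  "grp [False, True, True] = [H6]"
  "grp [True, True, True] = [H7]"
  by (simp_all add: hbits_inj[of H0] hbits_inj[of H1] hbits_inj[of H2] hbits_inj[of H3] hbits_inj[of H4]
    hbits_inj[of H5] hbits_inj[of H6] hbits_inj[of H7] hbits_inj[of H8] hbits_inj[of H9] hbits_inj[of HA]
    hbits_inj[of HB] hbits_inj[of HC] hbits_inj[of HD] hbits_inj[of HE] hbits_inj[of HF])

definition dec :: "nat \<Rightarrow> hx list"
  where "dec n = grp (dbits n)"

abbreviation dtable :: "nat list list list list \<Rightarrow> hx list list list list list"
  where "dtable \<equiv> map (map (map (map dec)))"

abbreviation look :: "'a list list list list \<Rightarrow> nat \<Rightarrow> nat \<Rightarrow> nat \<Rightarrow> nat \<Rightarrow> 'a"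
  where "look t a b c d \<equiv> t ! a ! b ! c ! d"

text \<open>Unfolding the agreement of a function with a concrete table gives one equation per
  entry. The simplifier then finds an entry by matching the indices and need not walk through nested
  lists.\<close>

fun agree4 :: "nat \<Rightarrow> nat \<Rightarrow> nat \<Rightarrow> nat \<Rightarrow> (nat \<Rightarrow> nat \<Rightarrow> nat \<Rightarrow> nat \<Rightarrow> 'a) \<Rightarrow> 'a list \<Rightarrow> bool" where
  "agree4 a b c d f [] = True" | "agree4 a b c d f (x # l) = (f a b c d = x \<and> agree4 a b c (Suc d) f l)"

fun agree3 :: "nat \<Rightarrow> nat \<Rightarrow> nat \<Rightarrow> (nat \<Rightarrow> nat \<Rightarrow> nat \<Rightarrow> nat \<Rightarrow> 'a) \<Rightarrow> 'a list list \<Rightarrow> bool" where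
  "agree3 a b c f [] = True" | "agree3 a b c f (x # l) = (agree4 a b c 0 f x \<and> agree3 a b (Suc c) f l)"

fun agree2 :: "nat \<Rightarrow> nat \<Rightarrow> (nat \<Rightarrow> nat \<Rightarrow> nat \<Rightarrow> nat \<Rightarrow> 'a) \<Rightarrow> 'a list list list \<Rightarrow> bool" where
  "agree2 a b f [] = True" | "agree2 a b f (x # l) = (agree3 a b 0 f x \<and> agree2 a (Suc b) f l)"

fun agree1 :: "nat \<Rightarrow> (nat \<Rightarrow> nat \<Rightarrow> nat \<Rightarrow> nat \<Rightarrow> 'a) \<Rightarrow> 'a list list list list \<Rightarrow> bool" where
  "agree1 a f [] = True" | "agree1 a f (x # l) = (agree2 a 0 f x \<and> agree1 (Suc a) f l)"

lemma agree4I: "(\<And>k. k < length l \<Longrightarrow> f a b c (d + k) = l ! k) \<Longrightarrow> agree4 a b c d f l"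
proof (induction l arbitrary: d)
  case (Cons x l)
  show ?case using Cons.prems[of 0] Cons.IH[of "Suc d"] Cons.prems[of "Suc k" for k] by auto
qed simp

lemma agree3I: "(\<And>k m. k < length l \<Longrightarrow> f a b (c + k) m = l ! k ! m) \<Longrightarrow> agree3 a b c f l"
proof (induction l arbitrary: c)
  case (Cons x l)
  show ?case using Cons.prems[of 0] Cons.IH[of "Suc c"] Cons.prems[of "Suc k" for k] by (auto intro!: agree4I)
qed simp

lemma agree2I: "(\<And>k m n. k < length l \<Longrightarrow> f a (b + k) m n = l ! k ! m ! n) \<Longrightarrow> agree2 a b f l"
proof (induction l arbitrary: b)
  case (Cons x l)
  show ?case using Cons.prems[of 0] Cons.IH[of "Suc b"] Cons.prems[of "Suc k" for k] by (auto intro!: agree3I)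
qed simp

lemma agree1I: "(\<And>k m n p. k < length l \<Longrightarrow> f (a + k) m n p = l ! k ! m ! n ! p) \<Longrightarrow> agree1 a f l"
proof (induction l arbitrary: a)
  case (Cons x l)
  show ?case using Cons.prems[of 0] Cons.IH[of "Suc a"] Cons.prems[of "Suc k" for k] by (auto intro!: agree2I)
qed simp

lemmas agree_rules = agree1.simps agree2.simps agree3.simps agree4.simps simp_thms

lemmas dec_rules = list.map dec_def dbits_rules grp_rules

text \<open>
  The functional: for each exponent vector \<open>y\<close> of degree 11 (indexed by its first four entries), two digits
  for each three-element set \<open>z\<close>, giving its eight components at the monomial \<open>z y\<^sup>2\<close>; then the components
  at the monomials with all exponents odd.
\<close>

definition G11_table :: "hx list list list list list"
  where "G11_table = dtable [[[[0,0,0,0,0,0,0,0,0,0,0,0],[0,0,0,8388608,0,0,0,408021895168,0,0,0],[0,0,0,0,0,0,0,0,0,0],[0,0x6a99017d0000020000,0,0xfd00d6442200000003,0,0x6a004800002a00000000,0,0x20002000100000000005,0],[0,0,0,0,0,0,0,0],[0,0,0,0xde0000006d00503a,0,0,0],[0,0,0,0,0,0],[0,0x5d003000000000000004,0,0x68040000000000000000,0],[0,0,0,0],[0,0,0],[0,0],[0]],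
[[0,0,0,0,0,0,0,0x5f000000001c,0,0,0],[0,0,536871168,0,0,0,0xc0000018000001000000,0x30000000000c0000000,0,0],[0,0xe00000002000020000,0,37383397441792,0,0x301880002a0000000000,0,0x32a0000001f00024400,0],[36096,0x20000000000790100,0x60000000000020000,53248,3489660930,0x160000106a3000500000,4503602852855808,0x180309022003000a0000],[0,0,0,0x44000000d000003a00,0,0,0],[0,0,0x610000086d00f0000500,4785076241563648,0,0],[0,0x136000000e000064400,0,0x80010000000200d0,0],[5629503313281024,0x2e0208005d0100060000,0x2000058000002e00043f,0xc5d01fe680020000004],[0,0,0],[0,0],[0]],
[[0,0,0,0,0,0,0,0,0,0],[0,0x440138000000000020,0,0x8000000001000000,0,0xc070000010000000000,0,30786325577728,0],[0,0,0,0,0,0,0,0],[0,8388694,0,0x8000008140701,0,0x8d62004000100,0],[0,0,0,0,0,0],[0,0x40000100000000000,0,0x100000000000000000,0],[0,0,0,0],[0,0x80a002002800040000,0],[0,0],[0]],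
[[0,0x400000000000000ad00,0,0x4500000000000010000,0,0x2000000000090000002,0,5910977733918720,0],[0x1c000000000008d0000,0x60000000040101f800,1099511660544,17193500672,0x60000001009000000008,0x300000000c0260000000,0xd00000c033000000,0x590301180000000000c5],[0,134238208,0,0x77000013001045000400,0,0x18691002200300000000,0],[0x400000800060000,0x8000000000000000004,0x92040b00084527050000,0x1100007792000c18,0x59070020040000000040,0x1010001859690f02],[0,2147483648,0,0x2000018000002e006900,0],[0x1400008084000008,0x20008000000000014,0x2000e004002e20690f00,0x100cc00002020000060],[0,0xca00130282020000000,0],[0x1020200002029000060,0x2a00000c01000032],[0]],
[[0,0,0,0,0,0,0,0],[0,0,0,0x7d001000100000000001,0,0,0],[0,0,0,0,0,0],[0,0x80000b12f0000000018,0,0x2800007d000024001200,0],[0,0,0,0],[0,0,0],[0,0],[0]],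
[[0,0,0,0x21c000000ff00040000,0,0,0],[0,0,0x4000021010000,0x360101027d02000c0000,0,0],[0,0xc000f701001c02,0,0x3100f0030036000000bf,0],[0x26b08100000100040000,0x2000c080026000141,0x8000108240030000007,0x5140012283108007d02],[0,0,0],[0,0],[0]],
[[0,0,0,0,0,0],[0,0xb138d60004001000,0,0x800005002000020800,0],[0,0,0,0],[0,0x20080c003020002f5600,0],[0,0],[0]],
[[0,0x10b10003000300000000,0,0x8000110200230000000,0],[0x59270020040000000009,0x808001059001f03,0x1050c00003031000020,0x205900080100001c],[0,0x4100012203108000002,0],[0x2059000801000104,35201553793074],[0]],
[[0,0,0,0],[0,0,0],[0,0],[0]],
[[0,0,0],[0,0],[0]],
[[0,0],[0]],
[[0]]],
[[[0,0,0,0x800000020000,0,0,0,0x40000000000000000,0,0,0],[0,0,0x50000001000000,0,0,0,0x2c080000004000,0x340000000000040000,0,0],[0,0x79140000020200000000,0,0x20300002002008000,0,0x50000000000000400880,0,0xa000000000241340000,0],[0x100000000008d000003,0x20000006ae000140000,0xd0000000000100800000,0x2a9900fd0006020000,0x240300000000080000,0x80001001800002403,292057778176,0x3000800002a00000000],[0,0,0,0x9a0002000000002dc000,0,0,0],[0,0,0x100000503a05c02000,292057780224,0,0],[0,0x6000000000640200000,0,0xe00ac2000200000001,0],[292057780224,0x2000900003600000000,0xc400000004004000,0x5d003000040000e00006],[0,0,0],[0,0],[0]],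
[[0,0,0,0,0,0,7881419606982668,281474976710656,0,0],[0,0x4454c000030000000000,0xc0000000005000,0x700002000000000e0,0,0x9f2d0c00000000000000,87820193136389148,2199023255553,0],[768,0xc000990000000000,3298534883328,0x994400000000030000,0x30007000002800000,0x2000488000000300,5497558138908,0x9080000200000000000],[1099511627776,0x9800028000000800,0xd60000000000,0x2a256001607b9b504,0x10010000000000000007,0x10000003000011000100,0x2000000000010000000],[0,0,63771674411008,0xde0000020000,0,0],[0,0xc000000030000000000,0x11000060000008000000,0x900a00000200c100011c,0],[4398046511104,0x8098000300000000000,0x406000000d03f0100e0,0x13000000080050ac400],[335544320,6816115785728,0xfe000010000180c20000],[0,0],[0]],
[[0,0x100000000008d000003,0,0xd0000000000100000000,0,0x1003000000000c0000,0,115964116992,0],[0xf800001200ad00008400,0x600000004400c0000000,2147483648,0xc40000005000000000,0x57000000000000,0x180100070000100000,7168,0x3060000000000000000],[0,0x400001800006000000,0,0xe500d7140005c00400,0,0x69004000000000000000,0],[0x800138005000000020,4227072,0xc188100070400040000,72057594120050774,0xf010000010000000000,72058045126934784],[0,0,0,0x1a0000006900103a,0],[0x84000000001800,0x2e60000040000000000,451224274441,0x40000100000000000],[0,4398061191170,0],[0,0x10082780a002000000],[0]],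
[[35184372285440,1099511627776,0,0x800000000000,0x338000208000014,0x10000000000030003,0xc5000008000000000000,0x10000000000d0000000],[61572651160064,0xe000000c0000,0,0x1f77600000800b84700,16799544,0x10400c00000000010000,0x18000003001500000008],[0x4000000560000002000,0x80000004000100,0x18560000010000000005,0x110100a000000b008100,0x2000000000040000000,0x10010000001000400000],[0x8001000000013800,6102,0xa000081300d70000,0x210b002b005112014324,0x10000000080220000000],[0x14000020000008000000,335544320,0x600000080000003a0900,0xcc0000140001e01a0000],[0x800000b000000008420,0x5000c000d0008090b00,0x1400008004000008],[0x32000001000060020000,0x2a089100a00102000000],[0x270008023000000001]],
[[0,0,0,0xc000000000401140000,0,0,0],[0,0,6144,0x1000100001c00000000,0,0],[0,0x184000004650000,0,74309393851875336,0],[0x1008100001c00000000,0x20800030000b0000005,0x7d001000120000000000,0x14000031000000000018],[0,0,0],[0,0],[0]],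
[[0,0,1099511627804,0x1018000100000000000,0,0],[0,0x40100e3000012000000,0x2000000000004000000,0x700100030103b5030800,0],[0x41050000180200000000,2164359424,0x218030000bf07080000,0x8000f001011003],[0xc030010b1c000840000,0x1000202285a000300,0x123180027d0308080000],[0,0],[0]],
[[0,0x8000000000000000,0,2199023255553,0],[0x1fe10000100000000000,0x20000b12700e100,8796093022208,0x1027800005000000],[0,0x1c0000802f0000000000,0],[0xa11f560001001000,0x24000081000000021],[0]],
[[0x3000000000009000001,0x8020000b10000800000,0x1c000001000020010000,0x2010810000010c000000],[0x8000000380320000000,0x30000280a020000,0x59270018051000000001],[0x32218103000204000000,0x4010080c002000a181],[0x808001259801f03]],
[[0,0,0],[0,0],[0]],
[[0,0],[0]],
[[0]]],
[[[0,0,0,0,0,0,0,0,0,0],[0,0x4000000000000002000,0,0x4560000000000030000,0,0x1000000000080000000,0,0x50000005a0000,0],[0,0,0,0,0,0,0,0],[0,134250496,0,0xb0720b5500100,0,0x6a19000000000a0000,0],[0,0,0,0,0,0],[0,0x5000000da0000,0,0x400000000006d3f,0],[0,0,0,0],[0,0xfd00ce402000000004,0],[0,0],[0]],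
[[0,0xc0000000000000000000,0,0xc00000e0000000,0,0x90000000000200,0,0,0],[2214592512,5222680231936,0xc00000e0c0002000,0x80000000040000000000,0xa08080000002105c,0x100000010000000030,939524352,0x6000000000000000500],[0,0xd800984000c000200000,0,0x4000c00020840080001b,0,0x206100003c00000000,0],[0x800480000800000000c0,0xd60000d8800004c0,0x4e030000b50000000040,0xb13000404e000800,0x2000000000000008000,0x64000000002390000],[0,0,0,201326821,0],[402653184,0x6000000000000000500,0x10010000c863ff000,0x4320000000000040100],[0,0x5c00208000600100,0],[0x20000000000050100,0x4000000000000cc00],[0]],
[[0,0,0,0,0,0,0,0],[0,0x400000c00d60000,0,0xa0180b0004b847010000,0,0x40138040000000085,0],[0,0,0,0,0,0],[0,0x5c0000017001012,0,0x110000170000790000bd,0],[0,0,0,0],[0,0x2ce00000009000000,0],[0,0],[0]],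
[[0,0x480000c00000000c0,0,0x4e170000b80000000070,0,0x4000000000000008500,0],[0x10044000000000084,0x8000000000100,78065812111680,0x1b100a04e001c0000,0x400000000000000000,0x3200000000400017800],[0,413759707392,0,0x7e01700048400f800,0],[0x81a0011756010b0000,0x80000400000000541a0,0x2b975900798400450000,18692419584078],[0,0x4300000000000010000,0],[9895789232136,0x91000604000400fe0000],[0]],
[[0,0,0,0,0,0],[0,0x80017d0000080000,0,6759806077501447,0],[0,0,0,0],[0,0x1040000080000007d00,0],[0,0],[0]],
[[0,0xc06100001c00020000,0,0x5c00028000400000,0],[0x2000000000000000d00,0x44000000002400100,0x40000000000070100,0x40000000000001c00],[0,458816,0],[0x2060000000000000c00,0x1000010002000600],[0]],
[[0,0,0,0],[0,280,0],[0,0],[0]],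
[[0,0x2020000000000001000,0],[0x81000202000000080000,0x8000004000281020002],[0]],
[[0,0],[0]],
[[0]]],
[[[0,768,0,3298534883328,0,0x30006000002800000,0,98956046499840,0],[0xc0200000035000,0,536871168,94557999988736,0x200000210002c08,0x10000000000000030004,0x5000010000001000000,0],[0,0x794400002000010000,0,0x2000508000200200,0,0x391080000a0000000000,0],[0x400000080000000ad00,0x20080000004790000,0x8510000010000020002,0x100c0000003005100,2147483650,0x60100106a2000100000],[0,0xda0000020000,0,0x442000000003f013ae0,0],[0x5000040000000000000,0,0x10000006d00f03a0c00,0x32000015000001420000],[0,0x600000060050c8000,0],[0xcc000005000101800000,0x40a9900fd0002060000],[0]],
[[0,0x8d000000000000,0,3221225472,0x3004600000005c000802,0x800000a0000260,0,0x80000000000000],[0x8d0000000000c000,0x984400c000d600000000,824633720832,0x58200700905d1b080040,0x8000009080060000,0x65900000110000000080,0x80c0050000001000],[0xc00000000000c0000000,0xd6006000009880440000,0x40001b40000260,0xb100584000c000200000,4503599627371008,0x4000c000196100800000],[0x800000004000000000,0x49050096102280d1,0x30c040000b0000000040,0x151c80b1d50a205d,0x100000000000000010],[0,0x80000000000000,70252794740760,4398046511104],[0x8000050000004000,0x4e000000900000000080,0x150000000010000000],[4398046511104,0x992500005c00000000],[0xce0000000500]],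
[[0,0xd60000008d00,0,0x1c070000010000020006,0,0x1000000000000000002,0],[0x1c000000000008d0000,0x60800100040100c000,16832292,0x1012000181700070000,0x78000002008500000000,0x20000000040040000000],[0,0x501008000000b00d100,0,0x701001b0000457a0d00,0],[0x4105a400101900d10000,0xb000081010524,0x801c080000f8000d0000,0x580000797011c13],[0,0xfe000015000100180000,0],[2147483648,0x250000023000000015],[0]],
[[826848313344,0x800000048000000000,0x4084007040062400,0xb12040000b0000000040,0x204085000002005c,1099511627808],[0x8010080000044000000,0xd9c0014808a00000,0x54000000000084,0xe02a442001b100200010,61572651156032],[0xa024c000120000000080,0x55000500a000a4c0,0x4e130000bd0000000050,0x5a93000e059000800],[0x400b0018c00001800000,0x40000a001003d002b0c,0x8030011717001b0000],[0x150000000008000000,0x6000000ce0000000000],[0x4000000000000150000]],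
[[0,0x40048000080200000000,0,0x403000040070c0000,0],[0x100000000000d000001,0x401001000c000040000,0x1c000005000001000000,0x4200000000004040000],[0,0x40000700010c01,0],[0x6a080017d000c0c0000,0x42100404000600a0c0],[0]],
[[4503599627370752,0x40000000806100800000,7696581394432,0x6100005c00030000],[0x100000010000000010,0x58000024041001100,26388279067904],[0xc00000004000010000,0x10100000000000008000],[0x40080000000400100]],
[[0,0x2800000000008000000,0],[0x38011000000008,8598323200],[0]],
[[0x2000000180000000800,0x4080000002000000],[0x4008003000002003800]],
[[0]]],
[[[0,0,0,0,0,0,0,0],[0,0,0,0x400000c0000000000,0,0,0],[0,0,0,0,0,0],[0,0xb130002000001100,0,0xa007000800060800,0],[0,0,0,0],[0,0,0],[0,0],[0]],
[[0,0,0,5910975586435072,0,0,0],[0,0,0xc4000040b7000008,0x590101100000000000d1,0,0],[0,0x8d81001200000000000,0,0x4a00020082210000000,0],[0x200000000000000049,0x1818000800691001,0x70e00001018000040,0xa5900040000002e],[0,0,0],[0,0],[0]],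
[[0,0,0,0,0,0],[0,0x407001b70401150000,0,0x28b705007b0000047800,0],[0,0,0,0],[0,26388815937542,0],[0,0],[0]],
[[0,0x5961011004000000003d,0,0x54000001010000040,0],[0x18000010000000000,0x5860005900110090,0x20000000001004001db7,0x89000000280020000000],[0,0xa59000400800160,0],[35184775201024,0x431c0000000000000059],[0]],
[[0,0,0,0],[0,0,0],[0,0],[0]],
[[0,0,0],[0,0],[0]],
[[0,0],[0]],
[[0]]],
[[[0,0,0,115964116992,0,0,0],[0,0,0x84000000000400,0x1e00000040000000000,0,0],[0,0x6900c000000000000000,0,6597084446723,0],[0x10e00000110000000000,0x30000d82000e000,8796093022208,0x10180000a007000000],[0,0,0],[0,0],[0]],
[[0,0,0xd1000028000008000000,0x10000000000c4000000,0,0],[0,0x50442800001d00000000,0x10000008001500008428,0xb7000400010568000b00,0],[0x1000000000049000001,0x18030000b11000c00000,0x2e000000000040030000,0xa181000a0000e000000],[0x18000000300100000000,0x1240005818030019,0x59000010072000000000],[0,0],[0]],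
[[0,0x11000000150000000000,0,0x40000040000000000,0],[0x10000000000000100,0xb0010406101000100,0x78001d000300,0x81e001b70500040000],[0,0x10a930008007001100,0],[0xc19000000101110000,0x1c10004000000010c1a0],[0]],
[[0x90000018003d00000028,0x58000000700180000000,0xc4000040b7000008,0xe001000540000000c4],[0x60100000011000000018,0xa2010009def00002800,0x10000000000000000],[0x59a00110066000000061,0x1818000a00a99001],[0x401860005900300010]],
[[0,0,0],[0,0],[0]],
[[0,0],[0]],
[[0]]],
[[[0,0,0,0,0,0],[0,0x4000000400000000a5,0,0x24e00000008000000,0],[0,0,0,0],[0,8388942,0],[0,0],[0]],
[[0,10240,0,0x600000000000000000,0],[0x18000000000008d0000,0x3400000000001008000,8796277571592,0x910006040000002e0000],[0,0x2020000000008004000,0],[0x810006020008000e0000,0x4000281020006],[0]],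
[[0,0,0,0],[0,0x89000000080038070100,0],[0,0],[0]],
[[0,0x10000006000800200000,0],[0x1000340380061000000,0x18000700891001000005],[0]],
[[0,0],[0]],
[[0]]],
[[[0,2365587457,0,0x2e000015000000180000,0],[0x80000010002800008400,0x40000000400080000000,0,0xe10000026000000015],[0,0x2c0000180000e000000,0],[0x800100014000000028,8602550272],[0]],
[[0x2040a5000001005c,32,0x150000000008000000,0x60000004e0000000000],[4160,0x2100400f01000000,0x4000000000000150000],[0x60000004e0000002800,0x4000000006000100],[0x4000002000002010000]],
[[0,0x210100072000000098,0],[0x8000010000000000,0x404000000000210080],[0]],
[[0x5800000000000980000,0x7400002000003018000],[0x280000640000000]],
[[0]]],
[[[0,0,0,0],[0,0,0],[0,0],[0]],
[[0,0,0],[0,0],[0]],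
[[0,0],[0]],
[[0]]],
[[[0,0,0],[0,0],[0]],
[[0,0],[0]],
[[0]]],
[[[0,0],[0]],
[[0]]],
[[[0]]]]"

definition G11 :: "nat \<Rightarrow> nat \<Rightarrow> nat \<Rightarrow> nat \<Rightarrow> hx list"
  where "G11 = look G11_table"

lemma G11_agree: "agree1 0 G11 G11_table"
  by (rule agree1I) (simp add: G11_def)

lemmas G11_rules = G11_agree[unfolded G11_table_def dec_rules agree_rules]

definition G10_table :: "hx list list list list list"
  where "G10_table = dtable [[[[0,0,0,0,0,0,0,0,0,0,0],[0,0,1,64,0,0,0,0,0,0],[0,192,0,0,0,0,0,0,0],[82,0,32,0,1,0,2,0],[0,0,0,16,0,0,0],[0,0,0,9,0,0],[0,0,0,0,0],[10,3,2,6],[0,0,0],[0,0],[0]],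
[[0,0,0,128,0,0,1,0,0,0],[0,0,1,0,0,0,7,0,0],[0,0,128,0,128,0,0,192],[0,32,0,120,3,34,0],[0,0,28,0,0,0],[0,0,1,128,0],[0,64,4,51],[17,0,144],[0,0],[0]],
[[0,17,0,0,0,1,0,0,0],[3,0,0,0,1,64,0,0],[0,2,0,0,0,0,0],[224,12,64,0,0,0],[0,0,0,0,0],[0,0,32,13],[0,0,0],[0,1],[0]],
[[3,0,4,0,4,147,0,76],[0,0,32,4,64,129,2],[0,0,0,3,93,16],[128,0,128,64,0],[0,17,0,144],[2,0,8],[144,0],[5]],
[[0,0,0,0,0,0,0],[0,0,8,3,0,0],[0,0,0,32,0],[3,1,1,2],[0,0,0],[0,0],[0]],
[[0,0,0,128,0,0],[0,32,17,144,0],[128,8,3,41],[4,0,40],[0,0],[0]],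
[[0,0,0,0,0],[0,0,0,1],[0,0,0],[1,0],[0]],
[[29,0,149,88],[0,32,234],[114,0],[4]],
[[0,0,0],[0,0],[0]],
[[0,0],[0]],
[[0]]],
[[[0,0,0,128,0,0,0,16,0,0],[0,160,5,43,0,0,0,0,0],[128,0,0,192,16,0,0,0],[0,19,30,0,0,0,0],[0,0,185,0,0,0],[0,152,0,0,0],[0,0,16,41],[0,1,10],[0,0],[0]],
[[0,0,0,0,0,0,0,12,0],[34,217,16,0,128,0,28,0],[0,21,128,0,132,34,128],[0,16,0,64,0,8],[0,0,0,0,0],[16,118,16,0],[0,22,0],[0,7],[0]],
[[5,84,1,89,0,45,0,0],[192,170,3,0,71,23,1],[68,0,149,2,0,0],[0,0,247,64,0],[0,0,1,9],[1,3,11],[0,3],[0]],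
[[0,0,2,0,8,0,3],[32,0,0,0,160,0],[68,128,86,32,0],[120,0,0,8],[1,0,1],[0,42],[0]],
[[0,0,0,0,0,0],[0,0,0,0,0],[0,13,3,0],[1,0,2],[0,0],[0]],
[[0,0,128,0,0],[214,9,35,4],[0,0,0],[60,0],[0]],
[[0,0,0,0],[0,11,0],[2,0],[0]],
[[227,8,29],[43,32],[1]],
[[0,0],[0]],
[[0]]],
[[[0,128,0,128,0,128,0,0,0],[2,68,4,0,3,15,0,76],[0,128,0,10,0,192,0],[0,0,4,2,76,0],[0,0,0,4,0],[1,12,193,144],[0,0,0],[0,0],[0]],
[[0,0,0,0,128,0,0,0],[0,0,2,0,0,16,1],[214,73,93,150,0,0],[0,0,88,64,0],[0,128,177,0],[0,177,2],[0,0],[78]],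
[[0,0,0,155,0,17,0],[32,128,64,1,2,16],[0,3,0,65,0],[0,10,17,0],[0,0,0],[0,0],[0]],
[[2,152,27,0,1,101],[192,0,8,0,0],[72,0,213,2],[0,0,224],[2,0],[96]],
[[0,0,0,0,0],[30,0,32,0],[0,1,0],[0,0],[0]],
[[0,0,128,0],[0,34,78],[64,0],[0]],
[[0,2,0],[224,4],[0]],
[[15,0],[128]],
[[0]]],
[[[0,192,224,0,0,136,0,128],[0,0,3,64,8,0,4],[128,152,0,162,0,0],[68,240,0,64,0],[0,0,0,0],[1,0,0],[0,64],[17]],
[[128,0,0,0,64,209,0],[128,0,0,0,32,0],[0,0,7,0,0],[0,128,0,0],[0,93,128],[0,28],[128]],
[[1,68,12,32,7,159],[0,0,160,0,64],[128,1,36,2],[128,0,171],[1,29],[2]],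
[[192,183,2,35,0],[0,0,0,0],[5,0,68],[81,0],[0]],
[[128,0,0,128],[0,16,15],[128,8],[7]],
[[0,0,0],[84,16],[128]],
[[0,2],[0]],
[[0]]],
[[[0,0,0,0,0,0,0],[0,0,0,0,0,0],[0,0,0,0,0],[0,0,0,0],[0,0,0],[0,0],[0]],
[[0,0,0,93,0,0],[0,0,0,2,0],[64,16,5,88],[0,0,239],[0,0],[0]],
[[0,0,0,1,0],[0,0,128,0],[0,0,0],[157,100],[0]],
[[1,64,104,88],[0,0,0],[247,8],[10]],
[[0,0,0],[0,0],[0]],
[[0,0],[0]],
[[0]]],
[[[0,0,0,0,0,0],[0,0,0,0,0],[0,0,0,3],[0,0,0],[0,0],[0]],
[[0,246,2,179,0],[0,128,64,0],[227,10,29],[0,42],[0]],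
[[0,68,11,0],[0,0,40],[0,0],[32]],
[[128,0,1],[0,0],[64]],
[[0,0],[0]],
[[0]]],
[[[0,0,0,0,0],[1,16,0,0],[0,0,0],[0,8],[0]],
[[2,101,6,0],[0,61,64],[15,0],[0]],
[[0,64,0],[0,0],[0]],
[[65,0],[0]],
[[0]]],
[[[2,203,0,68],[128,0,1],[68,2],[0]],
[[0,12,2],[0,160],[68]],
[[0,16],[0]],
[[0]]],
[[[0,0,0],[0,0],[0]],
[[0,0],[0]],
[[0]]],
[[[0,0],[0]],
[[0]]],
[[[0]]]]"

definition G10 :: "nat \<Rightarrow> nat \<Rightarrow> nat \<Rightarrow> nat \<Rightarrow> hx list"
  where "G10 = look G10_table"

lemma G10_agree: "agree1 0 G10 G10_table"
  by (rule agree1I) (simp add: G10_def)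

lemmas G10_rules = G10_agree[unfolded G10_table_def dec_rules agree_rules]

text \<open>
  The spanning certificate for the odd sets \<open>{0,1,2}\<close>, \<open>{0,1,3}\<close> and the full set: a rank, followed by
  the position in the basis (rank 0) or by the relations whose sum expresses the monomial by monomials of lower rank.
  The entry is empty where \<open>y\<close> has exactly one odd exponent, since \<open>z y\<^sup>2\<close> is then hit by the \<open>\<chi>\<close>-trick.
\<close>

definition CA_table :: "hx list list list list list"
  where "CA_table = dtable [[[[0,0,0,0,0,0,0,0,0,0,0,0],[0,0xf111040101,0,0xf531010102,0,0xf711000101,0,0xf171010102,0,0xf511000101,0],[0,0,0,0,0,0,0,0,0,0],[0,0xf51301010a,0,0xf523003207,0,0xf153010102,0,0xf333000101,0],[0,0,0,0,0,0,0,0],[0,0xf531000101,0,0xf325003205,0,0xf171000101,0],[0,0,0,0,0,0],[0,17969664,0,0xf127003203,0],[0,0,0,0],[0,0xf151000101,0],[0,0],[0]],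
[[0,0xf110140101,0,18616832,0,0xf710100101,0,0xf170110108,0,0xf510100101,0],[0xf101140101,0xf011140101,16868096,17911808,0xf701100101,0xf611100101,0xf161110112,0xf071110102,0xf501100101,0xf411100101],[0,17515520,0,0xf132120106,0,0xf152110103,0,0xf332100101,0],[0xf702104201,17453824,17182976,17187584,0xf14311010b,0xf053110102,0xf162104201,0xf063103201],[0,0xf530100101,0,18681856,0,0xf170100101,0],[0xf105120101,0xf015120101,17834752,0xf315100108,0xf161100101,0xf071100101],[0,17044480,0,0xf126103205,0],[0xf323100102,0xf207103207,0xf135100107,0xf117100110],[0,0xf150100101,0],[0xf141100101,0xf051100101],[0]],
[[0,0,0,0,0,0,0,0,0,0],[0,0xf710204209,0,0xf530204204,0,0xf151210111,0,0xf17020420a,0],[0,0,0,0,0,0,0,0],[0,0xf113220114,0,0xf32320320f,0,0xf152204216,0],[0,0,0,0,0,0],[0,0xf33120010b,0,0xf12520320c,0],[0,0,0,0],[0,0xf13320010b,0],[0,0],[0]],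
[[0,18173952,0,0xf520303201,0,0xf150310110,0,0xf330300105,0],[0xf700304201,0xf211320111,0xf520304201,0xf430304201,0xf141310102,0xf051310102,0xf160304201,0xf151300109],[0,16794368,0,0xf333100107,0,0xf142303201,0],[0xf502304201,0xf01332010e,0xf331300113,0xf31330010b,0xf142304201,0xf213300116],[0,17961728,0,0xf124303201,0],[0xf321300106,0xf214304204,0xf124304201,0xf11530010b],[0,0xf106303201,0],[0xf123300102,0xf033300113],[0]],
[[0,0,0,0,0,0,0,0],[0,0xf111420101,0,17838592,0,0xf153000101,0],[0,0,0,0,0,0],[0,0xf303403210,0,0xf132404207,0],[0,0,0,0],[0,0xf117000101,0],[0,0],[0]],
[[0,0xf110520101,0,17175552,0,0xf152100101,0],[0xf101520101,0xf011520101,16913152,0xf233100108,0xf143100101,0xf053100101],[0,0xf302503204,0,0xf122503208,0],[0xf311500109,0xf20350320d,0xf12250420d,0xf02350320c],[0,0xf116100101,0],[0xf107100101,0xf017100101],[0]],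
[[0,0,0,0,0,0],[0,0xf111610115,0,0xf13060420a,0],[0,0,0,0],[0,0xf103603214,0],[0,0],[0]],
[[0,0xf312300103,0,0xf132300102,0],[0xf101710102,0xf011710115,0xf120704201,0xf11170010f],[0,0xf11350010e,0],[0xf10270420a,0xf00370320c],[0]],
[[0,0,0,0],[0,0xf115000101,0],[0,0],[0]],
[[0,0xf114100101,0],[0xf105100101,0xf015100101],[0]],
[[0,0],[0]],
[[0]]],
[[[0,0xf110050101,0,0xf330030101,0,0xf710010101,0,0xf360013201,0,0xf510010101,0],[0xf101050101,0xf011050101,0xf711013210,0xf231030105,0xf701010101,0xf611010101,0xf35101320a,0xf351010102,0xf501010101,0xf411010101],[0,0xf702013201,0,0xf132030101,0,0xf351014202,0,0xf162013201,0],[0xf30303010d,0xf213030105,0xf123030101,0xf033030109,18497536,0xf333010108,18358528,17781760],[0,0xf530010101,0,0xf324013201,0,0xf170010101,0],[0xf105030101,0xf431010101,18305280,0xf315010103,0xf161010101,0xf071010101],[0,0xf306013201,0,0xf126013210,0],[0xf323010102,0xf233010105,17313792,0xf117010102],[0,0xf150010101,0],[0xf141010101,0xf051010101],[0]],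
[[0xf100150101,0xf010150101,0xf320130103,0xf230130102,0xf700110101,0xf610110101,0xf350113204,18685952,0xf500110101,0xf410110101],[0xf001150101,0xf710114202,16925184,0xf131130104,0xf601110101,0xf350114208,0xf34111010f,0xf170114203,0xf401110101],[18755584,0xf602113201,18551296,0xf422113201,18554880,18625536,0xf322110107,17703936],[0xf602114201,0xf503113206,0xf422114201,0xf323113201,0xf242114207,0xf313110105,0xf062114201],[0xf104130101,0xf430110101,0xf314113203,18288896,0xf160110101,0xf070110101],[0xf005130101,0xf314114202,18039552,0xf12511320b,0xf205110101],[0xf314110102,0xf232110101,0xf125114209,0xf116110102],[0xf206114203,0xf107113202,0xf107110103],[0xf140110101,0xf050110101],[0xf041110101]],
[[0,0xf71101010e,0,0xf130230101,0,18563072,0,18489600,0],[0xf700214201,0xf211230101,0xf520214201,0xf51121010a,0xf340214201,0xf331210105,0xf321210102,0xf231210110],[0,0xf502213201,0,0xf322213201,0,17585152,0],[17129472,0xf403213213,18235648,0xf313210115,0xf142214201,0xf21321010b],[0,0xf304213201,0,0xf135010106,0],[17719808,0xf21421420f,0xf133210110,0xf11521010c],[0,17904128,0],[0xf106214201,0xf01621420f],[0]],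
[[18432512,0xf600313201,17588992,17977344,0xf33031320e,0xf251110108,0xf320310109,18297600],[0xf600314201,0xf111330106,0xf021330101,0xf330314203,0xf24031420b,0xf311310104,0xf060314201],[0xf102330108,16798464,0xf323110108,0xf233110104,0xf14131420a,16786176],[0xf003330110,0xf312314213,0xf231310102,0xf123313213,0xf042314201],[0xf305110102,0xf204313201,0xf125110106,0xf114310101],[0xf204314201,0xf114314202,0xf105310107],[17437440,17064960],[0xf023310102]],
[[0,0xf512010101,0,0xf332010102,0,0xf310410101,0],[0xf503010101,0xf413010101,0xf320414201,0xf311410104,0xf143010101,0xf211410101],[0,17457664,0,0xf122413201,0],[0xf302414203,0xf203413203,0xf122414201,0xf02341320f],[0,0xf130410101,0],[0xf121410101,0xf017010101],[0]],
[[0xf502110101,0xf010530101,0xf310513206,17638400,0xf142110101,0xf052110101],[0xf403110101,0xf310514202,0xf223110104,0xf133110108,0xf201510101],[0xf310510102,0xf202513201,0xf130510102,0xf022513209],[0xf202514203,0xf103513205,0xf031510109],[0xf106110101,0xf016110101],[0xf007110101]],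
[[0,0xf312210102,0,0xf131410102,0],[0xf300614205,0xf21061420a,0xf123210102,0xf030614214],[0,0xf102613204,0],[0xf10261420c,0xf003613211],[0]],
[[0xf30231010b,0xf212310102,0xf121510102,0xf032310101],[0xf200714201,0xf110714202,0xf020714201],[0xf110710104,0xf01351010e],[0xf00271420d]],
[[0,0xf114010101,0],[0xf105010101,0xf015010101],[0]],
[[0xf104110101,0xf014110101],[0xf005110101]],
[[0]]],
[[[0,0,0,0,0,0,0,0,0,0],[0,0xf711100102,0,0xf531100102,0,0xf35002420e,0,0xf171100106,0],[0,0,0,0,0,0,0,0],[0,0xf513100102,0,0xf323023206,0,0xf153100102,0],[0,0,0,0,0,0],[0,0xf331020107,0,0xf125023206,0],[0,0,0,0],[0,0xf13302010f,0],[0,0],[0]],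
[[0,19021824,0,18620672,0,0xf150130102,0,0xf330120101,0],[18505984,0xf411130104,18637312,18371072,0xf141130104,0xf051130102,0xf321120101,0xf231120104],[0,18633728,0,0xf13213010a,0,0xf312120101,0],[0xf50212420b,0xf213130106,18227712,0xf22312320c,0xf142124201,0xf21312010a],[0,18420224,0,0xf124123212,0],[17523456,0xf015130103,0xf13312010e,0xf115120102],[0,0xf106123201,0],[0xf106124201,0xf033120105],[0]],
[[0,0,0,0,0,0,0,0],[0,0xf511300102,0,0xf321223212,0,0xf150224208,0],[0,0,0,0,0,0],[0,0xf033310111331010a,0,0xf123223216,0],[0,0,0,0],[0,0xf13122010a,0],[0,0],[0]],
[[0,0xf51112010c,0,0xf331120103,0,0xf151120105,0],[0xf301330109,0xf211330105,0xf121330106,0xf031330104,0xf140324201,0xf050324205],[0,0xf313120117,0,0xf12232320d,0],[0xf103330105,0xf01333010d,0xf122324201,0xf113320110],[0,0xf104323201,0],[0xf121320102,0xf014324205],[0]],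
[[0,0,0,0,0,0],[0,0xf301423206,0,0xf13150010e,0],[0,0,0,0],[0,0xf10342320d,0],[0,0],[0]],
[[0,17581056,0,0xf120523205,0],[0xf303120102,0xf011530109,0xf123120102,0xf111520104],[0,0xf102523201,0],[0xf102524203,0xf003523203],[0]],
[[0,0,0,0],[0,0xf11322011330261132306123221420321442313210111314011171061333016113150610e,0],[0,0],[0]],
[[0,0xf112320102,0],[0xf103320107,0xf010724206],[0]],
[[0,0],[0]],
[[0]]],
[[[0,0xf710110103,0,0xf530110102,0,0xf350110102,0,18485504,0],[0xf701110102,0xf611110102,0xf521110102,0xf431110102,18567936,17445120,0xf321030111,18232064],[0,0xf512110102,0,0xf332110107,0,0xf312030102,0],[0xf502034205,0xf413110102,0xf322034201,0xf313030103,18428672,17048320],[0,18223360,0,0xf13411010a,0],[17974016,0xf215110104,0xf115033205,0xf115030108],[0,16978944,0],[17371904,0xf017110108],[0]],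
[[19342080,0xf600133201,18768896,19087360,0xf33013320d,0xf330130109,18699264,18690048],[17105664,18440192,0xf411133203,0xf330134206,18571776,0xf150134202,16859648],[0xf510130102,0xf402133201,0xf321134208,18502656,18493440,0xf042133201],[0xf402134201,0xf312134217,18240000,0xf132134206,18096640],[0xf312130102,0xf204133201,0xf123134209,0xf024133201],[0xf221130101,0xf105133202,0xf024134201],[0xf114130102,0xf006133201],[0xf023130102]],
[[0,0xf510310109,0,0xf331030103,0,0xf31023010f,0],[0xf501310102,0xf411310112,0xf32131010c,17769472,17764352,18093056],[0,0xf302233201,0,0xf122233203,0],[0xf311230103,0xf21331010f,0xf131230113,0xf11323010b],[0,18027264,0],[0xf121230102,0xf015310105],[0]],
[[0xf501130104,0xf400333203,0xf321130102,0xf231130101,0xf130333203,18162176],[0xf400334203,0xf310334202,0xf220334208,0xf130334202,0xf040334201],[0xf30313010c,0xf202333203,0xf123130102,0xf033130116],[0xf202334204,0xf10333320a,17843200],[0xf105130102,17649664],[17571840]],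
[[0,0xf300433201,0,17110016,0],[0xf30151010c,0xf211510104,16847616,18310144],[0,0xf102433208,0],[0xf111430107,0xf00343320c],[0]],
[[0xf302130101,0xf212130102,0xf122130103,0xf032130102],[0xf203130102,0xf101533202,17518592],[0xf110530103,0xf002533201],[0xf002534208]],
[[0,0xf112230102,0],[16998400,0xf013230114],[0]],
[[0xf101530103,0xf012330102],[0xf000734204]],
[[0]]],
[[[0,0,0,0,0,0,0,0],[0,0xf111060101,0,16982528,0,0xf151200101,0],[0,0,0,0,0,0],[0,0xf113050116,0,0xf123043205,0],[0,0,0,0],[0,0xf131040101,0],[0,0],[0]],
[[0,0xf110160101,0,0xf130150104,0,0xf150300101,0],[0xf501300101,0xf011160101,0xf121150105,0xf23130010a,0xf301140101,0xf211140101],[0,0xf112150102,0,0xf122143201,0],[0xf303300103,0xf013150111,0xf122144201,0xf10206031021403122140212],[0,0xf130140101,0],[0xf121140101,0xf031140101],[0]],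
[[0,0,0,0,0,0],[0,0xf310244203,0,0xf130244203,0],[0,0,0,0],[0,0xf11224420f,0],[0,0],[0]],
[[0,0xf31114010b,0,0xf120343208,0],[0xf300344203,0xf21034420d,0xf120344209,0xf030344209],[0,0xf102343202,0],[0xf102344203,0xf012344213],[0]],
[[0,0,0,0],[0,0xf111600101,0],[0,0],[0]],
[[0,0xf110700101,0],[0xf101700101,0xf011700101],[0]],
[[0,0],[0]],
[[0]]],
[[[0,0xf510210101,0,0xf330210102,0,0xf150210101,0],[0xf101070101,0xf011070101,0xf320054201,17388032,0xf301050101,0xf211050101],[0,0xf302053201,0,0xf132210103,0],[0xf303210106,0xf203053205,0xf122054201,0xf033210115],[0,0xf130050101,0],[0xf105210101,0xf015210101],[0]],
[[0xf100170101,0xf010170101,0xf310153208,0xf230310102,0xf300150101,0xf210150101],[0xf001170101,0xf310154202,0xf221310102,0xf130154208,0xf041310101],[18363136,0xf202153201,0xf122310103,16933888],[0xf203310102,0xf112154209,17391616],[0xf104310101,0xf014310101],[0xf021150101]],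
[[0,0xf311050107,0,0xf131050102,0],[0xf300254201,0xf210254203,0xf120254205,0xf030254203],[0,0xf10225320a,0],[0xf111250104,0xf01225420c],[0]],
[[0xf301150103,0xf211150103,0xf110353204,0xf03115010c],[0xf200354203,0xf110354203,0xf020354203],[0xf103150104,0xf00235320a],[0xf01135010e]],
[[0,0xf110610101,0],[0xf101610101,0xf011610101],[0]],
[[0xf100710101,0xf012150101],[0xf003150101]],
[[0]]],
[[[0,0,0,0,0,0],[0,0xf31122010a,0,0xf131140109,0],[0,0,0,0],[0,0xf113140113,0],[0,0],[0]],
[[0,0xf310320106,0,0xf130320102,0],[0xf301320102,0xf011170110,0xf120164201,0xf031320106],[0,0xf102163201,0],[0xf102164206,0xf00316320d],[0]],
[[0,0,0,0],[0,0xf11134010a,0],[0,0],[0]],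
[[0,0xf111160107,0],[0xf100364201,0xf010364203],[0]],
[[0,0],[0]],
[[0]]],
[[[0,0xf310150103,0,17896192,0],[0xf301230102,18158592,16843008,0xf03123010b],[0,16802816,0],[0xf103230101,0xf003073210],[0]],
[[0xf300330104,0xf210330102,0xf120330103,0xf030330101],[0xf201330102,17908736,17506304],[0xf110170107,0xf002173201],[0xf00217420f]],
[[0,0xf11107010c,0],[0xf101350104,0xf01027420c],[0]],
[[0xf101170103,0xf00037320f],[0xf000374204]],
[[0]]],
[[[0,0,0,0],[0,0xf111400101,0],[0,0],[0]],
[[0,0xf110500101,0],[0xf101500101,0xf011500101],[0]],
[[0,0],[0]],
[[0]]],
[[[0,0xf110410101,0],[0xf101410101,0xf011410101],[0]],
[[0xf100510101,0xf010510101],[0xf001510101]],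
[[0]]],
[[[0,0],[0]],
[[0]]],
[[[0]]]]"

definition CA :: "nat \<Rightarrow> nat \<Rightarrow> nat \<Rightarrow> nat \<Rightarrow> hx list"
  where "CA = look CA_table"

lemma CA_agree: "agree1 0 CA CA_table"
  by (rule agree1I) (simp add: CA_def)

lemmas CA_rules = CA_agree[unfolded CA_table_def dec_rules agree_rules]

definition CB_table :: "hx list list list list list"
  where "CB_table = dtable [[[[0,0,0,0,0,0,0,0,0,0,0,0],[0,0xf111041101,0,0xf331021106,0,0xf711001101,0,17510656,0,0xf511001101,0],[0,0,0,0,0,0,0,0,0,0],[0,0xf703002203,0,0xf133021101,0,0xf153011102,0,0xf333001101,0],[0,0,0,0,0,0,0,0],[0,0xf531001101,0,0xf135011109,0,0xf315001101,0],[0,0,0,0,0,0],[0,18031360,0,0xf127002201,0],[0,0,0,0],[0,0xf151001101,0],[0,0],[0]],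
[[0,0xf110141101,0,0xf530111105,0,0xf710101101,0,0xf170111102,0,0xf510101101,0],[0xf101141101,0xf011141101,16777216,18046976,0xf701101101,0xf611101101,17785344,0xf071111108,0xf501101101,0xf411101101],[0,0xf702102216,0,0xf52210220a,0,0xf15211110c,0,0xf162102211,0],[0xf303121105,0xf413111114,0xf523004201,0xf513101116,0xf143111101,0xf053111102,17310208,0xf233101107],[0,0xf530101101,0,0xf324102206,0,0xf170101101,0],[0xf521101101,0xf431101101,0xf315102212,0xf315101102,0xf305101101,0xf071101101],[0,0xf332101112,0,0xf126102205,0],[0xf323101101,0xf017111106,16928768,0xf117101102],[0,0xf150101101,0],[0xf141101101,0xf051101101],[0]],
[[0,0,0,0,0,0,0,0,0,0],[0,17646592,0,0xf131221102,0,0xf151211108,0,17503232,0],[0,0,0,0,0,0,0,0],[0,0xf503202201,0,0xf133211109,0,0xf143202206,0],[0,0,0,0,0,0],[0,17241088,0,0xf125202201,0],[0,0,0,0],[0,0xf107202201,0],[0,0],[0]],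
[[0,0xf310321108,0,17121536,0,0xf150311108,0,0xf330301104,0],[0xf301321102,0xf411311109,0xf121321110,0xf03132110b,18100224,0xf051311102,0xf321301107,0xf231301104],[0,0xf112321115,0,0xf322302205,0,0xf153101108,0],[0xf103321102,0xf403302203,0xf123311102,0xf233204212,0xf151301105,0xf043302204],[0,17113600,0,0xf124302209,0],[0xf105311106,0xf015311103,0xf115302205,0xf115301102],[0,0xf106302201,0],[0xf107204201,0xf007302206],[0]],
[[0,0,0,0,0,0,0,0],[0,0xf111421101,0,17965824,0,0xf153001101,0],[0,0,0,0,0,0],[0,0xf303402203,0,0xf123402205,0],[0,0,0,0],[0,0xf117001101,0],[0,0],[0]],
[[0,0xf110521101,0,0xf130511102,0,0xf152101101,0],[0xf101521101,0xf011521101,17244672,18178816,0xf143101101,0xf211501101],[0,0xf302502209,0,0xf133301106,0],[0xf31150110b,0xf203502212,0xf131501107,0xf11350110d],[0,0xf116101101,0],[0xf107101101,0xf017101101],[0]],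
[[0,0,0,0,0,0],[0,17039360,0,0xf133201102,0],[0,0,0,0],[0,0xf103602213,0],[0,0],[0]],
[[0,0xf30070220a,0,0xf132301106,0],[0xf303301106,0xf011711109,0xf123301102,0xf11170110c],[0,0xf102702203,0],[0xf10360420b,0xf003702203],[0]],
[[0,0,0,0],[0,0xf115001101,0],[0,0],[0]],
[[0,0xf114101101,0],[0xf105101101,0xf015101101],[0]],
[[0,0],[0]],
[[0]]],
[[[0,0xf110051101,0,0xf330031102,0,0xf710011101,0,19272192,0,0xf510011101,0],[0xf101051101,0xf011051101,0xf711012205,16994816,0xf701011101,0xf611011101,0xf351012205,18763776,0xf501011101,0xf411011101],[0,0xf312031102,0,0xf132031102,0,0xf342012201,0,0xf332011102,0],[0xf711011102,0xf213031107,0xf531011107,0xf513011104,0xf351011102,0xf33301110a,0xf171011102,18170624],[0,0xf530011101,0,0xf32401220a,0,0xf170011101,0],[0xf105031101,0xf431011101,0xf315012209,17576192,0xf305011101,0xf215011101],[0,0xf306012201,0,0xf126012201,0],[0xf315011102,0xf233011101,0xf117012208,0xf117011102],[0,0xf150011101,0],[0xf141011101,0xf051011101],[0]],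
[[0xf100151101,0xf010151101,0xf71011220f,0xf230131106,0xf700111101,0xf610111101,0xf35011220b,18628608,0xf500111101,0xf410111101],[0xf001151101,0xf70111220f,0xf221131102,0xf531014202,0xf601111101,18374656,0xf341111104,0xf331111103,0xf401111101],[0xf30213110d,0xf60211220a,0xf122131102,0xf422112216,0xf342014201,0xf33211110b,0xf162014201,0xf23211110b],[0xf203131106,0xf503112205,17326080,0xf323112218,18366720,0xf143112203,17256960],[0xf104131101,0xf430111101,0xf324014201,0xf314111103,0xf160111101,0xf070111101],[0xf421111101,0xf305112202,0xf305111107,0xf125112210,0xf061111101],[0xf322111102,0xf20611220a,0xf126014201,0xf116111113],[0xf223111101,0xf107112202,0xf02701420f],[0xf140111101,0xf050111101],[0xf041111101]],
[[0,16863744,0,16851456,0,18436096,0,17117440,0],[0xf301231107,0xf211231101,0xf511212204,0xf031231101,0xf341114204,0xf33121110a,0xf151212207,17900544],[0,0xf502212201,0,0xf322212201,0,17449728,0],[0xf511211102,0xf403212201,0xf313212209,0xf313211104,0xf143114207,0xf043212201],[0,16855296,0,0xf124212201,0],[0xf305114203,0xf23121110a,0xf115212208,0xf115211102],[0,0xf106212201,0],[17634304,0xf007212201],[0]],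
[[17829888,0xf210331109,16908800,17981440,18702592,18301184,0xf320311102,0xf230311107],[0xf201331102,0xf511214208,0xf021331102,0xf32131220e,0xf321311111,0xf31131110e,18034688],[0xf502214201,0xf402312213,0xf322214201,0xf5131011313111131303110b,17322496,0xf042312201],[0xf403214206,0xf303312208,0xf23131110c,0xf12331220b,16921088],[0xf304214201,0xf215111102,0xf132311106,0xf114311102],[0xf213311104,0xf131311105,17699328],[17179136,18113280],[0xf023311102]],
[[0,0xf110431101,0,18560000,0,0xf152011101,0],[0xf503011101,0xf011431101,0xf323011103,18105088,0xf301411101,0xf211411101],[0,18354432,0,0xf122412201,0],[0xf311411102,0xf203412201,0xf131411103,0xf113411104],[0,0xf116011101,0],[0xf107011101,0xf017011101],[0]],
[[0xf502111101,0xf412111101,18292992,17716224,0xf142111101,0xf210511101],[0xf403111101,0xf311414202,17191424,0xf121512202,0xf201511101],[0xf310511102,0xf202512203,17773056,0xf11251110a],[0xf211511107,0xf103512209,0xf031511101],[0xf120511101,0xf016111101],[0xf007111101]],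
[[0,17384192,0,0xf132211102,0],[0xf301514208,0xf213211108,0xf123211103,0xf033211102],[0,0xf102612203,0],[0xf111611103,0xf003612201],[0]],
[[0xf301511104,0xf212311106,0xf122311101,18244352],[0xf203311101,0xf101712204,16991232],[0xf11071110b,0xf002712211],[0xf003614208]],
[[0,0xf114011101,0],[0xf105011101,0xf015011101],[0]],
[[0xf104111101,0xf014111101],[0xf005111101]],
[[0]]],
[[[0,0,0,0,0,0,0,0,0,0],[0,0xf711101109,0,0xf531101102,0,0xf151031102,0,0xf171101105,0],[0,0,0,0,0,0,0,0],[0,0xf50302220a,0,0xf323022206,0,0xf313021104,0],[0,0,0,0,0,0],[0,17375744,0,0xf13510110a,0],[0,0,0,0],[0,18109184,0],[0,0],[0]],
[[0,0xf710024203,0,0xf530024203,0,0xf150131102,0,0xf17002420d,0],[0xf701024203,0xf611024214,0xf521024203,0xf431024203,0xf141131102,0xf051131109,0xf321121101,0xf231121106],[0,0xf51202420d,0,0xf32212220e,0,0xf152024211,0],[0xf511121104,0xf413024210,0xf331121112,0xf03313110d,0xf143024201,0xf213121116],[0,0xf33012110e,0,0xf124122207,0],[16974592,0xf015131105,0xf125024206,0xf11512110c],[0,0xf132121110,0],[0xf107024201,0xf017024216],[0]],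
[[0,0,0,0,0,0,0,0],[0,0xf51130110c,0,17707520,0,17712128,0],[0,0,0,0,0,0],[0,0xf313301113,0,0xf123222201,0],[0,0,0,0],[0,0xf105222201,0],[0,0],[0]],
[[0,0xf510224203,0,0xf320322211,0,0xf151121107,0],[0xf501224201,0xf211331106,0xf321224205,0xf11053111113311103331109,0xf141224201,0xf051224204],[0,0xf30232220c,0,0xf122322216,0],[0xf303224218,0xf21322420f,0xf123224201,0xf03322420e],[0,0xf13032110b,0],[0xf11332110f,0xf01522420a],[0]],
[[0,0,0,0,0,0],[0,17195776,0,18043648,0],[0,0,0,0],[0,0xf10342220c,0],[0,0],[0]],
[[0,0xf310424217,0,0xf13042420f,0],[0xf101531104,0xf011531115,0xf123121102,0xf111521110],[0,0xf10252220d,0],[0xf103424202,0xf00352220d],[0]],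
[[0,0,0,0],[0,17305856,0],[0,0],[0]],
[[0,0xf11062420f,0],[0xf101624201,0xf011624211],[0]],
[[0,0],[0]],
[[0]]],
[[[0,0xf71011110e,0,0xf520032204,0,0xf350111102,0,18424064,0],[0xf701111103,0xf61111110a,0xf521111102,0xf431111101,0xf331032203,0xf251111102,0xf161111103,17060352],[0,0xf50203220d,0,0xf322032202,0,0xf142032201,0],[0xf503111106,0xf40303220c,0xf323111102,0xf313031117,17125888,0xf043032201],[0,0xf304032201,0,0xf134111107,0],[0xf321031106,0xf231031101,0xf11503220a,0xf115031109],[0,0xf106032201,0],[0xf123031108,0xf033031105],[0]],
[[0xf700034203,0xf610034203,0xf520034203,0xf430034203,0xf340034201,0xf330131104,0xf320131110,0xf070034201],[0xf601034209,0xf511034213,0xf421034204,0xf33103420c,0xf241034201,0xf151034203,0xf061034201],[0xf510131104,0xf412034212,17379584,0xf31213110e,0xf142034201,0xf21213110b],[0xf403034211,0xf313034203,0xf223034208,0xf133034214,0xf043034201],[0xf304034201,0xf214034205,0xf13213110f,0xf11413110f],[0xf205034201,0xf115034202,0xf105131103],[0xf106034201,0xf006132215],[0xf023131104]],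
[[0,0xf510311109,0,0xf330311102,0,0xf140232201,0],[0xf501311103,0xf401232208,0xf311232207,17847296,0xf141311102,16790016],[0,0xf312311116,0,0xf122232205,0],[0xf31123110d,0xf203232203,0xf131231101,0xf033311113],[0,0xf104232201,0],[0xf121231105,17056768],[0]],
[[0xf501131105,0xf410234213,0xf321131109,0xf310331105,0xf140234201,0xf050234208],[0xf401234203,0xf311234205,0xf22123420b,0xf131234212,0xf041234201],[0xf302234204,0xf213131111,0xf130331112,0xf03223420c],[0xf203234204,0xf10333220a,0xf023234218],[0xf120331102,0xf030331101],[0xf005234201]],
[[0,0xf300432201,0,17641984,0],[0xf303031103,0xf201432206,0xf121511102,17261312],[0,0xf102432202,0],[0xf111431102,0xf003432202],[0]],
[[0xf30133110c,0xf210434205,0xf120434201,0xf030434217],[0xf201434205,0xf101532208,0xf021434203],[0xf102434208,0xf00253220c],[0xf00343420c]],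
[[0,0xf100632201,0],[0xf101711107,0xf001632201],[0]],
[[0xf100634201,0xf012331114],[0xf003331107]],
[[0]]],
[[[0,0,0,0,0,0,0,0],[0,0xf111061101,0,0xf331201101,0,0xf151201101,0],[0,0,0,0,0,0],[0,0xf313201107,0,0xf123042201,0],[0,0,0,0],[0,0xf131041101,0],[0,0],[0]],
[[0,0xf110161101,0,0xf130151103,0,0xf150301101,0],[0xf501301101,0xf011161101,16781824,17253376,0xf141301101,0xf051301101],[0,0xf112151103,0,0xf122142205,0],[17777664,0xf21330110a,0xf123044201,0xf03330110d],[0,0xf130141101,0],[0xf121141101,0xf015301101],[0]],
[[0,0,0,0,0,0],[0,17851392,0,0xf131321110,0],[0,0,0,0],[0,0xf103242201,0],[0,0],[0]],
[[0,0xf311141102,0,0xf131141102,0],[0xf30124420b,0xf21124420c,0xf12124420b,0xf031244207],[0,0xf11314110e,0],[0xf103244203,0xf013244206],[0]],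
[[0,0,0,0],[0,0xf111601101,0],[0,0],[0]],
[[0,0xf110701101,0],[0xf101701101,0xf011701101],[0]],
[[0,0],[0]],
[[0]]],
[[[0,0xf510211101,0,0xf330211101,0,0xf310051101,0],[0xf501211101,0xf011071101,0xf321211108,0xf231131109,0xf141211101,0xf051211101],[0,0xf312211101,0,0xf122052201,0],[0xf303211109,0xf203052207,0xf131051102,0xf023052201],[0,0xf114211101,0],[0xf105211101,0xf015211101],[0]],
[[0xf100171101,0xf010171101,17654272,0xf310151106,0xf300151101,0xf210151101],[0xf001171101,0xf301152202,0xf221311105,0xf131054204,0xf201151101],[0xf302311105,0xf202152205,16916992,0xf032311101],[17052160,0xf103152202,0xf023054201],[0xf104311101,0xf014311101],[0xf005311101]],
[[0,17441792,0,17568768,0],[0xf301154203,0xf211154205,0xf121331106,0xf111251105],[0,0xf113051108,0],[0xf103154204,0xf013154211],[0]],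
[[18165760,0xf211151102,0xf121151104,0xf031151102],[0xf201254201,0xf11125420b,0xf021254201],[0xf103151109,0xf01315110b],[0xf01135110d]],
[[0,0xf110611101,0],[0xf101611101,0xf013051101],[0]],
[[0xf100711101,0xf010711101],[0xf001711101]],
[[0]]],
[[[0,0,0,0,0,0],[0,0xf311221101,0,17249280,0],[0,0,0,0],[0,0xf113221102,0],[0,0],[0]],
[[0,0xf110171103,0,0xf13006420a,0],[0xf301064201,0xf21132110a,0xf121064201,0xf031064208],[0,0xf112064214,0],[0xf103064201,0xf013321112],[0]],
[[0,0,0,0],[0,0xf111341108,0],[0,0],[0]],
[[0,0xf111161109,0],[0xf101264201,0xf011264205],[0]],
[[0,0],[0]],
[[0]]],
[[[0,0xf310231102,0,0xf130231102,0],[0xf301151106,16986624,0xf111072203,17318912],[0,0xf112231102,0],[0xf103231108,0xf013231102],[0]],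
[[0xf300331102,0xf210074203,0xf120074201,17915904],[0xf201074201,0xf111074202,0xf021074201],[0xf102331102,0xf002172210],[0xf003074201]],
[[0,0xf10027220f,0],[0xf101174208,0xf001272201],[0]],
[[0xf101171102,0xf01117110b],[0xf001274201]],
[[0]]],
[[[0,0,0,0],[0,0xf111401101,0],[0,0],[0]],
[[0,0xf110501101,0],[0xf101501101,0xf011501101],[0]],
[[0,0],[0]],
[[0]]],
[[[0,0xf110411101,0],[0xf101411101,0xf011411101],[0]],
[[0xf100511101,0xf010511101],[0xf001511101]],
[[0]]],
[[[0,0],[0]],
[[0]]],
[[[0]]]]"

definition CB :: "nat \<Rightarrow> nat \<Rightarrow> nat \<Rightarrow> nat \<Rightarrow> hx list"
  where "CB = look CB_table"

lemma CB_agree: "agree1 0 CB CB_table"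
  by (rule agree1I) (simp add: CB_def)

lemmas CB_rules = CB_agree[unfolded CB_table_def dec_rules agree_rules]

definition CE_table :: "hx list list list list list"
  where "CE_table = dtable [[[[0xf200040301,0xf110040301,0xf020040301,0xf53001030c,0xf240020302,0xf150020312,0xf540000302,0xf170010303,0xf600000301,0xf510000301,0xf420000301],[0xf101040301,0xf011040301,0xf521010316,17170432,0xf701000311,0xf611000316,0xf161010309,0xf351000309,0xf501000301,0xf411000301],[0xf002040301,0xf512010314,0xf630000315,0xf132020308,0xf450000302,0xf152010309,0xf06201030c,0xf332000307,0xf402000301],[0xf711000310,0xf213020317,0xf531000317,18825472,0xf0710103151010308,0xf053010311,0xf171000311,0xf15300030c],[0xf404010302,0xf53000030b,0xf024020302,0xf13401030c,0xf260000302,0xf170000312,0xf224000302],[0xf521000306,0xf015020317,0xf333000312,0xf315000313,0xf16100030b,0xf215000312],[0xf414000302,18886656,0xf306000313,19337728,0xf054000302],[0xf323000312,0xf017010313,0xf135000313,0xf117000303],[0xf240000301,0xf150000301,0xf060000301],[0xf141000301,0xf051000301],[0xf042000301]],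
[[0xf100140301,0xf010140301,18817536,0xf430110309,0xf14012030b,0xf050120310,0xf160110304,0xf070110313,0xf500100301,0xf410100301],[0xf001140301,19075584,0xf221120310,19079168,0xf041120306,0xf15111030a,0xf061110310,0xf33110031a,0xf401100301],[18899712,18894848,18830080,18952448,0xf142110311,0xf052110307,0xf322100312,0xf152100316],[0xf20312030f,19215360,18878720,0xf133110309,0xf043110303,0xf31310031a,17171456],[0xf520100304,0xf01412030b,0xf12411030c,0xf314100315,0xf16010030e,0xf070100311],[0xf005120306,19009536,0xf305100318,17235968,0xf061100316],[19014400,0xf016110305,19031040,0xf116100309],[0xf22310030f,19226624,0xf035100309],[0xf140100301,0xf050100301],[0xf041100301]],
[[0xf000240301,0xf31022030f,0xf621000310,18964736,0xf441000302,0xf150210307,0xf060210311,0xf330200310,0xf400200301],[0xf301220319,18890752,0xf121220310,18882816,0xf141210311,0xf051210305,0xf321200306,0xf151200314],[0xf402210314,0xf513000307,0xf502200316,18960896,0xf04221030c,18948608,0xf063000315],[0xf511200311,0xf01322030d,0xf12321030c,0xf313200304,0xf303200313,0xf213200308],[0xf405000302,18956800,0xf30420030c,19161856,0xf045000302],[19018240,0xf231200315,19219456,0xf115200309],[0xf006210310,19025920,0xf10620030c],[18817024,0xf033200307],[0xf040200301]],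
[[0xf300320312,19013632,19018752,18813184,0xf140310315,0xf050310318,18748416,0xf071100310],[19092224,19149056,18694912,0xf13131030b,0xf041310307,0xf31130031a,0xf221300317],[0xf102320317,18752512,18944000,0xf03231030b,0xf143100311,0xf053100317],[18821888,19276544,0xf303300319,19293184,18825216],[18813952,0xf215100310,19095552,0xf1071003115100308],[18965504,19152896,0xf105300311],[0xf114300309,0xf017100311],[0xf01530030c]],
[[0xf400410302,0xf512000306,0xf500400302,18821120,0xf242000302,0xf152000307,0xf140400302],[0xf101420312,0xf413000306,0xf12141030c,0xf233000314,0xf301400316,0xf05300030b],[0xf002420302,19083776,0xf23040030f,0xf133200309,0xf202400302],[0xf311400315,0xf013410312,0xf13140030c,0xf11340030c],[0xf004410302,0xf130400308,0xf026000302],[0xf12140030b,0xf017000312],[0xf022400302]],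
[[0xf100520306,0xf010520304,0xf120510311,0xf232100317,0xf142100312,0xf052100306],[0xf001520307,19207168,0xf1014303101510310071030a,0xf133100319,0xf201500317],[0xf310500318,0xf012510317,0xf130500307,0xf033300312],[0xf211500307,19357952,0xf031500313],[0xf120500310,0xf01610030b],[0xf021500312]],
[[0xf401400302,0xf31220030f,0xf221400314,19091456,0xf041400302],[18747904,18760704,0xf123200308,18887680],[0xf210600311,19157760,0xf030600313],[0xf111600304,19337472],[0xf005400302]],
[[0xf100710310,18898944,0xf122300319,0xf032300312],[0xf203300310,0xf113300313,0xf101700313],[0xf110700313,0xf013500313],[0xf011700303]],
[[0xf204000301,0xf114000301,0xf024000301],[0xf105000301,0xf015000301],[0xf006000301]],
[[0xf104100301,0xf014100301],[0xf005100301]],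
[[0xf004200301]]],
[[[0xf100050301,0xf010050301,0xf320030307,0xf710010311,0xf700010312,0xf61001030b,19337984,0xf350010313,0xf500010301,0xf410010301],[0xf001050301,0xf31103031a,0xf221030312,0xf13103031a,0xf60101030e,17236224,19030016,19226880,0xf401010301],[0xf302030310,0xf212030306,18948864,0xf032030313,19162112,19218432,19026176,18817280],[18747392,0xf11303031a,0xf431010311,19292160,19095808,19153152,0xf143010309],[0xf520010307,0xf014030316,0xf332010309,0xf31401030c,0xf304010308,0xf21401030b],[0xf421010312,0xf331010319,0xf305010307,19358208,0xf205010310],[19091712,0xf232010308,19158016,0xf116010304],[0xf223010319,0xf133010313,0xf107010313],[0xf140010301,0xf050010301],[0xf041010301]],
[[0xf000150301,19227136,19026432,19153408,0xf040130308,19358464,19156992,0xf330110313,0xf400110301],[0xf301130313,0xf21113030d,0xf12113030d,19141120,19350528,19144704,0xf32111030d,19075328],[18760192,0xf112130314,18834176,19288064,0xf322110302,0xf31211030d,0xf222110310],[19206656,0xf013130309,19210240,19280896,19140864,19080192],[0xf004130306,19223296,0xf304110305,19350272,0xf204110306],[19149824,0xf231110315,19145728,0xf11511030a],[18891520,0xf13211030d,0xf106110310],[19075072,0xf03311031a],[0xf040110301]],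
[[0xf701010313,0xf611010305,0xf120230315,0xf510210310,0xf341010312,0xf251010317,18759936,18899456],[0xf201230308,0xf111230315,0xf021230318,19283968,0xf321210311,0xf311210314,18895872],[0xf4310103511010371100030a,0xf413010318,0xf330210318,0xf233010308,18833920,18829824],[0xf41121030c,19353856,0xf231210313,19289088,18952192],[18694400,0xf230210318,0xf132210302,0xf114210311],[0xf221210310,0xf13121030d,0xf105210307],[0xf122210310,0xf032210312],[0xf015210316]],
[[18887168,19010048,18957312,19275776,19084288,19206400,0xf22031030f],[0xf101330319,19222528,19354368,19345664,0xf301310309,19215104],[0xf002330314,19346432,0xf223110314,19211264,18878464],[0xf31131030b,19284736,19280640,0xf113310309],[18883584,19140608,0xf104310303],[19079936,0xf03131031a],[17171200]],
[[0xf502010317,0xf41201030b,0xf32201030d,18751744,0xf300410306,0xf052010304],[0xf403010316,0xf313010309,0xf301410318,19223040,0xf20141030b],[0xf310410307,0xf213210311,0xf130410305,0xf11241030c],[0xf211410311,19350016,0xf031410315],[0xf120410306,0xf01601030e],[0xf007010311]],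
[[0xf00053030b,19214592,0xf300510307,19149568,0xf200510306],[0xf30311031a,0xf213110314,0xf123110315,19010560],[0xf210510305,19145472,0xf030510318],[0xf11151030a,17236992],[0xf006110316]],
[[0xf302210317,18895360,18891264,19014144],[0xf203210306,0xf11321030d,0xf101610305],[0xf110610310,19030784],[0xf011610309]],
[[0xf201510314,19076096,0xf02231030f],[0xf10331031a,19227648],[0xf003510309]],
[[0xf104010301,0xf014010301],[0xf005010301]],
[[0xf004110301]]],
[[[0xf000060301,0xf510030309,0xf62010030c,0xf530100311,0xf600020302,0xf150030313,0xf060030313,0xf170100313,0xf400020301],[0xf701100313,0xf611100310,0xf521100307,0xf431100303,0xf141030315,0xf051030318,0xf161100305,0xf23102030f],[0xf602100311,0xf512100305,0xf42210030c,0xf132030304,0xf04203030c,0xf312020315,0xf062100310],[0xf503100318,0xf413100307,0xf32310030b,0xf033030319,0xf151020310,18964480],[0xf420020302,0xf330020314,0xf30402030f,0xf134100312,0xf044100302],[0xf321020317,0xf0143103015110300711030a,0xf125100317,0xf115020307],[0xf214020314,18759680,0xf106020311],[18899200,0xf033020310],[0xf040020301]],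
[[0xf500130313,19030272,19218688,19096064,0xf14013030c,0xf050130307,0xf320120308,0xf230120319],[19157248,19144960,0xf221130302,19279872,0xf041130305,0xf311120315,18891776],[0xf510120317,0xf212130311,0xf330120308,0xf312120313,0xf302120318,0xf212120310],[19083264,19345920,0xf231120314,19284992,18882560],[18752000,0xf014130318,0xf132120311,0xf114120311],[0xf005130307,0xf131120314,0xf105120305],[18895616,0xf032120306],[0xf015120314]],
[[0xf600300313,0xf510300318,0xf42030030c,0xf330300319,0xf04023030f,0xf1431003151100307110030a,0xf140220314],[0xf501300307,0xf411300305,0xf121230313,0xf311220314,0xf141300318,0xf051300307],[0xf40230030f,0xf112230314,0xf22230030e,0xf133020318,0xf050220316],[18944768,0xf213300318,0xf123300308,18960640],[0xf205020316,18833664,0xf10422030c],[18829568,18948352],[0xf006300315]],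
[[0xf300330312,0xf41112030c,0xf32112030c,18944512,0xf14112030c,0xf051120311],[0xf201330309,19210752,0xf021330318,19353600,0xf20132030d],[0xf31032030b,0xf012330308,0xf123120313,0xf11232030c],[18960384,19288832,0xf031320304],[18953216,0xf030320313],[0xf021320308]],
[[0xf402020302,18879232,0xf220500316,18694144,0xf040500302],[0xf101430311,18833408,0xf123020318,18956544],[0xf21042030c,0xf113220302,0xf03042030c],[0xf111420311,19161600],[0xf004500302]],
[[0xf100530317,18829312,0xf122120310,19017984],[18948096,0xf11312030d,0xf023120315],[0xf110520307,19219200],[0xf011520309]],
[[0xf000630315,0xf112220310,0xf100620310],[0xf103220312,19026944],[0xf01062030c]],
[[0xf101520316,18818048],[0xf003320307]],
[[0xf004020301]]],
[[[0xf700110303,0xf610110309,0xf520110309,0xf7101003510110308,0xf34011030c,0xf330030312,18886912,0xf230030312],[0xf601110304,0xf51111030a,0xf421110311,0xf331110309,0xf24111030c,19009792,19014656],[0xf502110307,0xf412110311,18961152,0xf23211030c,18957056,19018496],[0xf403110315,0xf31311030b,18944256,19276800,18812928],[18821376,0xf21411030c,19084032,0xf114030315],[0xf205110311,19206144,0xf105030318],[0xf12203030f,18748160],[0xf007110310]],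
[[19338240,17236480,19161088,19292416,0xf320130309,0xf310130319,19091968],[19358720,19349504,19288320,19210496,19223552,19148800],[0xf410130312,19284224,0xf302130318,19354112,18694656],[19276032,19354624,19345408,0xf11313030b],[0xf22013030d,0xf130130309,0xf104130307],[19214848,0xf03113031a],[0xf022130317]],
[[0xf500310313,0xf410310315,0xf320310304,0xf23103030b,0xf300230314,0xf210230317],[0xf40131030c,19280128,0xf301230308,19346176,18752256],[0xf303030319,0xf212310313,0xf122310314,18945024],[0xf21123030c,19211008,0xf10323030b],[18879488,0xf014310311],[0xf005310317]],
[[0xf40113030c,0xf311130309,18961408,0xf13113030b,18821632],[19292672,19288576,19284480,19276288],[0xf203130304,19280384,0xf030330319],[0xf111330309,19292928],[18826240]],
[[18825984,18952960,18883328,18813696],[0xf203030313,19141632,0xf021510310],[0xf110430303,19096576],[0xf0107103011510308]],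
[[0xf202130308,19079680,18965248],[0xf10313031a,19153920],[0xf010530311]],
[[17170944,0xf011430309],[0xf001710311]],
[[0xf00153030c]]],
[[[0xf400050302,0xf110060316,0xf500040302,18825728,0xf240200302,0xf150200317,0xf140040302],[0xf501200310,0xf411200306,18952704,18878976,0xf14120030b,0xf051200306],[0xf410040302,18883072,0xf022050316,0xf13220030d,0xf050040302],[18813440,18695168,18751488,18822144],[0xf004050302,0xf130040306,0xf024200302],[0xf105200304,0xf015200307],[0xf014040302]],
[[0xf10016030b,0xf01016030e,0xf320300313,0xf310140311,0xf140300316,0xf210140312],[0xf401300308,19141376,18834432,0xf131300309,0xf041300306],[0xf102150310,0xf212300318,0xf130140318,0xf11214030c],[18956288,19222784,0xf023300314],[0xf12014030b,0xf030140316],[0xf00530030b]],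
[[0xf000260302,0xf311040303,0xf22104030c,0xf131040307,0xf200240302],[19096320,0xf211320302,0xf121320311,19083520],[0xf20304030c,0xf113040305,0xf02304030f],[0xf11124030c,0xf013320309],[0xf020240302]],
[[0xf1010703101150308,0xf211140311,0xf121140311,0xf031140315],[19161344,19349760,0xf101340312],[0xf103140315,0xf01314030c],[0xf01134030c]],
[[0xf000450302,0xf112040306,0xf100440302],[0xf10160030e,0xf013040308],[0xf002600302]],
[[0xf100700311,0xf01214030b],[0xf001700312]],
[[0xf002240302]]],
[[[0xf500210312,0xf010070311,0xf320210308,0xf310050317,0xf30005030b,0xf210050306],[0xf40121030b,19079424,18830336,19214336,0xf201050304],[18964992,0xf212210310,0xf130050307,0xf112050311],[19017728,19149312,0xf023210317],[0xf120050306,0xf014210312],[0xf005210306]],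
[[0xf000170312,0xf31031031a,18949120,0xf13031031a,0xf200150307],[19153664,0xf21131030d,0xf121310314,19206912],[0xf202310315,0xf112310315,0xf3101403110150311007030a],[19010304,0xf013310319],[0xf020150317]],
[[0xf301050311,0xf211050307,0xf121050305,0xf031050318],[19218944,19145216,0xf101250317],[0xf103050318,0xf013050307],[0xf003330312]],
[[0xf201150309,0xf11115030a,0xf021150307],[17236736,19357696],[0xf003150313]],
[[0xf100610316,0xf012050310],[0xf00161030b]],
[[0xf002150312]]],
[[[0xf400220302,17170688,0xf300060315,0xf130220317,0xf040140302],[0xf301140309,0xf211220310,18895104,0xf03122030f],[0xf210060310,18891008,0xf022140314],[19013888,19092480],[0xf004140302]],
[[0xf100170311,0xf210320312,0xf120320306,18747648],[19026688,0xf11132030d,18760448],[0xf110160305,0xf012320308],[18887424]],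
[[0xf20106030c,0xf111060310,0xf021060311],[19030528,19157504],[0xf003060313]],
[[0xf101160309,0xf011160304],[19337216]],
[[0xf000540302]]],
[[[0xf30015030c,0xf210150316,0xf120150314,0xf110070310],[18817792,19075840,18899968],[0xf10223030f,0xf012230319],[0xf003230312]],
[[0xf200330307,0xf11033031a,0xf020330310],[19227392,0xf011330313],[0xf010170313]],
[[0xf100350309,0xf011070313],[0xf001350313]],
[[0xf001170303]]],
[[[0xf200400301,0xf110400301,0xf020400301],[0xf101400301,0xf011400301],[0xf002400301]],
[[0xf100500301,0xf010500301],[0xf001500301]],
[[0xf000600301]]],
[[[0xf100410301,0xf010410301],[0xf001410301]],
[[0xf000510301]]],
[[[0xf000420301]]]]"

definition CE :: "nat \<Rightarrow> nat \<Rightarrow> nat \<Rightarrow> nat \<Rightarrow> hx list"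
  where "CE = look CE_table"

lemma CE_agree: "agree1 0 CE CE_table"
  by (rule agree1I) (simp add: CE_def)

lemmas CE_rules = CE_agree[unfolded CE_table_def dec_rules agree_rules]

text \<open>Six digits give the monomial. The stored numerals have a seventh, nonzero digit, which
  protects zeros at the end.\<close>

fun bdec :: "hx list \<Rightarrow> hx \<times> tup" where
  "bdec (z # a # b # c # d # e # l) = (z, (hex_nat a, hex_nat b, hex_nat c, hex_nat d, hex_nat e))" | "bdec l = (H0, (0, 0, 0, 0, 0))"

definition basis_list_table :: "(hx \<times> tup) list list"
  where "basis_list_table = map (map (\<lambda>n. bdec (dec n))) [[24252673,24191234,20009480,22094595,19994113,17905161,23269386,18043146,17244436,17240597,16979235,17109559,16978276,16847718,17182986,16856346,17855000,17854761,18886999,19943713,23081240,23073072,16802586,17830746,17893155,18941718,22151953,19072276,18219795,20316434,17827386,22085946,18944119,17961072,18161716,17969240,17915959,18046997,19988586,20254746],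
[18100760,18100521,18154281,18219798,18223158,19940118,19943478,18161719,18944356,24129801,23269641,24190999,19932439,17244439,19989080,18092592,24118033,16806201,21168921,21115161,22094598,17893158,20124674,17970194,18027076,17969477,20017154,17912357,17855237,20136192,23080986,17051706,17048346,20062986,20009226,17854746,17908506,17911866,16856840,16782186],
[19075161,18961160,18158120,17052437,19935321,19935560,19992680,22032920,17831480,16920920,17835319,16912752,16798512,19943718,24252678,19997478,22086441,24191239,18088755,24118035,18023477,20120837,17969717,18030676,17916674,20017156,17920034,20193552,19214354,19333392,17969226,17854986,17051946,18879786,23134986,22221066,19206426,20066586,20120346,16856841],
[19072280,18027556,19989560,17244440,18161720,17920036,17113874,19990039,17985552,20128276,20074754,17002756,17970436,21173000,19018520,22090280,20984597,18944357,16789877,17175313,20189953,19923793,17838201,16978041,18961161,19935561,18096432,19939639,22155558,17236272,24125712,20120586,20013066,17052186,18886746,20984106,17109306,18026586,20123946,17969466],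
[19072281,18023957,17916437,18968839,18162439,17117236,19989561,19993639,19990279,17175315,19009875,17961078,17846838,17899639,22094359,16978999,19084038,17897238,22033161,22090281,18092595,19927155,18031394,17977396,17974036,20017157,20197392,20251152,19333393,18023466,17915946,17052426,23138826,18886986,24183072,21168432,17912586,19210266,20124186,21041466],
[19076121,18968840,17985793,16868120,16975640,16979000,22094360,17892920,19993640,17113877,19990041,16913712,22159638,16859952,19943719,24314118,19997479,23269632,21168912,18096435,24125715,24183552,18031157,18031874,17974037,20251153,20058918,17838921,17961558,23073558,19337233,18941226,23142666,18887466,17916426,18023946,19267866,21041946,20128026,18027306],
[17958678,17893161,20059398,17831472,18231558,22032912,18096915,18100275,21115153,16920912,21049637,22094601,16979241,18166280,18952277,17839640,17900599,16974193,21168913,23269633,23269395,18154035,17240115,20005638,20254993,22090032,19333394,18031637,17977877,18038836,18879318,18945066,18941706,17117226,19271706,17974026,21102906,17920266,20131866,16847706]]"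

definition basis_list :: "nat \<Rightarrow> (hx \<times> tup) list"
  where "basis_list n = (if n < 7 then basis_list_table ! n else [])"

lemmas basis_list_table_eq = basis_list_table_def[unfolded dec_rules bdec.simps hex_nat.simps]

lemma basis_list_unfold:

  "basis_list 0 = basis_list_table ! 0"
  "basis_list (Suc 0) = basis_list_table ! (Suc 0)"
  "basis_list (Suc (Suc 0)) = basis_list_table ! (Suc (Suc 0))"
  "basis_list N3 = basis_list_table ! N3"
  "basis_list N4 = basis_list_table ! N4"
  "basis_list N5 = basis_list_table ! N5"
  "basis_list N6 = basis_list_table ! N6"
  by (simp_all add: basis_list_def)

lemmas basis_list_rules = basis_list_unfold[unfolded basis_list_table_eq nth_Cons_0 nth_Cons_Suc]

definition functional_at :: "hx \<Rightarrow> tup \<Rightarrow> hx \<times> hx"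
  where "functional_at z t = (case t of (a, b, c, d, e) \<Rightarrow> if z = HA then two (G10 a b c d) else sl z (G11 a b c d))"

lemma functional_at_rules:
  "functional_at H0 (a, b, c, d, e) = sl H0 (G11 a b c d)"
  "functional_at H1 (a, b, c, d, e) = sl H1 (G11 a b c d)"
  "functional_at H2 (a, b, c, d, e) = sl H2 (G11 a b c d)"
  "functional_at H3 (a, b, c, d, e) = sl H3 (G11 a b c d)"
  "functional_at H4 (a, b, c, d, e) = sl H4 (G11 a b c d)"
  "functional_at H5 (a, b, c, d, e) = sl H5 (G11 a b c d)"
  "functional_at H6 (a, b, c, d, e) = sl H6 (G11 a b c d)"
  "functional_at H7 (a, b, c, d, e) = sl H7 (G11 a b c d)"
  "functional_at H8 (a, b, c, d, e) = sl H8 (G11 a b c d)"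
  "functional_at H9 (a, b, c, d, e) = sl H9 (G11 a b c d)"
  "functional_at HA (a, b, c, d, e) = two (G10 a b c d)"
  by (simp_all only: functional_at_def prod.case hx.distinct if_True if_False simp_thms)

text \<open>The three-element sets form two orbits under rotation, those of {0, 1, 2} and {0, 1, 3}.
  Each set uses the entry of its representative, with the exponents rotated accordingly.\<close>

fun cert_entry :: "hx \<Rightarrow> tup \<Rightarrow> hx list" where
  "cert_entry H0 (a, b, c, d, e) = CA a b c d" |
  "cert_entry H1 (a, b, c, d, e) = CB a b c d" |
  "cert_entry H2 (a, b, c, d, e) = CA e a b c" |
  "cert_entry H3 (a, b, c, d, e) = CB c d e a" |
  "cert_entry H4 (a, b, c, d, e) = CB e a b c" |
  "cert_entry H5 (a, b, c, d, e) = CA d e a b" |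
  "cert_entry H6 (a, b, c, d, e) = CA b c d e" |
  "cert_entry H7 (a, b, c, d, e) = CB b c d e" |
  "cert_entry H8 (a, b, c, d, e) = CB d e a b" |
  "cert_entry H9 (a, b, c, d, e) = CA c d e a" |
  "cert_entry HA (a, b, c, d, e) = CE a b c d" |
  "cert_entry z t = []"

section \<open>Evaluation\<close>

text \<open>Runs through all exponent vectors of a given degree: the last argument is the degree
  still to be distributed, and the current exponent grows as it shrinks. The check becomes one large
  conjunction, to be settled by rewriting.\<close>

fun all_tup4 :: "(tup \<Rightarrow> bool) \<Rightarrow> nat \<Rightarrow> nat \<Rightarrow> nat \<Rightarrow> nat \<Rightarrow> nat \<Rightarrow> bool" where
  "all_tup4 f a b c d 0 = f (a, b, c, d, 0)"
| "all_tup4 f a b c d (Suc r) = (f (a, b, c, d, Suc r) \<and> all_tup4 f a b c (Suc d) r)"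

fun all_tup3 :: "(tup \<Rightarrow> bool) \<Rightarrow> nat \<Rightarrow> nat \<Rightarrow> nat \<Rightarrow> nat \<Rightarrow> bool" where
  "all_tup3 f a b c 0 = all_tup4 f a b c 0 0"
| "all_tup3 f a b c (Suc r) = (all_tup4 f a b c 0 (Suc r) \<and> all_tup3 f a b (Suc c) r)"

fun all_tup2 :: "(tup \<Rightarrow> bool) \<Rightarrow> nat \<Rightarrow> nat \<Rightarrow> nat \<Rightarrow> bool" where
  "all_tup2 f a b 0 = all_tup3 f a b 0 0"
| "all_tup2 f a b (Suc r) = (all_tup3 f a b 0 (Suc r) \<and> all_tup2 f a (Suc b) r)"

fun all_tup1 :: "(tup \<Rightarrow> bool) \<Rightarrow> nat \<Rightarrow> nat \<Rightarrow> bool" where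
  "all_tup1 f a 0 = all_tup2 f a 0 0"
| "all_tup1 f a (Suc r) = (all_tup2 f a 0 (Suc r) \<and> all_tup1 f (Suc a) r)"

lemma c4D: "all_tup4 f a b c d r \<Longrightarrow> i + e = r \<Longrightarrow> f (a, b, c, d + i, e)"
proof (induction f a b c d r arbitrary: i rule: all_tup4.induct)
  case (2 f a b c d r)
  then show ?case by (cases i) auto
qed simp

lemma c3D: "all_tup3 f a b c r \<Longrightarrow> i + d + e = r \<Longrightarrow> f (a, b, c + i, d, e)"
proof (induction f a b c r arbitrary: i rule: all_tup3.induct)
  case (2 f a b c r)
  then show ?case using c4D[of f a b c 0 "Suc r" d e] by (cases i) auto
qed (use c4D[of _ _ _ _ 0 0 0 0] in auto)

lemma c2D: "all_tup2 f a b r \<Longrightarrow> i + c + d + e = r \<Longrightarrow> f (a, b + i, c, d, e)"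
proof (induction f a b r arbitrary: i rule: all_tup2.induct)
  case (2 f a b r)
  then show ?case using c3D[of f a b 0 "Suc r" c d e] by (cases i) auto
qed (use c3D[of _ _ _ 0 0 0 0 0] in auto)

lemma c1D: "all_tup1 f a r \<Longrightarrow> i + b + c + d + e = r \<Longrightarrow> f (a + i, b, c, d, e)"
proof (induction f a r arbitrary: i rule: all_tup1.induct)
  case (2 f a r)
  then show ?case using c2D[of f a 0 "Suc r" b c d e] by (cases i) auto
qed (use c2D[of _ _ 0 0 0 0 0 0] in auto)

lemma all_tup1_all: "all_tup1 f 0 n \<Longrightarrow> tup_deg t = n \<Longrightarrow> f t"
  using c1D[of f 0 n] by (cases t) auto

lemma subs_rules:
  "subs 0 = [(0,0,0)]"
  "subs (Suc 0) = [(0,(Suc 0),0),((Suc 0),0,(Suc (Suc 0)))]"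
  "subs (Suc (Suc 0)) = [(0,(Suc (Suc 0)),0),((Suc (Suc 0)),0,N4)]"
  "subs N3 = [(0,N3,0),((Suc 0),(Suc (Suc 0)),(Suc (Suc 0))),((Suc (Suc 0)),(Suc 0),N4),(N3,0,N6)]"
  "subs N4 = [(0,N4,0),(N4,0,N8)]"
  "subs N5 = [(0,N5,0),((Suc 0),N4,(Suc (Suc 0))),(N4,(Suc 0),N8),(N5,0,N10)]"
  "subs N6 = [(0,N6,0),((Suc (Suc 0)),N4,N4),(N4,(Suc (Suc 0)),N8),(N6,0,N12)]"
  "subs N7 = [(0,N7,0),((Suc 0),N6,(Suc (Suc 0))),((Suc (Suc 0)),N5,N4),(N3,N4,N6),(N4,N3,N8),(N5,(Suc (Suc 0)),N10),(N6,(Suc 0),N12),(N7,0,N14)]"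
  "subs N8 = [(0,N8,0),(N8,0,N16)]"
  "subs N9 = [(0,N9,0),((Suc 0),N8,(Suc (Suc 0))),(N8,(Suc 0),N16),(N9,0,N18)]"
  "subs N10 = [(0,N10,0),((Suc (Suc 0)),N8,N4),(N8,(Suc (Suc 0)),N16),(N10,0,N20)]"
  by (simp_all add: subs_def binomial_Suc_Suc)

text \<open>Relations from three odd exponents have the same square part for every \<open>z\<close>,
  so all ten sets are evaluated at once on packed vectors.\<close>

fun functional_sum :: "tup list \<Rightarrow> hx list" where
  "functional_sum [] = []" | "functional_sum ((a, b, c, d, e) # l) = xor_vec (G11 a b c d) (functional_sum l)"

fun zero_pair :: "hx \<times> hx \<Rightarrow> bool" where
  "zero_pair (H0, H0) = True" | "zero_pair x = False"

definition vanish1 :: "nat \<Rightarrow> tup \<Rightarrow> bool" where "vanish1 a t = zero_vec (functional_sum (sq_tups a t))"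

definition vanish2 :: "tup \<Rightarrow> bool"
  where "vanish2 t = (zero_pair (xsum functional_at (r2 H0 t)) \<and> zero_pair (xsum functional_at (r2 H1 t)) \<and> zero_pair (xsum functional_at (r2 H2 t)) \<and>
    zero_pair (xsum functional_at (r2 H3 t)) \<and> zero_pair (xsum functional_at (r2 H4 t)))"

definition vanish3 :: "nat \<Rightarrow> tup \<Rightarrow> bool" where "vanish3 a t = zero_pair (xsum functional_at (r3 a t))"

definition certified_at :: "hx \<Rightarrow> tup \<Rightarrow> bool" where "certified_at z t = certified cert_entry basis_list z t (cert_entry z t)"

lemma zero_pair_iff: "zero_pair x \<longleftrightarrow> x = (H0, H0)"
  by (cases x rule: zero_pair.cases) auto

lemma xsum_xs: "is3 z \<Longrightarrow> xsum functional_at (map (Pair z) l) = sl z (functional_sum l)"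
proof (induction l)
  case Nil
  show ?case by (cases z) simp_all
next
  case (Cons t l)
  obtain a b c d e where t: "t = (a, b, c, d, e)" by (cases t)
  have "z \<noteq> HA" using Cons.prems by auto
  then have "functional_at z t = sl z (G11 a b c d)" by (simp add: functional_at_def t)
  then show ?case using Cons by (simp add: t sl_xor_vec)
qed

primrec twice :: "nat \<Rightarrow> nat" where "twice 0 = 0" | "twice (Suc n) = Suc (Suc (twice n))"

primrec set_weight :: "hx \<Rightarrow> nat" where
  "set_weight H0 = N7" |
  "set_weight H1 = N11" |
  "set_weight H2 = N19" |
  "set_weight H3 = N13" |
  "set_weight H4 = N21" |
  "set_weight H5 = N25" |
  "set_weight H6 = N14" |
  "set_weight H7 = N22" |
  "set_weight H8 = N26" |
  "set_weight H9 = N28" |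
  "set_weight HA = N31" |
  "set_weight HB = 0" |
  "set_weight HC = 0" |
  "set_weight HD = 0" |
  "set_weight HE = 0" |
  "set_weight HF = 0"

text \<open>Horner scheme for the weight of the exponent vector, doubled once more because the
  vector enters squared.\<close>

fun weight :: "hx \<times> tup \<Rightarrow> nat" where
  "weight (z, (a, b, c, d, e)) = ad (twice (ad a (twice (ad b (twice (ad c (twice (ad d (twice e))))))))) (set_weight z)"

text \<open>Repeated subtraction of 31, bounded by the first argument. Running out of steps makes
  the check fail, so success is sound for every bound.\<close>

fun mod_31 :: "nat \<Rightarrow> nat \<Rightarrow> nat option \<Rightarrow> nat \<Rightarrow> bool" where
  "mod_31 0 w m n = False" | "mod_31 (Suc f) w None n = (n = w)"
| "mod_31 (Suc f) w (Some m) n = mod_31 f w (sub_opt m N31) m"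

text \<open>The eight components at successive rotations of a monomial. With five rotations these
  are forty bits, and for the basis monomial at position p they must form the unit row p.\<close>

fun rows :: "nat \<Rightarrow> hx \<times> tup \<Rightarrow> bool list" where
  "rows 0 x = []"
| "rows (Suc n) (z, t) = (case functional_at z t of (a, b) \<Rightarrow> hbits a @ hbits b @ rows n (rot (z, t)))"

fun all_false :: "bool list \<Rightarrow> bool" where
  "all_false [] = True" | "all_false (True # l) = False" | "all_false (False # l) = all_false l"

fun unit_row :: "nat \<Rightarrow> bool list \<Rightarrow> bool" where
  "unit_row p [] = False" | "unit_row 0 (x # l) = (x \<and> all_false l)" | "unit_row (Suc p) (x # l) = (\<not> x \<and> unit_row p l)"

fun in_range :: "hx \<times> tup \<Rightarrow> bool" where
  "in_range (z, t) = (is3 z \<and> tup_deg t = N11 \<or> z = HA \<and> tup_deg t = N10)"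

definition basis_entry :: "nat \<Rightarrow> nat \<Rightarrow> hx \<times> tup \<Rightarrow> bool" where
  "basis_entry w p x = (in_range x \<and> mod_31 N16 w (sub_opt (weight x) N31) (weight x) \<and>
     unit_row p (rows N5 x))"

fun basis_ok :: "nat \<Rightarrow> nat \<Rightarrow> (hx \<times> tup) list \<Rightarrow> bool" where
  "basis_ok w p [] = (p = N40)" | "basis_ok w p (x # l) = (basis_entry w p x \<and> basis_ok w (Suc p) l)"

fun occurs_in :: "hx \<times> tup \<Rightarrow> (hx \<times> tup) list \<Rightarrow> bool" where
  "occurs_in x [] = False" | "occurs_in x (y # l) = (x = y \<or> occurs_in x l)"

fun rot_closed :: "(hx \<times> tup) list \<Rightarrow> (hx \<times> tup) list \<Rightarrow> bool" where
  "rot_closed [] l' = True" | "rot_closed (x # l) l' = (occurs_in (rot x) l' \<and> rot_closed l l')"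

lemmas functional_rules = simp_thms G11_rules G10_rules subs_rules sub_opt.simps ad.simps tup_deg.simps fin.simps
  go.simps goL.simps goM.simps append.simps sq_tups.simps functional_sum.simps zero_vec.simps all_tup1.simps all_tup2.simps all_tup3.simps all_tup4.simps
  vanish1_def vanish2_def vanish3_def xor_vec.simps xor_hex.simps hx.case functional_at_rules sl.simps two.simps drop_two.simps xor_pair.simps
  xsum.simps zero_pair.simps r1_def r2.simps r3.simps pairs_def cpairs.simps inc.simps list.map

lemmas spanning_rules = simp_thms CA_rules CB_rules CE_rules basis_list_rules subs_rules sub_opt.simps ad.simps tup_deg.simps
  fin.simps go.simps goL.simps goM.simps append.simps sq_tups.simps all_tup1.simps all_tup2.simps all_tup3.simps all_tup4.simps
  certified_at_def cert_entry.simps r1_def r2.simps r3.simps pairs_def cpairs.simps inc.simps list.map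
  certified.simps certified_rank.simps rel.simps rl.simps toggle_high.simps toggle_unless.simps toggle.simps toggle_aux.simps relation_of.simps
  relation1.simps relation2.simps relation3.simps less_nat.simps rank_of.simps hex_nat16.simps hex_nat.simps is3.simps ispos.simps basis_member.simps rot_opt.simps
  nth_opt.simps rot.simps rot_set.simps rot_tup.simps ev.simps cnt.simps odd1.simps
  prod.inject hx.distinct nat.inject nat.distinct option.inject option.distinct list.inject list.distinct

lemmas basis_rules = simp_thms G11_rules G10_rules basis_list_rules functional_at_rules sl.simps two.simps drop_two.simps
  sub_opt.simps ad.simps tup_deg.simps append.simps is3.simps hbits.simps twice.simps set_weight.simps weight.simps mod_31.simps
  rows.simps all_false.simps unit_row.simps in_range.simps basis_entry_def basis_ok.simps occurs_in.simps rot_closed.simps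
  rot.simps rot_set.simps rot_tup.simps prod.case
  prod.inject hx.distinct nat.inject nat.distinct

section \<open>Running the certificate\<close>

lemma vanish1_eval:
  "all_tup1 (vanish1 (Suc 0)) 0 N10"
  "all_tup1 (vanish1 (Suc (Suc 0))) 0 N9"
  "all_tup1 (vanish1 N3) 0 N8"
  "all_tup1 (vanish1 N4) 0 N7"
  "all_tup1 (vanish1 N5) 0 N6"
  "all_tup1 (vanish1 N6) 0 N5"
  "all_tup1 (vanish1 N7) 0 N4"
  "all_tup1 (vanish1 N8) 0 N3"
  "all_tup1 (vanish1 N9) 0 (Suc (Suc 0))"
  "all_tup1 (vanish1 N10) 0 (Suc 0)"
  "all_tup1 (vanish1 N11) 0 0"
  by (simp_all only: functional_rules)

lemma vanish2_eval: "all_tup1 vanish2 0 N10"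
  by (simp only: functional_rules)

lemma vanish3_eval:
  "all_tup1 (vanish3 (Suc 0)) 0 N9"
  "all_tup1 (vanish3 (Suc (Suc 0))) 0 N8"
  "all_tup1 (vanish3 N3) 0 N7"
  "all_tup1 (vanish3 N4) 0 N6"
  "all_tup1 (vanish3 N5) 0 N5"
  "all_tup1 (vanish3 N6) 0 N4"
  "all_tup1 (vanish3 N7) 0 N3"
  "all_tup1 (vanish3 N8) 0 (Suc (Suc 0))"
  "all_tup1 (vanish3 N9) 0 (Suc 0)"
  "all_tup1 (vanish3 N10) 0 0"
  by (simp_all only: functional_rules)

lemma certified_at_eval: "all_tup1 (certified_at H0) 0 N11" "all_tup1 (certified_at H1) 0 N11" "all_tup1 (certified_at HA) 0 N10"
  by (simp_all only: spanning_rules)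

lemma basis_ok_eval:
  "basis_ok 0 0 (basis_list 0)"
  "basis_ok (Suc 0) 0 (basis_list (Suc 0))"
  "basis_ok N3 0 (basis_list (Suc (Suc 0)))"
  "basis_ok N5 0 (basis_list N3)"
  "basis_ok N7 0 (basis_list N4)"
  "basis_ok N11 0 (basis_list N5)"
  "basis_ok N15 0 (basis_list N6)"
  by (simp_all only: basis_rules)

lemma rot_closed_eval: "rot_closed (basis_list 0) (basis_list 0)"
  by (simp only: basis_rules)

section \<open>From the evaluated checks to the assumptions on the certificate\<close>

lemma vanish1_all:
  assumes "0 < a" "tup_deg y + a = 11"
  shows "vanish1 a y"
proof -
  have "a = (Suc 0) \<or> a = (Suc (Suc 0)) \<or> a = N3 \<or> a = N4 \<or> a = N5 \<or> a = N6 \<or> a = N7 \<or> a = N8 \<or> a = N9 \<or> a = N10 \<or> a = N11"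
    using assms by arith
  from this assms(2) show ?thesis
    by (elim disjE) (hypsubst, rule vanish1_eval[THEN all_tup1_all], arith)+
qed

lemma vanish3_all:
  assumes "0 < a" "tup_deg y + a = 10"
  shows "vanish3 a y"
proof -
  have "a = (Suc 0) \<or> a = (Suc (Suc 0)) \<or> a = N3 \<or> a = N4 \<or> a = N5 \<or> a = N6 \<or> a = N7 \<or> a = N8 \<or> a = N9 \<or> a = N10"
    using assms by arith
  from this assms(2) show ?thesis
    by (elim disjE) (hypsubst, rule vanish3_eval[THEN all_tup1_all], arith)+
qed

lemma all_false_nth: "all_false l \<Longrightarrow> q < length l \<Longrightarrow> \<not> l ! q"
  by (induction l arbitrary: q rule: all_false.induct) (auto simp: nth_Cons split: nat.splits)

lemma unit_row_nth: "unit_row p l \<Longrightarrow> q < length l \<Longrightarrow> l ! q = (q = p)"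
  by (induction p l arbitrary: q rule: unit_row.induct) (auto simp: nth_Cons all_false_nth split: nat.splits)

lemma length_rows: "length (rows m x) = 8 * m"
  by (induction m x rule: rows.induct) (auto split: prod.splits)

lemma rows_nth:
  assumes "n < m" "r < 8"
  shows "of_bool (rows m x ! (8 * n + r)) = hex_comp r (case (rot ^^ n) x of (z, t) \<Rightarrow> functional_at z t)"
  using assms
proof (induction n arbitrary: m x)
  case 0
  then obtain m' where "m = Suc m'" by (cases m) auto
  then show ?case using 0 by (cases x) (auto simp: hex_comp_def nth_append split: prod.splits)
next
  case (Suc n)
  then obtain m' where m: "m = Suc m'" "n < m'" by (cases m) auto
  obtain z t where x: "x = (z, t)" by (cases x)
  have "rows m x ! (8 * Suc n + r) = rows m' (rot x) ! (8 * n + r)"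
    using m by (simp add: x nth_append split: prod.splits)
  then show ?case using Suc.IH[OF m(2) Suc.prems(2)] by (simp add: funpow_swap1 del: rot.simps)
qed

lemma twice_eq: "twice n = 2 * n"
  by (induction n) auto

lemma weight_eq:
  assumes "is3 z \<or> z = HA"
  shows "mono_weight (ex (z, t)) = weight (z, t)"
proof -
  obtain a b c d e where t: "t = (a, b, c, d, e)" by (cases t)
  have "mono_weight (ym t) = a + 2 * b + 4 * c + 8 * d + 16 * e"
    by (simp add: mono_weight_def sum_5 wcoef_simps t lookup_ym)
  moreover have "mono_weight (ind (zs z)) = set_weight z"
    using assms by (cases z) (simp_all add: mono_weight_def sum_5 wcoef_simps lookup_ind)
  ultimately show ?thesis by (simp add: ex_def mono_weight_add twice_eq t)
qed

lemma mod_31_mod: "w < 31 \<Longrightarrow> mod_31 f w (sub_opt n 31) n \<Longrightarrow> n mod 31 = w"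
proof (induction f arbitrary: n)
  case (Suc f)
  have s: "N31 = (31 :: nat)" by simp
  show ?case
  proof (cases "31 \<le> n")
    case True
    then have "mod_31 f w (sub_opt (n - 31) 31) (n - 31)"
      using Suc.prems by (simp only: sub_opt_eq[of n 31] mod_31.simps if_True s)
    then have "(n - 31) mod 31 = w" using Suc by blast
    then show ?thesis using True by (simp add: le_mod_geq)
  next
    case False
    then have "n = w" using Suc.prems by (simp add: sub_opt_eq[of n 31])
    then show ?thesis using Suc.prems by simp
  qed
qed simp

lemma cbD: "basis_ok w p l \<Longrightarrow> p + length l = 40 \<and> (\<forall>i<length l. basis_entry w (p + i) (l ! i))"
proof (induction w p l rule: basis_ok.induct)
  case (2 w p x l)
  then show ?case by (auto simp: nth_Cons split: nat.splits)
qed simp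

lemma wreps_rules: "wreps ! 0 = 0" "wreps ! (Suc 0) = (Suc 0)" "wreps ! (Suc (Suc 0)) = N3" "wreps ! N3 = N5" "wreps ! N4 = N7" "wreps ! N5 = N11" "wreps ! N6 = N15"
  by (simp_all add: wreps_def)

lemma basis_ok_all:
  assumes "c < 7"
  shows "basis_ok (wreps ! c) 0 (basis_list c)"
proof -
  have "c = 0 \<or> c = (Suc 0) \<or> c = (Suc (Suc 0)) \<or> c = N3 \<or> c = N4 \<or> c = N5 \<or> c = N6"
    using assms by arith
  then show ?thesis by (elim disjE) (hypsubst, subst wreps_rules, rule basis_ok_eval)+
qed

lemma wreps_less: "c < 7 \<Longrightarrow> wreps ! c < 31"
  by (cases c rule: nat.exhaust) (auto simp: wreps_def nth_Cons split: nat.splits)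

lemma occurs_in_iff: "occurs_in x l \<longleftrightarrow> x \<in> set l"
  by (induction l) auto

lemma rot_closed_iff: "rot_closed l l' \<longleftrightarrow> (\<forall>x\<in>set l. rot x \<in> set l')"
  by (induction l) (auto simp: occurs_in_iff simp del: rot.simps)

lemma basis_entry_all:
  assumes "c < 7" "p < 40"
  shows "basis_entry (wreps ! c) p (basis_list c ! p)" and "length (basis_list c) = 40"
  using cbD[OF basis_ok_all[OF assms(1)]] assms by auto

lemma in_range_valid: "in_range x \<longleftrightarrow> valid x"
  by (cases x) (simp add: valid_def numeral_eq_Suc)

interpretation certificate functional_at cert_entry basis_list
proof
  fix z :: hx and t y g :: tup and a k :: nat
  show "xsum functional_at (r1 z a y) = (H0, H0)" if "is3 z" "0 < a" "tup_deg y + a = 11" for z a y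
    using vanish1_all[OF that(2,3)] by (simp add: r1_def xsum_xs[OF that(1)] vanish1_def zero_vec_sl)
  show "xsum functional_at (r2 k g) = (H0, H0)" if "ispos k" "tup_deg g = 10" for k g
  proof -
    have "vanish2 g" by (rule all_tup1_all[OF vanish2_eval]) (use that in simp)
    then show ?thesis using that by (auto simp: vanish2_def zero_pair_iff ispos_iff simp del: r2.simps xsum.simps)
  qed
  show "xsum functional_at (r3 a y) = (H0, H0)" if "0 < a" "tup_deg y + a = 10" for a y
    using vanish3_all[OF that] by (simp add: vanish3_def zero_pair_iff)
  show "\<exists>n z t. (rot ^^ n) x = (z, t) \<and> z \<in> {H0, H1, HA} \<and> cert_entry z t = cert_entry (fst x) (snd x)" if "valid x" for x
  proof -
    obtain z a b c d e where x: "x = (z, (a, b, c, d, e))" by (cases x) auto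
    \<comment> \<open>The witness counts the rotations that carry the set to {0, 1, 2}, {0, 1, 3} or
      the full set.\<close>
    show ?thesis
    proof (cases z)
      case H0
      then show ?thesis by (intro exI[of _ "0 :: nat"]) (simp add: x numeral_eq_Suc)
    next
      case H1
      then show ?thesis by (intro exI[of _ "0 :: nat"]) (simp add: x numeral_eq_Suc)
    next
      case H2
      then show ?thesis by (intro exI[of _ "1 :: nat"]) (simp add: x numeral_eq_Suc)
    next
      case H3
      then show ?thesis by (intro exI[of _ "3 :: nat"]) (simp add: x numeral_eq_Suc)
    next
      case H4
      then show ?thesis by (intro exI[of _ "1 :: nat"]) (simp add: x numeral_eq_Suc)
    next
      case H5
      then show ?thesis by (intro exI[of _ "2 :: nat"]) (simp add: x numeral_eq_Suc)
    next
      case H6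
      then show ?thesis by (intro exI[of _ "4 :: nat"]) (simp add: x numeral_eq_Suc)
    next
      case H7
      then show ?thesis by (intro exI[of _ "4 :: nat"]) (simp add: x numeral_eq_Suc)
    next
      case H8
      then show ?thesis by (intro exI[of _ "2 :: nat"]) (simp add: x numeral_eq_Suc)
    next
      case H9
      then show ?thesis by (intro exI[of _ "3 :: nat"]) (simp add: x numeral_eq_Suc)
    next
      case HA
      then show ?thesis by (intro exI[of _ "0 :: nat"]) (simp add: x numeral_eq_Suc)
    qed (use that in \<open>simp_all add: x valid_def\<close>)
  qed
  show "certified cert_entry basis_list z t (cert_entry z t)" if "z \<in> {H0, H1, HA}" "valid (z, t)" for z t
  proof -
    have "certified_at z t"
      using that all_tup1_all[OF certified_at_eval(1), of t] all_tup1_all[OF certified_at_eval(2), of t] all_tup1_all[OF certified_at_eval(3), of t]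
      by (auto simp: valid_def)
    then show ?thesis by (simp only: certified_at_def)
  qed
  show "length (basis_list c) = 40" if "c < 7" for c
    using basis_entry_all(2)[of c 0] that by simp
  show "basis_list c = []" if "7 \<le> c" for c
    using that by (simp add: basis_list_def)
  fix c p :: nat
  assume cp: "c < 7" "p < 40"
  note b = basis_entry_all(1)[OF cp, unfolded basis_entry_def in_range_valid]
  show v: "valid (basis_list c ! p)" using b by blast
  have "mono_weight (ex (basis_list c ! p)) = weight (basis_list c ! p)"
    using v weight_eq[of "fst (basis_list c ! p)" "snd (basis_list c ! p)"] by (auto simp: valid_def)
  moreover have "mod_31 N16 (wreps ! c) (sub_opt (weight (basis_list c ! p)) 31) (weight (basis_list c ! p))"
    using b by (simp add: numeral_eq_Suc)
  ultimately show "mono_weight (ex (basis_list c ! p)) mod 31 = wreps ! c"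
    using mod_31_mod[OF wreps_less[OF cp(1)]] by simp
  show "hex_comp r (case (rot ^^ n) (basis_list c ! p) of (z, t) \<Rightarrow> functional_at z t) = of_bool (p = 8 * n + r)" if "n < 5" "r < 8" for n r
  proof -
    have "unit_row p (rows 5 (basis_list c ! p))" using b by (simp add: numeral_eq_Suc)
    then have "rows 5 (basis_list c ! p) ! (8 * n + r) = (8 * n + r = p)"
      by (rule unit_row_nth) (use that in \<open>simp add: length_rows\<close>)
    then show ?thesis using rows_nth[OF that, of "basis_list c ! p"] by auto
  qed
qed (use rot_closed_eval in \<open>simp_all add: rot_closed_iff del: rot.simps\<close>)

lemma degree_25: "\<exists>B :: (5, K) mpol set. qbas tw 25 B \<and> card B = 1240"
  using qbas_25 card_bas by blast

theorem theorem4p10: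
  fixes s :: nat
  assumes "0 < s"
  shows "QP.dim (QP_deg (15 * 2 ^ s - 5) :: 5 QP set) = 1240"
  using degree_25 reduction_to_degree_25[OF assms] by metis

end
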